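(* The Sliding Token problem can be solved in linear time for trees.
   Context: Sliding Token problem: given a graph $G$ and two independent sets $I_b$ and $I_r$ of $G$ with $|I_b|=|I_r|$ (a token placed on each vertex of $I_b$), decide whether there is a sequence of independent sets $\langle I_1,\ldots,I_\ell\rangle$ with $I_1=I_b$, $I_\ell=I_r$, all of the same size, such that each $I_i$ is obtained from $I_{i-1}$ by sliding exactly one token along an edge, i.e., $I_{i-1}\setminus I_i=\{u\}$, $I_i\setminus I_{i-1}=\{v\}$ for some edge $\{u,v\}$ of $G$. Here $G$ is a tree with $n$ vertices, and linear time means $O(n)$. *)

theory Defs
  imports Complex_Main "HOL-Library.Landau_Symbols"
begin

section \<open>Finite simple graphs and trees\<close>

definition simple_graph :: "'v set \<Rightarrow> 'v set set \<Rightarrow> bool" where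
  "simple_graph V E \<longleftrightarrow> finite V \<and> (\<forall>e\<in>E. \<exists>u v. u \<in> V \<and> v \<in> V \<and> u \<noteq> v \<and> e = {u, v})"

definition walk :: "'v set \<Rightarrow> 'v set set \<Rightarrow> 'v list \<Rightarrow> bool" where
  "walk V E p \<longleftrightarrow> p \<noteq> [] \<and> set p \<subseteq> V \<and> successively (\<lambda>u v. {u, v} \<in> E) p"

definition connected_graph :: "'v set \<Rightarrow> 'v set set \<Rightarrow> bool" where
  "connected_graph V E \<longleftrightarrow>
     V \<noteq> {} \<and> (\<forall>u\<in>V. \<forall>v\<in>V. \<exists>p. walk V E p \<and> hd p = u \<and> last p = v)"

text \<open>A cycle is given by the list of its vertices, without repeating the first one at the end.\<close>

definition cycle :: "'v set \<Rightarrow> 'v set set \<Rightarrow> 'v list \<Rightarrow> bool" where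
  "cycle V E p \<longleftrightarrow> walk V E p \<and> distinct p \<and> 3 \<le> length p \<and> {last p, hd p} \<in> E"

definition tree :: "'v set \<Rightarrow> 'v set set \<Rightarrow> bool" where
  "tree V E \<longleftrightarrow> simple_graph V E \<and> connected_graph V E \<and> \<not> (\<exists>p. cycle V E p)"


section \<open>The Sliding Token problem\<close>

definition independent_set :: "'v set \<Rightarrow> 'v set set \<Rightarrow> 'v set \<Rightarrow> bool" where
  "independent_set V E I \<longleftrightarrow> I \<subseteq> V \<and> (\<forall>u\<in>I. \<forall>v\<in>I. {u, v} \<notin> E)"

definition slide :: "'v set set \<Rightarrow> 'v set \<Rightarrow> 'v set \<Rightarrow> bool" where
  "slide E I J \<longleftrightarrow> (\<exists>u v. I - J = {u} \<and> J - I = {v} \<and> {u, v} \<in> E)"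

definition sliding_token_instance ::
    "'v set \<Rightarrow> 'v set set \<Rightarrow> 'v set \<Rightarrow> 'v set \<Rightarrow> bool" where
  "sliding_token_instance V E I\<^sub>b I\<^sub>r \<longleftrightarrow>
     simple_graph V E \<and> independent_set V E I\<^sub>b \<and> independent_set V E I\<^sub>r \<and> card I\<^sub>b = card I\<^sub>r"

definition sliding_token :: "'v set \<Rightarrow> 'v set set \<Rightarrow> 'v set \<Rightarrow> 'v set \<Rightarrow> bool" where
  "sliding_token V E I\<^sub>b I\<^sub>r \<longleftrightarrow>
     (\<exists>Is. Is \<noteq> [] \<and> hd Is = I\<^sub>b \<and> last Is = I\<^sub>r \<and>
        (\<forall>I\<in>set Is. independent_set V E I \<and> card I = card I\<^sub>b) \<and>
        successively (slide E) Is)"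


section \<open>Random access machines\<close>

text \<open>
  The unit-cost RAM of Cook and Reckhow over the natural numbers (so subtraction is truncated):
  registers \<open>X\<^sub>0, X\<^sub>1, \<dots>\<close>, initially all zero, and a read-only input tape that is read from left
  to right. \<open>Load i j\<close> is \<open>X\<^sub>i := X\<close>[\<open>X\<^sub>j\<close>] and \<open>Store i j\<close> is \<open>X\<close>[\<open>X\<^sub>i\<close>]\<open> := X\<^sub>j\<close>. Reading past the end of the
  input yields zero. The machine halts when the program counter leaves the program.
\<close>

datatype instr =
    Const nat nat
  | Add nat nat nat
  | Sub nat nat nat
  | Load nat nat
  | Store nat nat
  | Read nat
  | JumpPos nat nat

record config =
  pc :: nat
  reg :: "nat \<Rightarrow> nat"
  tape :: "nat list"

fun exec :: "instr \<Rightarrow> config \<Rightarrow> config" where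
  "exec (Const i k) s = s\<lparr>pc := Suc (pc s), reg := (reg s)(i := k)\<rparr>"
| "exec (Add i j k) s = s\<lparr>pc := Suc (pc s), reg := (reg s)(i := reg s j + reg s k)\<rparr>"
| "exec (Sub i j k) s = s\<lparr>pc := Suc (pc s), reg := (reg s)(i := reg s j - reg s k)\<rparr>"
| "exec (Load i j) s = s\<lparr>pc := Suc (pc s), reg := (reg s)(i := reg s (reg s j))\<rparr>"
| "exec (Store i j) s = s\<lparr>pc := Suc (pc s), reg := (reg s)(reg s i := reg s j)\<rparr>"
| "exec (Read i) s =
     s\<lparr>pc := Suc (pc s),
       reg := (reg s)(i := (case tape s of [] \<Rightarrow> 0 | x # _ \<Rightarrow> x)),
       tape := tl (tape s)\<rparr>"
| "exec (JumpPos i l) s = s\<lparr>pc := (if 0 < reg s i then l else Suc (pc s))\<rparr>"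

type_synonym program = "instr list"

definition halted :: "program \<Rightarrow> config \<Rightarrow> bool" where
  "halted P s \<longleftrightarrow> length P \<le> pc s"

definition step :: "program \<Rightarrow> config \<Rightarrow> config" where
  "step P s = (if halted P s then s else exec (P ! pc s) s)"

definition run :: "program \<Rightarrow> nat list \<Rightarrow> nat \<Rightarrow> config" where
  "run P inp t = (step P ^^ t) \<lparr>pc = 0, reg = (\<lambda>_. 0), tape = inp\<rparr>"

text \<open>
  Within \<open>T\<close> steps \<open>P\<close> halts on \<open>inp\<close> with the truth value \<open>b\<close> in register \<open>0\<close>, and at no time
  does a register hold more than a \<open>w\<close>-bit word. The word length keeps the unit-cost measure
  honest: without it, repeated addition would create numbers with linearly many bits.
\<close>

definition decides_within ::
    "program \<Rightarrow> nat \<Rightarrow> nat \<Rightarrow> nat list \<Rightarrow> bool \<Rightarrow> bool" where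
  "decides_within P w T inp b \<longleftrightarrow>
     (\<exists>t\<le>T. halted P (run P inp t) \<and> reg (run P inp t) 0 = (if b then 1 else 0) \<and>
        (\<forall>s\<le>t. \<forall>r. reg (run P inp s) r < 2 ^ w))"


section \<open>Encoding of instances\<close>

definition enumerates :: "'a list \<Rightarrow> 'a set \<Rightarrow> bool" where
  "enumerates xs A \<longleftrightarrow> distinct xs \<and> set xs = A"

text \<open>
  The vertices are \<open>0, \<dots>, n - 1\<close>. An instance is presented as the number of vertices, the list of
  edges, and the lists of the vertices carrying a token in \<open>I\<^sub>b\<close> and in \<open>I\<^sub>r\<close>; each list is in
  arbitrary order and preceded by its length, and each edge is listed once, as its two end
  vertices in either order.
\<close>

definition encodes ::
    "nat list \<Rightarrow> nat \<Rightarrow> nat set set \<Rightarrow> nat set \<Rightarrow> nat set \<Rightarrow> bool" where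
  "encodes inp n E I\<^sub>b I\<^sub>r \<longleftrightarrow>
     (\<exists>es bs rs.
        enumerates (map (\<lambda>(u, v). {u, v}) es) E \<and> enumerates bs I\<^sub>b \<and> enumerates rs I\<^sub>r \<and>
        inp = [n, length es] @ concat (map (\<lambda>(u, v). [u, v]) es)
              @ [length bs] @ bs @ [length rs] @ rs)"

end

theory Submission
  imports Defs "HOL-Real_Asymp.Real_Asymp"
begin

text \<open>
  A set \<open>S\<close> of tokens is frozen if every neighbour of a vertex of \<open>S\<close> has a second neighbour in \<open>S\<close>:
  no token of \<open>S\<close> can ever move. In a forest the greatest frozen set \<open>R\<close> consists of all tokens that
  never move. Two token sets are reconfigurable into each other iff they have the same \<open>R\<close> and
  equally many tokens in every component of the graph without the closed neighbourhood of \<open>R\<close>.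
  For sufficiency \<open>R\<close> is empty; then a token can be brought to any vertex of a component that has
  tokens. One takes a leaf \<open>v\<close> whose neighbour \<open>u\<close> has only leaves as neighbours, with at most one
  exception, brings a token to \<open>v\<close> on both sides, and deletes \<open>u\<close> and its leaves.

  The algorithm orders the vertices by repeatedly cutting off leaves. A pass from the leaves to the
  roots finds the tokens that are stuck within the subtree below them, a pass back finds \<open>R\<close>, and a
  last pass from the leaves adds up the numbers of tokens in the components.
\<close>



section \<open>Sliding tokens in forests\<close>

text \<open>A token that lies in no frozen set merely has no certificate of immobility; the
  combinatorial work is to turn this into actual slides. If a token on \<open>w\<close> cannot be
  freed, then every neighbour \<open>z\<close> of \<open>w\<close> has another token next to it that
  is rigid once \<open>z\<close> is deleted, and the union of these rigid sets with \<open>w\<close>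
  is frozen. Acyclicity enters where the neighbours of \<open>z\<close> are cleared: without
  \<open>z\<close> they lie in different components, so clearing one of them never refills another.
  On the machine, time, word length and correctness have to be bounded together. A small structured
  language therefore carries a credit that pays for time and a bound \<open>B\<close> on the numbers
  written, and one simulation result transfers both to the RAM. The word length is dictated by the
  elimination order: each vertex stores the sum of its neighbours instead of an adjacency list. Such
  sums can be of order \<open>n * n\<close>, which costs two logarithms plus a constant.\<close>

text \<open>Subgraphs are given by vertex subsets \<open>U\<close> of one fixed edge set \<open>E\<close>. Acyclicity is used in the
  form that every edge is a bridge, which passes to subsets at once.\<close>

definition bridged :: "'v set set \<Rightarrow> 'v set \<Rightarrow> bool" where
  "bridged E U \<longleftrightarrow> (\<forall>y\<in>U. \<forall>z\<in>U. {y, z} \<in> E \<longrightarrow>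
     (\<exists>C\<subseteq>U. y \<in> C \<and> z \<notin> C \<and> (\<forall>a\<in>C. \<forall>b\<in>U - C. {a, b} \<in> E \<longrightarrow> a = y \<and> b = z)))"

definition closed_in :: "'v set set \<Rightarrow> 'v set \<Rightarrow> 'v set \<Rightarrow> bool" where
  "closed_in E U C \<longleftrightarrow> C \<subseteq> U \<and> (\<forall>a\<in>C. \<forall>b\<in>U. {a, b} \<in> E \<longrightarrow> b \<in> C)"

definition frozen :: "'v set set \<Rightarrow> 'v set \<Rightarrow> 'v set \<Rightarrow> 'v set \<Rightarrow> bool" where
  "frozen E U I S \<longleftrightarrow> S \<subseteq> I \<inter> U \<and>
     (\<forall>u\<in>S. \<forall>z\<in>U. {u, z} \<in> E \<longrightarrow> (\<exists>u'\<in>S. u' \<noteq> u \<and> {u', z} \<in> E))"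

definition rigid :: "'v set set \<Rightarrow> 'v set \<Rightarrow> 'v set \<Rightarrow> 'v set" where
  "rigid E U I = \<Union>{S. frozen E U I S}"

definition move :: "'v set set \<Rightarrow> 'v set \<Rightarrow> 'v set \<Rightarrow> 'v set \<Rightarrow> bool" where
  "move E U I J \<longleftrightarrow> independent_set U E I \<and> independent_set U E J \<and> slide E I J"

abbreviation reach :: "'v set set \<Rightarrow> 'v set \<Rightarrow> 'v set \<Rightarrow> 'v set \<Rightarrow> bool" where
  "reach E U \<equiv> (move E U)\<^sup>*\<^sup>*"

section \<open>Acyclic graphs and their bridges\<close>

text \<open>Loop erasure: whenever the next vertex already lies on the path, the path is cut back to
  it. This supplies the distinctness that a cycle requires.\<close>

lemma successively_distinct_path:
  assumes "r\<^sup>*\<^sup>* a b"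
  shows "\<exists>p. p \<noteq> [] \<and> hd p = a \<and> last p = b \<and> successively r p \<and> distinct p"
  using assms
proof induction
  case base
  show ?case by (rule exI[of _ "[a]"]) simp
next
  case (step b c)
  then obtain p where p: "p \<noteq> []" "hd p = a" "last p = b" "successively r p" "distinct p"
    by blast
  show ?case
  proof (cases "c \<in> set p")
    case True
    then obtain q q' where q: "p = (q @ [c]) @ q'"
      by (metis append_Cons append_Nil append_assoc split_list)
    have "successively r (q @ [c])"
      using p(4) unfolding q successively_append_iff by blast
    moreover have "hd (q @ [c]) = a"
      using p(2) unfolding q by (cases q) auto
    ultimately show ?thesis
      using p(5) unfolding q by (intro exI[of _ "q @ [c]"]) auto
  next
    case False
    with p step(2) show ?thesis
      by (intro exI[of _ "p @ [c]"]) (auto simp: successively_append_iff)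
  qed
qed

text \<open>A simple path from \<open>y\<close> to \<open>z\<close> that avoids the edge
  \<open>{y, z}\<close> would be closed to a cycle by that edge. Hence the vertices reachable from
  \<open>y\<close> without this edge form the required side of the cut.\<close>

lemma bridged_if_acyclic:
  assumes "simple_graph V E" "\<nexists>p. cycle V E p"
  shows "bridged E V"
  unfolding bridged_def
proof (intro ballI impI)
  fix y z assume yz: "y \<in> V" "z \<in> V" "{y, z} \<in> E"
  define r where "r a b \<longleftrightarrow> a \<in> V \<and> b \<in> V \<and> {a, b} \<in> E \<and> {a, b} \<noteq> {y, z}" for a b
  have "\<not> r\<^sup>*\<^sup>* y z"
  proof
    assume "r\<^sup>*\<^sup>* y z"
    then obtain p where p: "p \<noteq> []" "hd p = y" "last p = z" "successively r p" "distinct p"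
      using successively_distinct_path by metis
    have "y \<noteq> z"
      using assms(1) yz unfolding simple_graph_def by (metis doubleton_eq_iff)
    then obtain b q where pq: "p = y # b # q"
      using p by (cases p rule: remdups_adj.cases) auto
    \<comment> \<open>A path with only two vertices would use the edge \<open>{y, z}\<close>, which
      \<open>r\<close> excludes; so the cycle has at least three vertices.\<close>
    have "q \<noteq> []"
      using p(3,4) unfolding pq by (auto simp: r_def)
    then have len: "3 \<le> length p"
      unfolding pq by (cases q) auto
    have "set p' \<subseteq> V" if "successively r p'" "hd p' \<in> V" for p'
      using that by (induction p' rule: induct_list012) (auto simp: r_def)
    then have "set p \<subseteq> V"
      using p yz by simp
    moreover have "successively (\<lambda>u v. {u, v} \<in> E) p"
      using p(4) by (rule successively_mono) (auto simp: r_def)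
    ultimately have "cycle V E p"
      using p len yz(3) by (simp add: cycle_def walk_def insert_commute)
    with assms(2) show False by blast
  qed
  moreover have "b \<in> V \<Longrightarrow> b = z \<and> a = y" if "r\<^sup>*\<^sup>* y a" "{a, b} \<in> E" "\<not> r\<^sup>*\<^sup>* y b" "a \<in> V" for a b
  proof -
    assume "b \<in> V"
    have "\<not> r a b" using that rtranclp.rtrancl_into_rtrancl by metis
    then have "{a, b} = {y, z}"
      using that \<open>b \<in> V\<close> by (auto simp: r_def)
    then show ?thesis
      using that(3) by (auto simp: doubleton_eq_iff)
  qed
  ultimately show "\<exists>C\<subseteq>V. y \<in> C \<and> z \<notin> C \<and> (\<forall>a\<in>C. \<forall>b\<in>V - C. {a, b} \<in> E \<longrightarrow> a = y \<and> b = z)"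
    using yz by (intro exI[of _ "{x \<in> V. r\<^sup>*\<^sup>* y x}"]) auto
qed

lemma bridged_subset:
  assumes "bridged E U" "U' \<subseteq> U"
  shows "bridged E U'"
  unfolding bridged_def
proof (intro ballI impI)
  fix y z assume yz: "y \<in> U'" "z \<in> U'" "{y, z} \<in> E"
  then obtain C where "C \<subseteq> U" "y \<in> C" "z \<notin> C" "\<forall>a\<in>C. \<forall>b\<in>U - C. {a, b} \<in> E \<longrightarrow> a = y \<and> b = z"
    using assms unfolding bridged_def by (metis subsetD)
  then show "\<exists>C\<subseteq>U'. y \<in> C \<and> z \<notin> C \<and> (\<forall>a\<in>C. \<forall>b\<in>U' - C. {a, b} \<in> E \<longrightarrow> a = y \<and> b = z)"
    using yz assms(2) by (intro exI[of _ "C \<inter> U'"]) auto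
qed

lemma bridged_irrefl: "bridged E U \<Longrightarrow> x \<in> U \<Longrightarrow> {x, x} \<notin> E"
  unfolding bridged_def by blast

text \<open>\<open>u\<close> is the end of an edge whose cut is minimal among those where \<open>u\<close> has a further neighbour
  on its own side.\<close>

lemma bridged_safe_vertex:
  assumes br: "bridged E U" and fin: "finite U" and ab: "a \<in> U" "b \<in> U" "{a, b} \<in> E"
  obtains u p v where "u \<in> U" "v \<in> U" "{x \<in> U. {v, x} \<in> E} = {u}"
    "\<And>y. y \<in> U \<Longrightarrow> {u, y} \<in> E \<Longrightarrow> y = p \<or> {x \<in> U. {y, x} \<in> E} = {u}"
proof -
  define cut where "cut C u p \<longleftrightarrow> C \<subseteq> U \<and> u \<in> C \<and> p \<in> U - C \<and> {u, p} \<in> E \<and>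
      (\<forall>a\<in>C. \<forall>b\<in>U - C. {a, b} \<in> E \<longrightarrow> a = u \<and> b = p)" for C u p
  have ex_cut: "\<exists>C. cut C u p" if up: "u \<in> U" "p \<in> U" "{u, p} \<in> E" for u p
  proof -
    obtain C where "C \<subseteq> U" "u \<in> C" "p \<notin> C" "\<forall>a\<in>C. \<forall>b\<in>U - C. {a, b} \<in> E \<longrightarrow> a = u \<and> b = p"
      using br[unfolded bridged_def, rule_format, OF up] by blast
    with up show ?thesis unfolding cut_def by blast
  qed
  have leaf: "{x \<in> U. {u, x} \<in> E} = {p}" if "cut C u p" "\<not> (\<exists>v\<in>C. {u, v} \<in> E)" for C u p
    using that unfolding cut_def by blast
  show thesis
  proof (cases "\<exists>C u p. cut C u p \<and> (\<exists>v\<in>C. {u, v} \<in> E)")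
    case False
    then have "{x \<in> U. {u, x} \<in> E} = {p}" if up: "u \<in> U" "p \<in> U" "{u, p} \<in> E" for u p
    proof -
      obtain C where "cut C u p" using ex_cut[OF up] by blast
      then show ?thesis using leaf False by blast
    qed
    note single = this
    have "{b, a} \<in> E" using ab(3) by (simp add: insert_commute)
    with single have "{x \<in> U. {a, x} \<in> E} = {b}" "{x \<in> U. {b, x} \<in> E} = {a}"
      using ab by blast+
    then show thesis using that[of b a a] ab by blast
  next
    case True
    define Q where "Q c \<longleftrightarrow> (\<exists>C u p. cut C u p \<and> (\<exists>v\<in>C. {u, v} \<in> E) \<and> c = card C)" for c
    have "\<exists>c. Q c" using True unfolding Q_def by blast
    then have "Q (LEAST c. Q c)" by (metis LeastI)
    then obtain C u p where C: "cut C u p" "\<exists>v\<in>C. {u, v} \<in> E" "(LEAST c. Q c) = card C"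
      unfolding Q_def by blast
    have finC: "finite C" using C fin finite_subset unfolding cut_def by auto
    have leaf': "{x \<in> U. {y, x} \<in> E} = {u}" if y: "y \<in> U" "{u, y} \<in> E" "y \<noteq> p" for y
    proof -
      have yC: "y \<in> C"
      proof (rule ccontr)
        assume "y \<notin> C"
        with y(1) have "y \<in> U - C" by blast
        with C(1) y(2,3) show False unfolding cut_def by blast
      qed
      have "u \<in> U" "{y, u} \<in> E" using y C(1) unfolding cut_def by (auto simp: insert_commute)
      then obtain C' where C': "cut C' y u" using ex_cut y(1) by blast
      \<comment> \<open>An edge leaving the intersection leaves \<open>C'\<close> or
        \<open>C\<close>, so it is the edge from \<open>y\<close> to \<open>u\<close> or the one
        from \<open>u\<close> to \<open>p\<close>; the latter is impossible because \<open>u\<close>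
        is not in \<open>C'\<close>. The new cut is strictly smaller, and minimality makes
        \<open>y\<close> a leaf.\<close>
      have cut: "cut (C' \<inter> C) y u"
        unfolding cut_def
      proof (intro conjI ballI impI)
        fix a b assume "a \<in> C' \<inter> C" "b \<in> U - C' \<inter> C" "{a, b} \<in> E"
        then have "(a = y \<and> b = u) \<or> (a = u \<and> b = p)"
          using C' C(1) unfolding cut_def by blast
        moreover have "a \<noteq> u" using C' \<open>a \<in> C' \<inter> C\<close> unfolding cut_def by blast
        ultimately show "a = y" "b = u" by blast+
      qed (use C' C(1) yC in \<open>auto simp: cut_def\<close>)
      have "u \<in> C" "u \<notin> C'" using C' C(1) unfolding cut_def by simp_all
      then have "C' \<inter> C \<subset> C" by blast
      then have "card (C' \<inter> C) < card C" using finC psubset_card_mono by blast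
      then have "\<not> Q (card (C' \<inter> C))" using C(3) not_less_Least by metis
      then show ?thesis using leaf[OF cut] cut unfolding Q_def by blast
    qed
    obtain v where v: "v \<in> C" "{u, v} \<in> E" using C(2) by blast
    then have "v \<in> U" "v \<noteq> p" using C(1) unfolding cut_def by auto
    then show thesis
      using that[of u v p] leaf' v C(1) unfolding cut_def by auto
  qed
qed

section \<open>Invariants of token slides\<close>

text \<open>If a token of \<open>S\<close> slid to \<open>v\<close>, the second neighbour of
  \<open>v\<close> in \<open>S\<close> would still carry its token, contradicting independence. So
  the sliding token is not in \<open>S\<close>, and the rest of the condition does not mention the
  token set.\<close>

lemma frozen_move:
  assumes "frozen E U I S" "move E U I J"
  shows "frozen E U J S"
proof -
  obtain u v where uv: "I - J = {u}" "J - I = {v}" "{u, v} \<in> E"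
    using assms(2) unfolding move_def slide_def by blast
  have J: "J \<subseteq> U" "\<And>a b. a \<in> J \<Longrightarrow> b \<in> J \<Longrightarrow> {a, b} \<notin> E"
    using assms(2) unfolding move_def independent_set_def by auto
  have "u \<notin> S"
  proof
    assume "u \<in> S"
    moreover have "v \<in> U" using uv J by blast
    ultimately obtain u' where "u' \<in> S" "u' \<noteq> u" "{u', v} \<in> E"
      using assms(1) uv(3) unfolding frozen_def by blast
    moreover from this have "u' \<in> J" using uv(1) assms(1) unfolding frozen_def by blast
    ultimately show False using J uv by blast
  qed
  moreover have "S \<subseteq> I" using assms(1) unfolding frozen_def by blast
  ultimately have "S \<subseteq> J" using uv(1) by (metis DiffI singletonD subset_iff)
  then show ?thesis using assms(1) unfolding frozen_def by simp
qed

lemma move_sym: "move E U I J \<Longrightarrow> move E U J I"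
  unfolding move_def slide_def by (metis insert_commute)

lemma reach_sym: "reach E U I J \<Longrightarrow> reach E U J I"
  by (induction rule: rtranclp_induct) (auto intro: converse_rtranclp_into_rtranclp move_sym)

lemma rigid_reach: "reach E U I J \<Longrightarrow> rigid E U J = rigid E U I"
proof (induction rule: rtranclp_induct)
  case (step J K)
  have "frozen E U K S \<longleftrightarrow> frozen E U J S" for S
    using frozen_move step(2) move_sym by blast
  then have "rigid E U K = rigid E U J" unfolding rigid_def by presburger
  then show ?case using step.IH by simp
qed simp

lemma frozen_rigid: "frozen E U I (rigid E U I)"
  unfolding frozen_def rigid_def by blast

lemma frozen_le_rigid: "frozen E U I S \<Longrightarrow> S \<subseteq> rigid E U I"
  unfolding rigid_def by blast

lemma rigid_subset: "rigid E U I \<subseteq> I \<inter> U"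
  using frozen_rigid[of E U I] unfolding frozen_def by (rule conjunct1)

lemma independent_reach: "reach E U I J \<Longrightarrow> independent_set U E I \<Longrightarrow> independent_set U E J"
  by (induction rule: rtranclp_induct) (auto simp: move_def)

lemma move_mono: "move E U I J \<Longrightarrow> U \<subseteq> U' \<Longrightarrow> move E U' I J"
  unfolding move_def independent_set_def by blast

lemma reach_mono: "reach E U I J \<Longrightarrow> U \<subseteq> U' \<Longrightarrow> reach E U' I J"
  by (induction rule: rtranclp_induct) (auto intro: rtranclp.rtrancl_into_rtrancl move_mono)

lemma slide_closed:
  assumes "move E U I J" "closed_in E U C" "I - J = {u}" "J - I = {v}" "{u, v} \<in> E"
  shows "u \<in> C \<longleftrightarrow> v \<in> C"
proof -
  have "u \<in> U" "v \<in> U" using assms unfolding move_def independent_set_def by auto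
  then show ?thesis
    using assms unfolding closed_in_def by (metis insert_commute)
qed

text \<open>No slide crosses the boundary of a closed set. Performing only the slides inside
  \<open>C\<close> is therefore legal, and all tokens outside \<open>C\<close> stay where they
  were.\<close>

lemma reach_restrict:
  assumes "reach E U I J" "independent_set U E I" "closed_in E U C"
  shows "reach E U I ((J \<inter> C) \<union> (I - C))"
  using assms(1)
proof (induction rule: rtranclp_induct)
  case base
  have "I \<inter> C \<union> (I - C) = I" by blast
  then show ?case by simp
next
  case (step J K)
  obtain u v where uv: "J - K = {u}" "K - J = {v}" "{u, v} \<in> E"
    using step(2) unfolding move_def slide_def by blast
  have uvC: "u \<in> C \<longleftrightarrow> v \<in> C" using slide_closed step(2) assms(3) uv by metis
  show ?case
  proof (cases "u \<in> C")
    case True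
    have ind: "independent_set U E ((L \<inter> C) \<union> (I - C))" if "independent_set U E L" for L
      using that assms(2,3) unfolding independent_set_def closed_in_def
      by (auto 4 4 simp: insert_commute)
    have "((J \<inter> C) \<union> (I - C)) - ((K \<inter> C) \<union> (I - C)) = {u}"
      "((K \<inter> C) \<union> (I - C)) - ((J \<inter> C) \<union> (I - C)) = {v}"
      using uv uvC True by blast+
    then have "move E U ((J \<inter> C) \<union> (I - C)) ((K \<inter> C) \<union> (I - C))"
      using ind[of J] ind[of K] step(2) uv(3) unfolding move_def slide_def by metis
    then show ?thesis using step(3) by simp
  next
    case False
    then have "x \<in> J \<longleftrightarrow> x \<in> K" if "x \<in> C" for x
      using that uv(1,2) uvC by (metis DiffI singletonD)
    then have "J \<inter> C = K \<inter> C" by blast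
    then show ?thesis using step(3) by simp
  qed
qed

lemma reach_card:
  assumes "reach E U I J" "closed_in E U C" "finite U"
  shows "card (I \<inter> C) = card (J \<inter> C)"
  using assms(1)
proof (induction rule: rtranclp_induct)
  case (step J K)
  obtain u v where uv: "J - K = {u}" "K - J = {v}" "{u, v} \<in> E"
    using step(2) unfolding move_def slide_def by blast
  have uvC: "u \<in> C \<longleftrightarrow> v \<in> C" using slide_closed step(2) assms(2) uv by metis
  have fin: "finite C" using assms(2,3) finite_subset unfolding closed_in_def by blast
  have "card (J \<inter> C) = card (K \<inter> C)"
  proof (cases "u \<in> C")
    case True
    then have *: "J \<inter> C = insert u (J \<inter> K \<inter> C)" "K \<inter> C = insert v (J \<inter> K \<inter> C)"
      using uv uvC by blast+
    have "u \<notin> J \<inter> K \<inter> C" "v \<notin> J \<inter> K \<inter> C" using uv by blast+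
    then show ?thesis unfolding * using fin by simp
  next
    case False
    then have "x \<in> J \<longleftrightarrow> x \<in> K" if "x \<in> C" for x
      using that uv(1,2) uvC by (metis DiffI singletonD)
    then have "J \<inter> C = K \<inter> C" by blast
    then show ?thesis by simp
  qed
  then show ?case using step.IH by simp
qed simp

section \<open>Tokens outside the rigid set can move\<close>

definition clearable :: "'v set set \<Rightarrow> 'v set \<Rightarrow> bool" where
  "clearable E U \<longleftrightarrow> (\<forall>I y. independent_set U E I \<longrightarrow> y \<in> I \<longrightarrow> y \<notin> rigid E U I \<longrightarrow>
     (\<exists>J. reach E U I J \<and> y \<notin> J))"

text \<open>The side of \<open>y\<close> in the cut of the edge \<open>{y, z}\<close> is closed once
  \<open>z\<close> is gone, and it contains no other neighbour of \<open>z\<close>. Restricting to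
  it the slides that clear \<open>y\<close> leaves the remaining neighbours of \<open>z\<close>
  untouched, so they can be treated one after the other.\<close>

lemma clear_neighbours:
  assumes br: "bridged E U" and z: "z \<in> U" and clr: "clearable E (U - {z})"
    and ind: "independent_set (U - {z}) E I"
    and Y: "finite Y" "Y \<subseteq> {y \<in> U. {y, z} \<in> E}" "Y \<inter> rigid E (U - {z}) I = {}"
  shows "\<exists>J. reach E (U - {z}) I J \<and> J \<inter> Y = {} \<and>
    (\<forall>x\<in>U - Y. {x, z} \<in> E \<longrightarrow> (x \<in> J \<longleftrightarrow> x \<in> I))"
  using Y
proof (induction Y)
  case empty
  show ?case by auto
next
  case (insert y Y)
  then obtain J where J: "reach E (U - {z}) I J" "J \<inter> Y = {}"
    "\<forall>x\<in>U - Y. {x, z} \<in> E \<longrightarrow> (x \<in> J \<longleftrightarrow> x \<in> I)"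
    by auto
  have y: "y \<in> U" "{y, z} \<in> E" using insert.prems by auto
  show ?case
  proof (cases "y \<in> J")
    case False
    then show ?thesis using J by (intro exI[of _ J]) auto
  next
    case True
    have indJ: "independent_set (U - {z}) E J" using J(1) ind independent_reach by metis
    have "y \<notin> rigid E (U - {z}) J" using rigid_reach[OF J(1)] insert.prems by auto
    then obtain K where K: "reach E (U - {z}) J K" "y \<notin> K"
      using clr indJ True unfolding clearable_def by blast
    obtain C where C: "C \<subseteq> U" "y \<in> C" "z \<notin> C"
      "\<forall>a\<in>C. \<forall>b\<in>U - C. {a, b} \<in> E \<longrightarrow> a = y \<and> b = z"
      using br[unfolded bridged_def, rule_format, OF y(1) z y(2)] by blast
    have "closed_in E (U - {z}) C" using C unfolding closed_in_def by auto
    then have "reach E (U - {z}) J ((K \<inter> C) \<union> (J - C))"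
      using reach_restrict K(1) indJ by metis
    then have "reach E (U - {z}) I ((K \<inter> C) \<union> (J - C))" using J(1) by simp
    moreover have other: "x \<notin> C" if "x \<in> U" "{x, z} \<in> E" "x \<noteq> y" for x
      using that C z by blast
    moreover have "(K \<inter> C \<union> (J - C)) \<inter> insert y Y = {}"
    proof -
      have "x \<notin> C \<and> x \<notin> J" if "x \<in> Y" for x
        using that other insert.prems(1) insert.hyps(2) J(2) by blast
      then show ?thesis using K(2) C(2) by blast
    qed
    ultimately show ?thesis
      using J(3) by (intro exI[of _ "(K \<inter> C) \<union> (J - C)"]) blast
  qed
qed

text \<open>All tokens next to \<open>z\<close> other than \<open>w\<close> are cleared within the
  graph without \<open>z\<close>; then \<open>w\<close> is the only token next to \<open>z\<close>
  and may slide there.\<close>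

lemma slide_after_clearing:
  assumes br: "bridged E U" and fin: "finite U" and clr: "clearable E (U - {z})"
    and ind: "independent_set U E I" and w: "w \<in> I" "z \<in> U" "{w, z} \<in> E"
    and free: "\<And>y. y \<in> I \<Longrightarrow> {y, z} \<in> E \<Longrightarrow> y \<noteq> w \<Longrightarrow> y \<notin> rigid E (U - {z}) I"
  shows "\<exists>J. reach E U I J \<and> z \<in> J \<and> w \<notin> J"
proof -
  have zI: "z \<notin> I" using ind w unfolding independent_set_def by blast
  have ind': "independent_set (U - {z}) E I"
    using ind zI unfolding independent_set_def by blast
  define Y where "Y = {y \<in> I. {y, z} \<in> E \<and> y \<noteq> w}"
  have IU: "I \<subseteq> U" using ind unfolding independent_set_def by blast
  have "finite Y" "Y \<subseteq> {y \<in> U. {y, z} \<in> E}" "Y \<inter> rigid E (U - {z}) I = {}"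
    using finite_subset[OF IU fin] free IU unfolding Y_def by auto
  from clear_neighbours[OF br w(2) clr ind' this]
  obtain J where J: "reach E (U - {z}) I J" "J \<inter> Y = {}"
    "\<forall>x\<in>U - Y. {x, z} \<in> E \<longrightarrow> (x \<in> J \<longleftrightarrow> x \<in> I)" by blast
  have indJ: "independent_set (U - {z}) E J" using J(1) ind' independent_reach by metis
  have wJ: "w \<in> J" using J w IU unfolding Y_def by auto
  \<comment> \<open>Clearing might in principle have moved tokens onto empty neighbours of
    \<open>z\<close>; the third property of \<open>J\<close> rules this out.\<close>
  have only: "x = w" if "x \<in> J" "{x, z} \<in> E" for x
    using that J(2,3) indJ unfolding Y_def independent_set_def by blast
  let ?K = "insert z (J - {w})"
  have "w \<noteq> z" using w zI by blast
  have zz: "{z, z} \<notin> E" using br w(2) bridged_irrefl by metis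
  have "independent_set U E ?K"
    using indJ only zz w(2) unfolding independent_set_def by (auto simp: insert_commute)
  moreover have "independent_set U E J" using indJ unfolding independent_set_def by blast
  moreover have "slide E J ?K"
    using wJ indJ \<open>w \<noteq> z\<close> w(3) unfolding slide_def independent_set_def
    by (intro exI[of _ w] exI[of _ z]) auto
  ultimately have "move E U J ?K" unfolding move_def by blast
  then have "reach E U I ?K"
    using reach_mono[OF J(1), of U] by (metis Diff_subset rtranclp.rtrancl_into_rtrancl)
  then show ?thesis using \<open>w \<noteq> z\<close> by (intro exI[of _ ?K]) auto
qed

text \<open>It suffices to find one neighbour \<open>z\<close> of \<open>w\<close> whose other
  tokens are not rigid in the graph without \<open>z\<close>, since that smaller graph is clearable
  by induction. If every neighbour failed, \<open>w\<close> would lie in a frozen set.\<close>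

lemma clearable_if_bridged:
  assumes "bridged E U" "finite U"
  shows "clearable E U"
  using assms
proof (induction "card U" arbitrary: U rule: less_induct)
  case less
  show ?case
    unfolding clearable_def
  proof (intro allI impI)
    fix I w assume ind: "independent_set U E I" and w: "w \<in> I" "w \<notin> rigid E U I"
    have wU: "w \<in> U" using ind w unfolding independent_set_def by blast
    have "\<exists>z\<in>U. {w, z} \<in> E \<and>
      (\<forall>y\<in>I. {y, z} \<in> E \<longrightarrow> y \<noteq> w \<longrightarrow> y \<notin> rigid E (U - {z}) I)"
    proof (rule ccontr)
      assume *: "\<not> ?thesis"
      \<comment> \<open>Neighbours of \<open>w\<close> are guarded by \<open>w\<close> and by a
        rigid token of the corresponding deleted graph. Any other vertex \<open>z\<close> next to
        some \<open>u\<close> in \<open>?S\<close> survives the deletion that put \<open>u\<close>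
        into \<open>?S\<close>, so its second guard is found there.\<close>
      let ?S = "insert w (\<Union>z\<in>{z \<in> U. {w, z} \<in> E}. rigid E (U - {z}) I)"
      have "frozen E U I ?S"
        unfolding frozen_def
      proof (intro conjI ballI impI)
        show "?S \<subseteq> I \<inter> U" using rigid_subset w wU by fast
        fix u z assume u: "u \<in> ?S" and z: "z \<in> U" "{u, z} \<in> E"
        show "\<exists>u'\<in>?S. u' \<noteq> u \<and> {u', z} \<in> E"
        proof (cases "{w, z} \<in> E")
          case True
          then obtain y where "y \<in> rigid E (U - {z}) I" "{y, z} \<in> E" "y \<noteq> w"
            using * z by blast
          then show ?thesis using True z(1) by (cases "u = w") auto
        next
          case False
          then obtain z' where z': "z' \<in> U" "{w, z'} \<in> E" "u \<in> rigid E (U - {z'}) I"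
            using u z by blast
          have "z \<in> U - {z'}" using False z z' by auto
          then obtain u' where "u' \<in> rigid E (U - {z'}) I" "u' \<noteq> u" "{u', z} \<in> E"
            using frozen_rigid[of E "U - {z'}" I] z(2) z'(3) unfolding frozen_def by blast
          then show ?thesis using z' by blast
        qed
      qed
      then show False using w(2) frozen_le_rigid by blast
    qed
    then obtain z where z: "z \<in> U" "{w, z} \<in> E"
      "\<And>y. y \<in> I \<Longrightarrow> {y, z} \<in> E \<Longrightarrow> y \<noteq> w \<Longrightarrow> y \<notin> rigid E (U - {z}) I"
      by blast
    have "card (U - {z}) < card U" using z(1) less.prems(2) by (intro psubset_card_mono) auto
    then have "clearable E (U - {z})"
      using less.hyps less.prems bridged_subset by (metis Diff_subset finite_Diff)
    then show "\<exists>J. reach E U I J \<and> w \<notin> J"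
      using slide_after_clearing[OF less.prems _ ind w(1) z] by blast
  qed
qed

text \<open>At most one neighbour of \<open>z\<close> carries a token that is rigid in the graph
  without \<open>z\<close>: two such tokens would guard \<open>z\<close> as well, and the rigid set
  would be frozen in the whole graph.\<close>

lemma rigid_empty_occupy_neighbour:
  assumes br: "bridged E U" and fin: "finite U" and ind: "independent_set U E I"
    and mob: "rigid E U I = {}" and w: "w \<in> I" "z \<in> U" "{w, z} \<in> E"
  shows "\<exists>J. reach E U I J \<and> z \<in> J"
proof -
  let ?R = "rigid E (U - {z}) I"
  have uniq: "y = y'" if y: "y \<in> ?R" "{y, z} \<in> E" "y' \<in> ?R" "{y', z} \<in> E" for y y'
  proof (rule ccontr)
    assume "y \<noteq> y'"
    have "frozen E U I ?R"
      unfolding frozen_def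
    proof (intro conjI ballI impI)
      show "?R \<subseteq> I \<inter> U" using rigid_subset by fast
      fix u x assume "u \<in> ?R" "x \<in> U" "{u, x} \<in> E"
      then show "\<exists>u'\<in>?R. u' \<noteq> u \<and> {u', x} \<in> E"
        using frozen_rigid[of E "U - {z}" I] y \<open>y \<noteq> y'\<close> unfolding frozen_def
        by (cases "x = z") (metis, blast)
    qed
    then show False using mob y(1) frozen_le_rigid by blast
  qed
  \<comment> \<open>If there is one obstructing neighbour, it is itself chosen as the token to slide
    onto \<open>z\<close>; otherwise \<open>w\<close> is used.\<close>
  obtain w' where w': "w' \<in> I" "{w', z} \<in> E"
    "\<And>y. y \<in> I \<Longrightarrow> {y, z} \<in> E \<Longrightarrow> y \<noteq> w' \<Longrightarrow> y \<notin> ?R"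
  proof (cases "\<exists>y\<in>?R. {y, z} \<in> E")
    case True
    then obtain y where "y \<in> ?R" "{y, z} \<in> E" by blast
    then show thesis using that[of y] uniq rigid_subset by fast
  next
    case False
    then show thesis using that[of w] w by blast
  qed
  have "clearable E (U - {z})"
    using clearable_if_bridged br fin bridged_subset by (metis Diff_subset finite_Diff)
  then show ?thesis
    using slide_after_clearing[OF br fin _ ind w'(1) w(2) w'(2,3)] by blast
qed

lemma rigid_empty_occupy:
  assumes br: "bridged E U" and fin: "finite U" and ind: "independent_set U E I"
    and mob: "rigid E U I = {}" and w: "w \<in> I"
    and path: "(\<lambda>a b. a \<in> U \<and> b \<in> U \<and> {a, b} \<in> E)\<^sup>*\<^sup>* w v"
  shows "\<exists>J. reach E U I J \<and> v \<in> J"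
  using path
proof (induction rule: rtranclp_induct)
  case base
  then show ?case using w by blast
next
  case (step v v')
  then obtain J where J: "reach E U I J" "v \<in> J" by blast
  have "independent_set U E J" "rigid E U J = {}"
    using independent_reach rigid_reach J(1) ind mob by metis+
  then obtain K where "reach E U J K" "v' \<in> K"
    using rigid_empty_occupy_neighbour[OF br fin] J(2) step(2) by blast
  then show ?case using J(1) by (meson rtranclp_trans)
qed

section \<open>Reconfiguration when no token is rigid\<close>

text \<open>Ensures that deleting \<open>u\<close> with its leaves creates no new rigid tokens. The
  only deleted vertex that a frozen set of the smaller graph can touch is \<open>u\<close>; the
  token on \<open>v\<close> then provides the second guard of \<open>u\<close>, and \<open>v\<close>
  has no other neighbour to be guarded.\<close>

lemma frozen_extend_leaf:
  assumes "frozen E U' (I - {v}) S" "v \<in> I" "u \<in> U" "v \<in> U" "{v, u} \<in> E"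
    and U': "U' = U - {u} - {x \<in> U. {y \<in> U. {x, y} \<in> E} = {u}}"
    and v: "{y \<in> U. {v, y} \<in> E} = {u}"
  shows "frozen E U I S \<or> frozen E U I (insert v S)"
proof -
  have S: "S \<subseteq> I \<inter> U'" "v \<notin> S" using assms(1) unfolding frozen_def by auto
  have step: "\<exists>u'\<in>S. u' \<noteq> x \<and> {u', z} \<in> E" if "x \<in> S" "z \<in> U" "{x, z} \<in> E" "z \<noteq> u" for x z
  proof -
    have "x \<in> {y \<in> U. {z, y} \<in> E}" "x \<noteq> u"
      using that S U' by (auto simp: insert_commute)
    then have "z \<in> U'" using that(2,4) unfolding U' by blast
    then show ?thesis using assms(1) that unfolding frozen_def by blast
  qed
  show ?thesis
  proof (cases "\<exists>x\<in>S. {x, u} \<in> E")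
    case False
    then have "\<forall>x\<in>S. \<forall>z\<in>U. {x, z} \<in> E \<longrightarrow> (\<exists>u'\<in>S. u' \<noteq> x \<and> {u', z} \<in> E)"
      using step by metis
    moreover have "S \<subseteq> I \<inter> U" using S U' by blast
    ultimately show ?thesis unfolding frozen_def by blast
  next
    case True
    then obtain x where x: "x \<in> S" "{x, u} \<in> E" by blast
    have "\<exists>u'\<in>insert v S. u' \<noteq> y \<and> {u', z} \<in> E"
      if y: "y \<in> insert v S" "z \<in> U" "{y, z} \<in> E" for y z
    proof (cases "z = u")
      case True
      show ?thesis
        using True x S(2) assms(5) by (metis insert_iff)
    next
      case False
      then have "y \<noteq> v" using v y by blast
      then show ?thesis using step[of y z] y False by blast
    qed
    moreover have "insert v S \<subseteq> I \<inter> U" using S U' assms(2,4) by blast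
    ultimately show ?thesis unfolding frozen_def by blast
  qed
qed

text \<open>Tokens of \<open>R\<close> outside \<open>U'\<close> without an edge to
  \<open>U'\<close> can stand by unchanged. Used both for the token parked on a leaf and for the
  rigid tokens.\<close>

lemma reach_union:
  assumes "reach E U' I J" "U' \<subseteq> U" "independent_set U E R" "U' \<inter> R = {}"
    "\<And>x y. x \<in> U' \<Longrightarrow> y \<in> R \<Longrightarrow> {x, y} \<notin> E"
  shows "reach E U (I \<union> R) (J \<union> R)"
  using assms(1)
proof (induction rule: rtranclp_induct)
  case (step J K)
  have ind: "independent_set U E (L \<union> R)" if L: "independent_set U' E L" for L
    unfolding independent_set_def
  proof (intro conjI ballI)
    show "L \<union> R \<subseteq> U" using L assms(2,3) unfolding independent_set_def by blast
    fix x y assume "x \<in> L \<union> R" "y \<in> L \<union> R"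
    moreover have "L \<subseteq> U'" using L unfolding independent_set_def by blast
    ultimately show "{x, y} \<notin> E"
      using L assms(3) assms(5)[of x y] assms(5)[of y x] unfolding independent_set_def
      by (auto simp: insert_commute)
  qed
  have "J \<union> R - (K \<union> R) = J - K" "K \<union> R - (J \<union> R) = K - J"
    using step(2) assms(4) unfolding move_def independent_set_def by blast+
  then have "move E U (J \<union> R) (K \<union> R)"
    using step(2) ind unfolding move_def slide_def by simp
  then show ?case using step.IH by simp
qed simp

text \<open>Induction on the number of vertices. Each deletion must preserve three things: absence
  of rigid tokens, independence, and equal counts on closed sets. The last is checked by extending
  every closed set of the smaller graph to one of the larger graph.\<close>

lemma reach_if_rigid_empty:
  assumes "bridged E U" "finite U" "independent_set U E I" "independent_set U E J"
    and "rigid E U I = {}" "rigid E U J = {}"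
    and "\<And>C. closed_in E U C \<Longrightarrow> card (I \<inter> C) = card (J \<inter> C)"
  shows "reach E U I J"
  using assms
proof (induction "card U" arbitrary: U I J rule: less_induct)
  case less
  note br = less.prems(1) and fin = less.prems(2) and ind = less.prems(3,4)
    and mob = less.prems(5,6) and cnt = less.prems(7)
  show ?case
  proof (cases "\<exists>a\<in>U. \<exists>b\<in>U. {a, b} \<in> E")
    case False
    have "L = {}" if "independent_set U E L" "rigid E U L = {}" for L
    proof -
      have "frozen E U L L"
        using that(1) False unfolding frozen_def independent_set_def by blast
      then show ?thesis using that(2) frozen_le_rigid by blast
    qed
    from this[OF ind(1) mob(1)] this[OF ind(2) mob(2)] show ?thesis by simp
  next
    case True
    then obtain a b where ab: "a \<in> U" "b \<in> U" "{a, b} \<in> E" by blast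
    obtain u p v where u: "u \<in> U" and v: "v \<in> U" "{x \<in> U. {v, x} \<in> E} = {u}"
      and safe: "\<And>y. y \<in> U \<Longrightarrow> {u, y} \<in> E \<Longrightarrow> y = p \<or> {x \<in> U. {y, x} \<in> E} = {u}"
      by (rule bridged_safe_vertex[OF br fin ab], rule that)
    have vu: "{v, u} \<in> E" using v(2) by blast
    have vv: "{v, v} \<notin> E" "{u, u} \<notin> E" using bridged_irrefl[OF br] u v(1) by blast+
    have vN: "x = u" if "x \<in> U" "{x, v} \<in> E" for x
    proof -
      have "{v, x} \<in> E" using that(2) by (simp add: insert_commute)
      then show ?thesis using that(1) v(2) by blast
    qed
    define path where "path a b \<longleftrightarrow> a \<in> U \<and> b \<in> U \<and> {a, b} \<in> E" for a b
    \<comment> \<open>\<open>K\<close> is the component of \<open>v\<close>. Equal counts on it mean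
      that either both sides or neither have a token to bring to \<open>v\<close>.\<close>
    define K where "K = {x \<in> U. path\<^sup>*\<^sup>* x v}"
    have K: "closed_in E U K"
      unfolding closed_in_def
    proof (intro conjI ballI impI)
      fix a b assume ab: "a \<in> K" "b \<in> U" "{a, b} \<in> E"
      then have "path b a" unfolding path_def K_def by (simp add: insert_commute)
      then show "b \<in> K" using ab unfolding K_def by (auto intro: converse_rtranclp_into_rtranclp)
    qed (auto simp: K_def)
    have vK: "v \<in> K" using v unfolding K_def by blast
    have finI: "finite I" "finite J"
      using ind fin finite_subset unfolding independent_set_def by blast+
    have emp: "I \<inter> K = {} \<longleftrightarrow> J \<inter> K = {}"
      using cnt[OF K] finI by (metis card_eq_0_iff finite_Int)
    show ?thesis
    proof (cases "I \<inter> K = {}")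
      case True
      let ?U = "U - {v}"
      have uK: "u \<in> K" using K vK u vu unfolding closed_in_def by blast
      \<comment> \<open>The component has no token, in particular none on \<open>u\<close>, the only
        neighbour of \<open>v\<close>. Hence no frozen set ever refers to \<open>v\<close>, and
        deleting \<open>v\<close> alone is harmless.\<close>
      have sub: "independent_set ?U E L \<and> rigid E ?U L = {}"
        if L: "independent_set U E L" "rigid E U L = {}" "L \<inter> K = {}" for L
      proof
        show "independent_set ?U E L" using L vK unfolding independent_set_def by blast
        have froz: "frozen E U L S" if S: "frozen E ?U L S" for S
        proof -
          have "{x, v} \<notin> E" if "x \<in> S" for x
          proof
            assume "{x, v} \<in> E"
            moreover have "x \<in> U" "x \<in> L" using S that unfolding frozen_def by auto
            ultimately have "x = u" using vN by blast
            then show False using \<open>x \<in> L\<close> uK L(3) by blast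
          qed
          then have "z \<in> ?U" if "x \<in> S" "z \<in> U" "{x, z} \<in> E" for x z using that by blast
          moreover have "S \<subseteq> L \<inter> U" using S unfolding frozen_def by blast
          ultimately show ?thesis using S unfolding frozen_def by simp
        qed
        have "S = {}" if "frozen E ?U L S" for S
          using frozen_le_rigid[OF froz[OF that]] L(2) by simp
        then show "rigid E ?U L = {}" unfolding rigid_def by blast
      qed
      have "card (I \<inter> C) = card (J \<inter> C)" if C: "closed_in E ?U C" for C
      proof -
        \<comment> \<open>Adding \<open>v\<close> exactly when \<open>u\<close> is present restores
          closedness, and \<open>v\<close> carries no token.\<close>
        let ?C = "if u \<in> C then insert v C else C"
        have "closed_in E U ?C"
          unfolding closed_in_def
        proof (intro conjI ballI impI)
          show "?C \<subseteq> U" using C v unfolding closed_in_def by auto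
          fix a b assume ab: "a \<in> ?C" "b \<in> U" "{a, b} \<in> E"
          show "b \<in> ?C"
          proof (cases "a = v")
            case True
            then have "b = u" using ab v(2) by blast
            then show ?thesis using ab True C unfolding closed_in_def by (auto split: if_splits)
          next
            case False
            then have "a \<in> C" using ab by (auto split: if_splits)
            show ?thesis
            proof (cases "b = v")
              case True
              then have "a = u" using vN ab(3) \<open>a \<in> C\<close> C unfolding closed_in_def by blast
              then show ?thesis using True \<open>a \<in> C\<close> by simp
            next
              case False
              then show ?thesis using ab \<open>a \<in> C\<close> C unfolding closed_in_def by simp
            qed
          qed
        qed
        moreover have "v \<notin> I" "v \<notin> J" using True emp vK by blast+
        then have "I \<inter> ?C = I \<inter> C" "J \<inter> ?C = J \<inter> C" by auto
        ultimately show ?thesis using cnt by metis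
      qed
      moreover have "card ?U < card U" using v fin by (intro psubset_card_mono) auto
      ultimately have "reach E ?U I J"
        using less.hyps[of ?U I J] sub[OF ind(1) mob(1)] sub[OF ind(2) mob(2)] True emp
          bridged_subset[OF br, of ?U] fin
        by blast
      then show ?thesis using reach_mono by (metis Diff_subset)
    next
      case False
      let ?L = "{x \<in> U. {y \<in> U. {x, y} \<in> E} = {u}}"
      let ?U = "U - {u} - ?L"
      have leaf: "\<exists>M. reach E U L M \<and> v \<in> M \<and> independent_set ?U E (M - {v}) \<and>
          rigid E ?U (M - {v}) = {} \<and> M \<inter> ({u} \<union> ?L) = {v}"
        if L: "independent_set U E L" "rigid E U L = {}" "L \<inter> K \<noteq> {}" for L
      proof -
        obtain w where "w \<in> L" "path\<^sup>*\<^sup>* w v" using L(3) unfolding K_def by blast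
        then obtain M where M: "reach E U L M" "v \<in> M"
          using rigid_empty_occupy[OF br fin L(1,2)] unfolding path_def by blast
        have indM: "independent_set U E M" using M L independent_reach by metis
        have mobM: "rigid E U M = {}" using M L rigid_reach by metis
        have uM: "u \<notin> M" using indM M(2) vu unfolding independent_set_def by blast
        \<comment> \<open>Tokens on two leaves of \<open>u\<close> would guard \<open>u\<close>
          together and be frozen. So \<open>v\<close> holds the only token among \<open>u\<close>
          and its leaves, and deleting these vertices removes exactly one token on either
          side.\<close>
        have lM: "l = v" if "l \<in> M" "l \<in> ?L" for l
        proof (rule ccontr)
          assume "l \<noteq> v"
          have lu: "{l, u} \<in> E" "l \<in> U" using that by blast+
          have "z = u" if "x \<in> {l, v}" "z \<in> U" "{x, z} \<in> E" for x z
            using that \<open>l \<in> ?L\<close> v(2) by blast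
          moreover have "{x, u} \<in> E" if "x \<in> {l, v}" for x using that lu vu by blast
          moreover have "\<exists>y\<in>{l, v}. y \<noteq> x" for x
            using \<open>l \<noteq> v\<close> by (cases "x = l") auto
          ultimately have "frozen E U M {l, v}"
            using that(1) lu(2) v(1) M(2) unfolding frozen_def by (metis IntI empty_subsetI insert_subset)
          then show False using mobM frozen_le_rigid by blast
        qed
        have "S = {}" if "frozen E ?U (M - {v}) S" for S
          using frozen_extend_leaf[OF that M(2) u v(1) vu refl v(2)] mobM frozen_le_rigid
          by (metis insert_not_empty subset_empty)
        then have "rigid E ?U (M - {v}) = {}" unfolding rigid_def by blast
        moreover have "M - {v} \<subseteq> ?U"
          using indM uM lM unfolding independent_set_def by blast
        then have "independent_set ?U E (M - {v})"
          using indM unfolding independent_set_def by blast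
        moreover have "M \<inter> ({u} \<union> ?L) = {v}" using uM lM M(2) v by blast
        ultimately show ?thesis using M by (intro exI[of _ M]) simp
      qed
      obtain I' where I': "reach E U I I'" "v \<in> I'" "independent_set ?U E (I' - {v})"
        "rigid E ?U (I' - {v}) = {}" "I' \<inter> ({u} \<union> ?L) = {v}"
        using leaf[OF ind(1) mob(1) False] by blast
      have "J \<inter> K \<noteq> {}" using False emp by blast
      from leaf[OF ind(2) mob(2) this]
      obtain J' where J': "reach E U J J'" "v \<in> J'" "independent_set ?U E (J' - {v})"
        "rigid E ?U (J' - {v}) = {}" "J' \<inter> ({u} \<union> ?L) = {v}"
        by blast
      have finU: "finite ?U" using fin by blast
      have "card ((I' - {v}) \<inter> C) = card ((J' - {v}) \<inter> C)" if C: "closed_in E ?U C" for C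
      proof -
        \<comment> \<open>Outside its leaves, \<open>u\<close> can only be adjacent to
          \<open>p\<close>. A closed set containing this neighbour must absorb \<open>u\<close> and
          all its leaves, which adds the single token on \<open>v\<close> to both counts.\<close>
        let ?C = "if p \<in> C \<and> {u, p} \<in> E then C \<union> ({u} \<union> ?L) else C"
        have disj: "C \<inter> ({u} \<union> ?L) = {}" using C unfolding closed_in_def by blast
        have uC: "x = p" if "x \<in> C" "{x, u} \<in> E" for x
        proof -
          have "x \<in> U" "{u, x} \<in> E"
            using that C unfolding closed_in_def by (auto simp: insert_commute)
          then show ?thesis using safe that(1) disj by blast
        qed
        have nL: "b \<notin> ?L" if "a \<in> C" "{a, b} \<in> E" for a b
        proof
          assume "b \<in> ?L"
          moreover have "a \<in> U" "a \<noteq> u" "{b, a} \<in> E"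
            using that C unfolding closed_in_def by (auto simp: insert_commute)
          ultimately show False by blast
        qed
        have "closed_in E U ?C"
          unfolding closed_in_def
        proof (intro conjI ballI impI)
          show "?C \<subseteq> U" using C u unfolding closed_in_def by auto
          fix a b assume ab: "a \<in> ?C" "b \<in> U" "{a, b} \<in> E"
          consider "a \<in> C" | "a = u" "p \<in> C" "{u, p} \<in> E" | "a \<in> ?L" "p \<in> C" "{u, p} \<in> E"
            using ab(1) by (auto split: if_splits)
          then show "b \<in> ?C"
          proof cases
            case 1
            show ?thesis
            proof (cases "b = u")
              case True
              then have "a = p" "{a, u} \<in> E" using 1 ab(3) uC by blast+
              then show ?thesis using True 1 by (simp add: insert_commute)
            next
              case False
              then have "b \<in> ?U" using nL[OF 1 ab(3)] ab(2) by blast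
              then have "b \<in> C" using C 1 ab(3) unfolding closed_in_def by blast
              then show ?thesis by simp
            qed
          next
            case 2
            then show ?thesis using safe[OF ab(2)] ab by auto
          next
            case 3
            then show ?thesis using ab by auto
          qed
        qed
        then have "card (I' \<inter> ?C) = card (J' \<inter> ?C)"
          using cnt reach_card[OF I'(1) _ fin, of ?C] reach_card[OF J'(1) _ fin, of ?C] by presburger
        moreover have "card (M \<inter> ?C) = card ((M - {v}) \<inter> C) + (if p \<in> C \<and> {u, p} \<in> E then 1 else 0)"
          if M: "M \<inter> ({u} \<union> ?L) = {v}" for M
        proof -
          have vC: "v \<notin> C" using disj v by blast
          have "M \<inter> (C \<union> ({u} \<union> ?L)) = insert v ((M - {v}) \<inter> C)" using M vC by blast
          moreover have "finite C" using C finU finite_subset unfolding closed_in_def by blast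
          moreover have "(M - {v}) \<inter> C = M \<inter> C" using vC by blast
          ultimately show ?thesis using vC by simp
        qed
        ultimately show ?thesis using I'(5) J'(5) by simp
      qed
      moreover have "card ?U < card U"
        using fin u by (intro psubset_card_mono) auto
      moreover have "bridged E ?U" by (rule bridged_subset[OF br]) blast
      ultimately have "reach E ?U (I' - {v}) (J' - {v})"
        using less.hyps[of ?U "I' - {v}" "J' - {v}"] I'(3,4) J'(3,4) finU by simp
      moreover have "{x, v} \<notin> E" if "x \<in> ?U" for x
        using vN that by blast
      moreover have "independent_set U E {v}" using v(1) vv unfolding independent_set_def by simp
      moreover have "v \<notin> ?U" using v by blast
      ultimately have "reach E U ((I' - {v}) \<union> {v}) ((J' - {v}) \<union> {v})"
        by (intro reach_union[of E ?U _ _ U]) auto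
      then have "reach E U I' J'" using I'(2) J'(2) by (simp add: insert_absorb)
      then show ?thesis using I'(1) reach_sym[OF J'(1)] by simp
    qed
  qed
qed

section \<open>The characterisation of yes-instances\<close>

text \<open>The size condition on the intermediate sets is automatic: \<open>reach_card\<close> for
  the closed set \<open>V\<close> shows that slides preserve cardinality.\<close>

lemma sliding_token_iff_reach:
  assumes "sliding_token_instance V E I J"
  shows "sliding_token V E I J \<longleftrightarrow> reach E V I J"
proof
  assume "sliding_token V E I J"
  then obtain Is where Is: "Is \<noteq> []" "hd Is = I" "last Is = J"
    "\<forall>K\<in>set Is. independent_set V E K" "successively (slide E) Is"
    unfolding sliding_token_def by blast
  have "reach E V (hd Is) (last Is)"
    using Is(1,4,5)
  proof (induction Is rule: induct_list012)
    case (3 x y zs)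
    then have "move E V x y" unfolding move_def by simp
    then show ?case using 3 by (simp add: converse_rtranclp_into_rtranclp)
  qed simp_all
  then show "reach E V I J" using Is by simp
next
  assume "reach E V I J"
  then have "\<exists>Is. Is \<noteq> [] \<and> hd Is = I \<and> last Is = J \<and>
    (\<forall>K\<in>set Is. independent_set V E K \<and> card K = card I) \<and> successively (slide E) Is"
  proof (induction rule: rtranclp_induct)
    case base
    then show ?case
      using assms by (intro exI[of _ "[I]"]) (simp add: sliding_token_instance_def)
  next
    case (step J K)
    then obtain Is where Is: "Is \<noteq> []" "hd Is = I" "last Is = J"
      "\<forall>K\<in>set Is. independent_set V E K \<and> card K = card I" "successively (slide E) Is"
      by blast
    have "closed_in E V V" unfolding closed_in_def by blast
    moreover have "finite V" using assms unfolding sliding_token_instance_def simple_graph_def by blast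
    ultimately have "card (J \<inter> V) = card (K \<inter> V)"
      using reach_card[of E V J K V] step(2) by blast
    moreover have "J \<inter> V = J" "K \<inter> V = K"
      using step(2) unfolding move_def independent_set_def by auto
    moreover have "card J = card I" using Is by (metis last_in_set)
    ultimately have "card K = card I" by simp
    then show ?case
      using Is step(2) unfolding move_def
      by (intro exI[of _ "Is @ [K]"]) (auto simp: successively_append_iff)
  qed
  then show "sliding_token V E I J" unfolding sliding_token_def by blast
qed

definition blocked :: "'v set set \<Rightarrow> 'v set \<Rightarrow> 'v set" where
  "blocked E R = R \<union> {x. \<exists>y\<in>R. {x, y} \<in> E}"

text \<open>Blocked vertices are isolated rather than deleted, so the vertex set stays
  \<open>V\<close>. The components of the remaining graph are then captured by its closed
  sets.\<close>

definition unblocked_edges :: "'v set set \<Rightarrow> 'v set \<Rightarrow> 'v set set" where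
  "unblocked_edges E R = {e \<in> E. e \<inter> blocked E R = {}}"

text \<open>Rigid tokens are present before and after every slide. By independence neither end of
  the slide is next to one of them, and neither end is one of them because it is empty on one of the
  two sides.\<close>

lemma reach_unblocked:
  assumes "reach E V I J"
  shows "reach (unblocked_edges E (rigid E V I)) V I J"
  using assms
proof (induction rule: rtranclp_induct)
  case (step J K)
  let ?R = "rigid E V I" and ?E = "unblocked_edges E (rigid E V I)"
  have RJ: "?R \<subseteq> J" using rigid_reach[OF step(1)] rigid_subset[of E V J] by blast
  have "reach E V I K" using step by simp
  then have RK: "?R \<subseteq> K" using rigid_reach[of E V I K] rigid_subset[of E V K] by blast
  have ind: "independent_set V E J" "independent_set V E K"
    using step(2) unfolding move_def by auto
  have "independent_set V ?E J" "independent_set V ?E K"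
    using ind unfolding independent_set_def unblocked_edges_def by blast+
  moreover obtain u v where uv: "J - K = {u}" "K - J = {v}" "{u, v} \<in> E"
    using step(2) unfolding move_def slide_def by blast
  have "u \<in> J" "v \<in> K" "u \<notin> K" "v \<notin> J" using uv by blast+
  then have "u \<notin> blocked E ?R" "v \<notin> blocked E ?R"
    using RJ RK ind unfolding blocked_def independent_set_def by blast+
  then have "{u, v} \<in> ?E" using uv(3) unfolding unblocked_edges_def by blast
  then have "slide ?E J K" using uv unfolding slide_def by blast
  ultimately have "move ?E V J K" unfolding move_def by blast
  then show ?case using step.IH by simp
qed simp

text \<open>Necessity combines invariance of the rigid set with counting in the unblocked graph. For
  sufficiency, the tokens outside \<open>R\<close> have no rigid subset in the unblocked part, so
  the case without rigid tokens applies there while \<open>R\<close> stands by.\<close>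

lemma reach_iff:
  assumes br: "bridged E V" and fin: "finite V"
    and ind: "independent_set V E I" "independent_set V E J"
  shows "reach E V I J \<longleftrightarrow> rigid E V I = rigid E V J \<and>
    (\<forall>C. closed_in (unblocked_edges E (rigid E V I)) V C \<longrightarrow> card (I \<inter> C) = card (J \<inter> C))"
    (is "_ \<longleftrightarrow> _ = _ \<and> ?cards")
proof
  assume "reach E V I J"
  then show "rigid E V I = rigid E V J \<and> ?cards"
    using rigid_reach reach_card[OF reach_unblocked _ fin] by metis
next
  assume "rigid E V I = rigid E V J \<and> ?cards"
  then have eq: "rigid E V I = rigid E V J" and cards: ?cards by auto
  define R where "R = rigid E V I"
  let ?F = "V - blocked E R"
  have free: "independent_set ?F E (L - R) \<and> rigid E ?F (L - R) = {} \<and> L = (L - R) \<union> R"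
    if L: "independent_set V E L" "rigid E V L = R" for L
  proof (intro conjI)
    have RL: "R \<subseteq> L" "R \<subseteq> V" using rigid_subset[of E V L] L(2) by auto
    show "L = (L - R) \<union> R" using RL by blast
    show "independent_set ?F E (L - R)"
      using L(1) RL unfolding independent_set_def blocked_def by blast
    have "S = {}" if S: "frozen E ?F (L - R) S" for S
    proof -
      \<comment> \<open>A blocked neighbour \<open>z\<close> of a token in \<open>S\<close> is not
        itself in \<open>R\<close>, so it is next to a token of \<open>R\<close>, which serves as
        the second guard. Maximality of \<open>R\<close> then forces \<open>S\<close> to be
        empty.\<close>
      have "frozen E V L (S \<union> R)"
        unfolding frozen_def
      proof (intro conjI ballI impI)
        show "S \<union> R \<subseteq> L \<inter> V" using S RL unfolding frozen_def by blast
        fix u z assume u: "u \<in> S \<union> R" and z: "z \<in> V" "{u, z} \<in> E"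
        show "\<exists>u'\<in>S \<union> R. u' \<noteq> u \<and> {u', z} \<in> E"
        proof (cases "u \<in> R")
          case True
          then show ?thesis
            using frozen_rigid[of E V L] L(2) z unfolding frozen_def by blast
        next
          case False
          then have uS: "u \<in> S" using u by blast
          show ?thesis
          proof (cases "z \<in> ?F")
            case True
            then show ?thesis using S uS z unfolding frozen_def by blast
          next
            case zB: False
            have "u \<notin> blocked E R" using S uS unfolding frozen_def by blast
            then have "z \<notin> R" using z(2) unfolding blocked_def by blast
            then obtain y where "y \<in> R" "{y, z} \<in> E"
              using zB z(1) unfolding blocked_def by (auto simp: insert_commute)
            moreover have "y \<noteq> u" using \<open>y \<in> R\<close> False by metis
            ultimately show ?thesis by (metis UnI2)
          qed
        qed
      qed
      then have "S \<subseteq> R" using L(2) frozen_le_rigid by blast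
      then show ?thesis using S unfolding frozen_def by blast
    qed
    then show "rigid E ?F (L - R) = {}" unfolding rigid_def by blast
  qed
  note I = free[OF ind(1) R_def[symmetric]] and J = free[OF ind(2) eq[folded R_def, symmetric]]
  have "card ((I - R) \<inter> C) = card ((J - R) \<inter> C)" if C: "closed_in E ?F C" for C
  proof -
    have "closed_in (unblocked_edges E R) V C"
      using C unfolding closed_in_def unblocked_edges_def by blast
    then have "card (I \<inter> C) = card (J \<inter> C)" using cards unfolding R_def by blast
    moreover have "C \<inter> R = {}" using C unfolding closed_in_def blocked_def by blast
    then have "(I - R) \<inter> C = I \<inter> C" "(J - R) \<inter> C = J \<inter> C" by blast+
    ultimately show ?thesis by simp
  qed
  then have "reach E ?F (I - R) (J - R)"
    using reach_if_rigid_empty[of E ?F "I - R" "J - R"] I J fin bridged_subset[OF br, of ?F]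
    by blast
  moreover have "independent_set V E R"
    using rigid_subset[of E V I] ind(1) unfolding R_def independent_set_def by blast
  ultimately have "reach E V ((I - R) \<union> R) ((J - R) \<union> R)"
    by (intro reach_union[of E ?F]) (auto simp: blocked_def)
  then show "reach E V I J" using I J by metis
qed


section \<open>A structured language for the random access machine\<close>

record state =
  var :: "nat \<Rightarrow> nat"
  arr :: "nat \<Rightarrow> nat \<Rightarrow> nat"
  input :: "nat list"
  credit :: nat

datatype com =
    Skip
  | VConst nat nat
  | VAdd nat nat nat
  | VSub nat nat nat
  | VRead nat
  | AGet nat nat nat
  | APut nat nat nat
  | Seq com com (infixr ";;" 60)
  | Cond nat com com
  | While com nat com

text \<open>Every atomic command and every test consumes a credit, so a run that does not get stuck
  terminates. \<open>B\<close> bounds the numbers written.\<close>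

inductive big :: "nat \<Rightarrow> com \<Rightarrow> state \<Rightarrow> state \<Rightarrow> bool" for B where
  "big B Skip s s"
| "0 < credit s \<Longrightarrow> k \<le> B \<Longrightarrow>
     big B (VConst x k) s (s\<lparr>var := (var s)(x := k), credit := credit s - 1\<rparr>)"
| "0 < credit s \<Longrightarrow> var s y + var s z \<le> B \<Longrightarrow>
     big B (VAdd x y z) s (s\<lparr>var := (var s)(x := var s y + var s z), credit := credit s - 1\<rparr>)"
| "0 < credit s \<Longrightarrow>
     big B (VSub x y z) s (s\<lparr>var := (var s)(x := var s y - var s z), credit := credit s - 1\<rparr>)"
| "0 < credit s \<Longrightarrow> input s = v # vs \<Longrightarrow> v \<le> B \<Longrightarrow>
     big B (VRead x) s (s\<lparr>var := (var s)(x := v), input := vs, credit := credit s - 1\<rparr>)"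
| "0 < credit s \<Longrightarrow>
     big B (AGet x a y) s (s\<lparr>var := (var s)(x := arr s a (var s y)), credit := credit s - 1\<rparr>)"
| "0 < credit s \<Longrightarrow>
     big B (APut a y x) s
       (s\<lparr>arr := (arr s)(a := (arr s a)(var s y := var s x)), credit := credit s - 1\<rparr>)"
| "big B c1 s s' \<Longrightarrow> big B c2 s' s'' \<Longrightarrow> big B (c1 ;; c2) s s''"
| "0 < credit s \<Longrightarrow> 0 < var s x \<Longrightarrow> big B c1 (s\<lparr>credit := credit s - 1\<rparr>) s' \<Longrightarrow>
     big B (Cond x c1 c2) s s'"
| "0 < credit s \<Longrightarrow> var s x = 0 \<Longrightarrow> big B c2 (s\<lparr>credit := credit s - 1\<rparr>) s' \<Longrightarrow>
     big B (Cond x c1 c2) s s'"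
| "big B c1 s s' \<Longrightarrow> 0 < credit s' \<Longrightarrow> var s' x = 0 \<Longrightarrow>
     big B (While c1 x c2) s (s'\<lparr>credit := credit s' - 1\<rparr>)"
| "big B c1 s s' \<Longrightarrow> 0 < credit s' \<Longrightarrow> 0 < var s' x \<Longrightarrow>
     big B c2 (s'\<lparr>credit := credit s' - 1\<rparr>) s'' \<Longrightarrow> big B (While c1 x c2) s'' s''' \<Longrightarrow>
     big B (While c1 x c2) s s'''"

text \<open>Existence of a run includes termination and excludes getting stuck, be it for lack of
  credit, a number above \<open>B\<close> or an exhausted input.\<close>

definition wp :: "nat \<Rightarrow> com \<Rightarrow> (state \<Rightarrow> bool) \<Rightarrow> state \<Rightarrow> bool" where
  "wp B c Q s \<longleftrightarrow> (\<exists>s'. big B c s s' \<and> Q s')"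

inductive_simps big_simps:
  "big B Skip s s'" "big B (VConst x k) s s'" "big B (VAdd x y z) s s'" "big B (VSub x y z) s s'"
  "big B (VRead x) s s'" "big B (AGet x a y) s s'" "big B (APut a y x) s s'"
  "big B (c1 ;; c2) s s'" "big B (Cond x c1 c2) s s'"

text \<open>As rewrite rules these act as a verification condition generator for loop-free
  code.\<close>

lemma wp_simps [simp]:
  "wp B Skip Q s \<longleftrightarrow> Q s"
  "wp B (VConst x k) Q s \<longleftrightarrow> 0 < credit s \<and> k \<le> B \<and>
     Q (s\<lparr>var := (var s)(x := k), credit := credit s - 1\<rparr>)"
  "wp B (VAdd x y z) Q s \<longleftrightarrow> 0 < credit s \<and> var s y + var s z \<le> B \<and>
     Q (s\<lparr>var := (var s)(x := var s y + var s z), credit := credit s - 1\<rparr>)"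
  "wp B (VSub x y z) Q s \<longleftrightarrow> 0 < credit s \<and>
     Q (s\<lparr>var := (var s)(x := var s y - var s z), credit := credit s - 1\<rparr>)"
  "wp B (VRead x) Q s \<longleftrightarrow> 0 < credit s \<and> (\<exists>v vs. input s = v # vs \<and> v \<le> B \<and>
     Q (s\<lparr>var := (var s)(x := v), input := vs, credit := credit s - 1\<rparr>))"
  "wp B (AGet x a y) Q s \<longleftrightarrow> 0 < credit s \<and>
     Q (s\<lparr>var := (var s)(x := arr s a (var s y)), credit := credit s - 1\<rparr>)"
  "wp B (APut a y x) Q s \<longleftrightarrow> 0 < credit s \<and>
     Q (s\<lparr>arr := (arr s)(a := (arr s a)(var s y := var s x)), credit := credit s - 1\<rparr>)"
  "wp B (c1 ;; c2) Q s \<longleftrightarrow> wp B c1 (wp B c2 Q) s"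
  "wp B (Cond x c1 c2) Q s \<longleftrightarrow> 0 < credit s \<and>
     (0 < var s x \<longrightarrow> wp B c1 Q (s\<lparr>credit := credit s - 1\<rparr>)) \<and>
     (var s x = 0 \<longrightarrow> wp B c2 Q (s\<lparr>credit := credit s - 1\<rparr>))"
  by (auto simp: wp_def big_simps) (cases "var s x = 0"; blast)

lemma wp_mono: "wp B c Q s \<Longrightarrow> (\<And>s'. Q s' \<Longrightarrow> Q' s') \<Longrightarrow> wp B c Q' s"
  unfolding wp_def by blast

primrec vars_written :: "com \<Rightarrow> nat set" where
  "vars_written Skip = {}"
| "vars_written (VConst x k) = {x}"
| "vars_written (VAdd x y z) = {x}"
| "vars_written (VSub x y z) = {x}"
| "vars_written (VRead x) = {x}"
| "vars_written (AGet x a y) = {x}"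
| "vars_written (APut a y x) = {}"
| "vars_written (c1 ;; c2) = vars_written c1 \<union> vars_written c2"
| "vars_written (Cond x c1 c2) = vars_written c1 \<union> vars_written c2"
| "vars_written (While c1 x c2) = vars_written c1 \<union> vars_written c2"

primrec arrs_written :: "com \<Rightarrow> nat set" where
  "arrs_written Skip = {}"
| "arrs_written (VConst x k) = {}"
| "arrs_written (VAdd x y z) = {}"
| "arrs_written (VSub x y z) = {}"
| "arrs_written (VRead x) = {}"
| "arrs_written (AGet x a y) = {}"
| "arrs_written (APut a y x) = {a}"
| "arrs_written (c1 ;; c2) = arrs_written c1 \<union> arrs_written c2"
| "arrs_written (Cond x c1 c2) = arrs_written c1 \<union> arrs_written c2"
| "arrs_written (While c1 x c2) = arrs_written c1 \<union> arrs_written c2"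

primrec reads_input :: "com \<Rightarrow> bool" where
  "reads_input Skip = False"
| "reads_input (VConst x k) = False"
| "reads_input (VAdd x y z) = False"
| "reads_input (VSub x y z) = False"
| "reads_input (VRead x) = True"
| "reads_input (AGet x a y) = False"
| "reads_input (APut a y x) = False"
| "reads_input (c1 ;; c2) = (reads_input c1 \<or> reads_input c2)"
| "reads_input (Cond x c1 c2) = (reads_input c1 \<or> reads_input c2)"
| "reads_input (While c1 x c2) = (reads_input c1 \<or> reads_input c2)"

definition frame :: "com \<Rightarrow> state \<Rightarrow> state \<Rightarrow> bool" where
  "frame c s s' \<longleftrightarrow> (\<forall>x. x \<notin> vars_written c \<longrightarrow> var s' x = var s x) \<and>
     (\<forall>a. a \<notin> arrs_written c \<longrightarrow> arr s' a = arr s a) \<and> (\<not> reads_input c \<longrightarrow> input s' = input s)"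

lemma big_frame: "big B c s s' \<Longrightarrow> frame c s s'"
  by (induction rule: big.induct) (auto simp: frame_def)

lemma big_credit: "big B c s s' \<Longrightarrow> credit s' \<le> credit s"
  by (induction rule: big.induct) auto

lemma wp_frame: "wp B c Q s \<Longrightarrow> (\<And>s'. Q s' \<Longrightarrow> frame c s s' \<Longrightarrow> Q' s') \<Longrightarrow> wp B c Q' s"
  unfolding wp_def using big_frame by metis

text \<open>Each test spends a credit, so induction on the credit replaces a separate
  variant.\<close>

lemma wp_While:
  assumes inv: "I s"
    and step: "\<And>s'. I s' \<Longrightarrow> frame (While c1 x c2) s s' \<Longrightarrow>
      wp B c1 (\<lambda>s'. 0 < credit s' \<and>
        (0 < var s' x \<longrightarrow> wp B c2 I (s'\<lparr>credit := credit s' - 1\<rparr>)) \<and>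
        (var s' x = 0 \<longrightarrow> Q (s'\<lparr>credit := credit s' - 1\<rparr>))) s'"
  shows "wp B (While c1 x c2) Q s"
proof -
  have "wp B (While c1 x c2) Q s'" if "I s'" "frame (While c1 x c2) s s'" for s'
    using that
  proof (induction "credit s'" arbitrary: s' rule: less_induct)
    case less
    have ex: "\<exists>t. big B c1 s' t \<and> R t" if "wp B c1 R s'" for R
      using that by (simp add: wp_def)
    obtain t where t: "big B c1 s' t" "0 < credit t"
      "0 < var t x \<longrightarrow> wp B c2 I (t\<lparr>credit := credit t - 1\<rparr>)"
      "var t x = 0 \<longrightarrow> Q (t\<lparr>credit := credit t - 1\<rparr>)"
      using ex[OF step[OF less.prems]] by (elim exE conjE) (rule that)
    show ?case
    proof (cases "var t x = 0")
      case True
      then show ?thesis using t big.intros(11) unfolding wp_def by blast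
    next
      case False
      then obtain u where u: "big B c2 (t\<lparr>credit := credit t - 1\<rparr>) u" "I u"
        using t(3) unfolding wp_def by auto
      have "frame (While c1 x c2) s u"
        using less.prems(2) big_frame[OF t(1)] big_frame[OF u(1)] unfolding frame_def by simp
      moreover have "credit u < credit s'"
        using big_credit[OF t(1)] big_credit[OF u(1)] t(2) by simp
      ultimately obtain v where "big B (While c1 x c2) u v" "Q v"
        using less.hyps u(2) unfolding wp_def by blast
      then show ?thesis using big.intros(12)[OF t(1,2) _ u(1)] False unfolding wp_def by blast
    qed
  qed
  then show ?thesis using inv unfolding frame_def by blast
qed

section \<open>Compilation and simulation\<close>

text \<open>Variables live in the registers below 30, the registers 30 and 31 are scratch, and the cell
  \<open>i\<close> of the array \<open>a < 16\<close> is the register \<open>32 + 16 * i + a\<close>.\<close>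

definition address :: "nat \<Rightarrow> nat \<Rightarrow> instr list" where
  "address a y = [Add 31 y y, Add 31 31 31, Add 31 31 31, Add 31 31 31, Const 30 (32 + a), Add 31 31 30]"

text \<open>Lengths do not depend on the position of the code, so absolute jump targets can be
  computed from the commands alone.\<close>

primrec code_length :: "com \<Rightarrow> nat" where
  "code_length Skip = 0"
| "code_length (VConst x k) = 1"
| "code_length (VAdd x y z) = 1"
| "code_length (VSub x y z) = 1"
| "code_length (VRead x) = 1"
| "code_length (AGet x a y) = 7"
| "code_length (APut a y x) = 7"
| "code_length (c1 ;; c2) = code_length c1 + code_length c2"
| "code_length (Cond x c1 c2) = code_length c1 + code_length c2 + 3"
| "code_length (While c1 x c2) = code_length c1 + code_length c2 + 5"

text \<open>\<open>l\<close> is the absolute address of the first instruction. An unconditional jump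
  is obtained by putting 1 into the scratch register 30 and testing it.\<close>

primrec compile :: "nat \<Rightarrow> com \<Rightarrow> instr list" where
  "compile l Skip = []"
| "compile l (VConst x k) = [Const x k]"
| "compile l (VAdd x y z) = [Add x y z]"
| "compile l (VSub x y z) = [Sub x y z]"
| "compile l (VRead x) = [Read x]"
| "compile l (AGet x a y) = address a y @ [Load x 31]"
| "compile l (APut a y x) = address a y @ [Store 31 x]"
| "compile l (c1 ;; c2) = compile l c1 @ compile (l + code_length c1) c2"
| "compile l (Cond x c1 c2) =
     [JumpPos x (l + code_length c2 + 3)] @ compile (l + 1) c2 @
     [Const 30 1, JumpPos 30 (l + code_length c1 + code_length c2 + 3)] @
     compile (l + code_length c2 + 3) c1"
| "compile l (While c1 x c2) =
     compile l c1 @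
     [JumpPos x (l + code_length c1 + 3), Const 30 1,
      JumpPos 30 (l + code_length c1 + code_length c2 + 5)] @
     compile (l + code_length c1 + 3) c2 @ [Const 30 1, JumpPos 30 l]"

primrec well_formed :: "com \<Rightarrow> bool" where
  "well_formed Skip = True"
| "well_formed (VConst x k) = (x < 30)"
| "well_formed (VAdd x y z) = (x < 30 \<and> y < 30 \<and> z < 30)"
| "well_formed (VSub x y z) = (x < 30 \<and> y < 30 \<and> z < 30)"
| "well_formed (VRead x) = (x < 30)"
| "well_formed (AGet x a y) = (x < 30 \<and> a < 16 \<and> y < 30)"
| "well_formed (APut a y x) = (x < 30 \<and> a < 16 \<and> y < 30)"
| "well_formed (c1 ;; c2) = (well_formed c1 \<and> well_formed c2)"
| "well_formed (Cond x c1 c2) = (x < 30 \<and> well_formed c1 \<and> well_formed c2)"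
| "well_formed (While c1 x c2) = (x < 30 \<and> well_formed c1 \<and> well_formed c2)"

lemma length_compile [simp]: "length (compile l c) = code_length c"
  by (induction c arbitrary: l) (auto simp: address_def)

primrec code_at :: "program \<Rightarrow> nat \<Rightarrow> instr list \<Rightarrow> bool" where
  "code_at P l [] = True"
| "code_at P l (i # is) = (l < length P \<and> P ! l = i \<and> code_at P (Suc l) is)"

lemma code_at_append [simp]:
  "code_at P l (is @ js) \<longleftrightarrow> code_at P l is \<and> code_at P (l + length is) js"
  by (induction "is" arbitrary: l) auto

lemma code_at_self: "code_at (is @ js) (length is) js"
proof (induction js arbitrary: "is")
  case (Cons j js)
  from Cons[of "is @ [j]"] show ?case by simp
qed simp

definition runs :: "program \<Rightarrow> nat \<Rightarrow> nat \<Rightarrow> config \<Rightarrow> config \<Rightarrow> bool" where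
  "runs P W k \<sigma> \<sigma>' \<longleftrightarrow> (step P ^^ k) \<sigma> = \<sigma>' \<and> (\<forall>j\<le>k. \<forall>r. reg ((step P ^^ j) \<sigma>) r < W)"

lemma runs_trans:
  assumes "runs P W k \<sigma> \<sigma>'" "runs P W m \<sigma>' \<sigma>''"
  shows "runs P W (k + m) \<sigma> \<sigma>''"
  unfolding runs_def
proof (intro conjI allI impI)
  have *: "(step P ^^ (j + k)) \<sigma> = (step P ^^ j) \<sigma>'" for j
    using assms(1) by (simp add: funpow_add runs_def)
  show "(step P ^^ (k + m)) \<sigma> = \<sigma>''"
    using *[of m] assms(2) by (simp add: add.commute runs_def)
  fix j r assume "j \<le> k + m"
  show "reg ((step P ^^ j) \<sigma>) r < W"
  proof (cases "j \<le> k")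
    case True
    then show ?thesis using assms(1) by (simp add: runs_def)
  next
    case False
    then have "j = (j - k) + k" "j - k \<le> m" using \<open>j \<le> k + m\<close> by auto
    then show ?thesis using * assms(2) by (metis runs_def)
  qed
qed

lemma runs_0: "\<sigma> = \<sigma>' \<Longrightarrow> (\<And>r. reg \<sigma> r < W) \<Longrightarrow> runs P W 0 \<sigma> \<sigma>'"
  by (simp add: runs_def)

lemma runs_Suc:
  assumes "code_at P (pc \<sigma>) [i]" "\<And>r. reg \<sigma> r < W" "runs P W k (exec i \<sigma>) \<sigma>'"
  shows "runs P W (Suc k) \<sigma> \<sigma>'"
proof -
  have "step P \<sigma> = exec i \<sigma>" using assms(1) by (simp add: step_def halted_def)
  moreover from this have "runs P W 1 \<sigma> (exec i \<sigma>)"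
    using assms(2,3) unfolding runs_def by (auto simp: le_Suc_eq)
  ultimately show ?thesis using runs_trans[of P W 1] assms(3) by simp
qed

definition represents :: "nat \<Rightarrow> nat \<Rightarrow> state \<Rightarrow> config \<Rightarrow> bool" where
  "represents B W s \<sigma> \<longleftrightarrow> tape \<sigma> = input s \<and> (\<forall>x<30. reg \<sigma> x = var s x \<and> var s x \<le> B) \<and>
     (\<forall>a<16. \<forall>i. reg \<sigma> (32 + 16 * i + a) = arr s a i \<and> arr s a i \<le> B) \<and>
     reg \<sigma> 30 < W \<and> reg \<sigma> 31 < W"

text \<open>The constant covers address computations: the largest cell address that is formed is
  \<open>32 + 16 * B + 15\<close>, and it is held in a scratch register.\<close>

lemma represents_bound:
  assumes "represents B W s \<sigma>" "16 * B + 48 < W"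
  shows "reg \<sigma> r < W"
proof -
  consider "r < 30" | "r = 30" | "r = 31" | "32 \<le> r" by linarith
  then show ?thesis
  proof cases
    case 4
    then have "r = 32 + 16 * ((r - 32) div 16) + (r - 32) mod 16" by simp
    moreover have "(r - 32) mod 16 < 16" by simp
    ultimately have "reg \<sigma> r \<le> B" using assms(1) unfolding represents_def by metis
    then show ?thesis using assms(2) by simp
  qed (use assms in \<open>auto simp: represents_def\<close>)
qed

lemma address_inject:
  "a < 16 \<Longrightarrow> b < 16 \<Longrightarrow> 32 + 16 * i + a = 32 + 16 * j + b \<longleftrightarrow> i = j \<and> a = (b :: nat)"
  (is "?a \<Longrightarrow> ?b \<Longrightarrow> ?l \<longleftrightarrow> ?r")
proof
  assume *: "a < 16" "b < 16" "?l"
  then have "(16 * i + a) div 16 = (16 * j + b) div 16" by simp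
  moreover have "(16 * k + c) div 16 = k" if "c < 16" for k c :: nat using that by simp
  ultimately have "i = j" using *(1,2) by metis
  then show "?r" using *(3) by simp
qed auto

text \<open>Four doublings multiply the index by 16.\<close>

lemma runs_address:
  assumes rep: "represents B W s \<sigma>" and W: "16 * B + 48 < W" and "a < 16" "y < 30"
    and code: "code_at P (pc \<sigma>) (address a y)"
  shows "\<exists>\<sigma>'. runs P W 6 \<sigma> \<sigma>' \<and> represents B W s \<sigma>' \<and> pc \<sigma>' = pc \<sigma> + 6 \<and>
    reg \<sigma>' 31 = 32 + 16 * var s y + a"
proof -
  have y: "reg \<sigma> y = var s y" "var s y \<le> B" using rep assms(4) by (auto simp: represents_def)
  let ?\<sigma> = "\<sigma>\<lparr>pc := Suc (Suc (Suc (Suc (Suc (Suc (pc \<sigma>)))))),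
    reg := (reg \<sigma>)(30 := 32 + a, 31 := 16 * var s y + (32 + a))\<rparr>"
  have bound: "reg \<sigma> r < W" for r using represents_bound[OF rep W] .
  have "runs P W (Suc (Suc (Suc (Suc (Suc (Suc 0)))))) \<sigma> ?\<sigma>"
    apply (rule runs_Suc, use code in \<open>simp add: address_def\<close>, rule bound)
    apply (rule runs_Suc, use code in \<open>simp add: address_def\<close>, use bound y assms(3,4) W in simp)
    apply (rule runs_Suc, use code in \<open>simp add: address_def\<close>, use bound y assms(3,4) W in simp)
    apply (rule runs_Suc, use code in \<open>simp add: address_def\<close>, use bound y assms(3,4) W in simp)
    apply (rule runs_Suc, use code in \<open>simp add: address_def\<close>, use bound y assms(3,4) W in simp)
    apply (rule runs_Suc, use code in \<open>simp add: address_def\<close>, use bound y assms(3,4) W in simp)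
    apply (rule runs_0)
     apply (use y assms(4) in simp)
    apply (use bound y assms(3,4) W in simp)
    done
  moreover have "Suc (Suc (Suc (Suc (Suc (Suc 0))))) = 6" by simp
  ultimately have "runs P W 6 \<sigma> ?\<sigma>" by metis
  then show ?thesis
    using rep y(2) assms(3) W by (intro exI[of _ ?\<sigma>]) (auto simp: represents_def)
qed

lemma runs_goto:
  assumes rep: "represents B W s \<sigma>" and W: "16 * B + 48 < W"
    and code: "code_at P (pc \<sigma>) [Const 30 1, JumpPos 30 l]"
  shows "\<exists>\<sigma>'. runs P W 2 \<sigma> \<sigma>' \<and> represents B W s \<sigma>' \<and> pc \<sigma>' = l"
proof -
  let ?\<sigma> = "\<sigma>\<lparr>pc := l, reg := (reg \<sigma>)(30 := 1)\<rparr>"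
  have bound: "reg \<sigma> r < W" for r using represents_bound[OF rep W] .
  have "runs P W (Suc (Suc 0)) \<sigma> ?\<sigma>"
    apply (rule runs_Suc, use code in \<open>simp; fail\<close>, use bound W in \<open>simp; fail\<close>)+
    using bound W by (simp add: runs_def)
  then show ?thesis
    using rep W by (intro exI[of _ ?\<sigma>]) (auto simp: represents_def numeral_2_eq_2)
qed

lemma runs_test:
  assumes rep: "represents B W s \<sigma>" and W: "16 * B + 48 < W" and "x < 30"
    and code: "code_at P (pc \<sigma>) [JumpPos x l]"
  shows "\<exists>\<sigma>'. runs P W 1 \<sigma> \<sigma>' \<and> represents B W s \<sigma>' \<and>
    pc \<sigma>' = (if 0 < var s x then l else Suc (pc \<sigma>))"
proof -
  let ?\<sigma> = "\<sigma>\<lparr>pc := (if 0 < var s x then l else Suc (pc \<sigma>))\<rparr>"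
  have bound: "reg \<sigma> r < W" for r using represents_bound[OF rep W] .
  have "reg \<sigma> x = var s x" using rep assms(3) by (simp add: represents_def)
  then have "runs P W (Suc 0) \<sigma> ?\<sigma>"
    apply -
    apply (rule runs_Suc, use code in \<open>simp; fail\<close>, use bound W in \<open>simp; fail\<close>)+
    using bound W by (simp add: runs_def)
  then show ?thesis
    using rep by (intro exI[of _ ?\<sigma>]) (auto simp: represents_def)
qed

lemma represents_credit [simp]: "represents B W (s\<lparr>credit := n\<rparr>) \<sigma> = represents B W s \<sigma>"
  by (simp add: represents_def)

text \<open>The exchange rate is 7 machine steps per credit: an array access takes 6 steps for the
  address and 1 for the transfer. A test with its unconditional jump takes only 3.\<close>

definition simulated ::
    "program \<Rightarrow> nat \<Rightarrow> nat \<Rightarrow> com \<Rightarrow> state \<Rightarrow> state \<Rightarrow> bool" where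
  "simulated P B W c s s' \<longleftrightarrow>
     (\<forall>\<sigma>. well_formed c \<and> represents B W s \<sigma> \<and> code_at P (pc \<sigma>) (compile (pc \<sigma>) c) \<longrightarrow>
       (\<exists>k \<sigma>'. runs P W k \<sigma> \<sigma>' \<and> represents B W s' \<sigma>' \<and> pc \<sigma>' = pc \<sigma> + code_length c \<and>
          k + 7 * credit s' \<le> 7 * credit s))"

lemma simulated_exec:
  assumes W: "16 * B + 48 < W" and "0 < credit s" "credit s' = credit s - 1"
    and c: "compile l c = [i]" "\<And>l'. compile l' c = compile l c" "code_length c = 1"
    and i: "\<And>\<sigma>. well_formed c \<Longrightarrow> represents B W s \<sigma> \<Longrightarrow>
      represents B W s' (exec i \<sigma>) \<and> pc (exec i \<sigma>) = Suc (pc \<sigma>)"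
  shows "simulated P B W c s s'"
  unfolding simulated_def
proof (intro allI impI, elim conjE)
  fix \<sigma> assume *: "well_formed c" "represents B W s \<sigma>" "code_at P (pc \<sigma>) (compile (pc \<sigma>) c)"
  have "runs P W (Suc 0) \<sigma> (exec i \<sigma>)"
  proof (rule runs_Suc[where i = i])
    show "code_at P (pc \<sigma>) [i]" using *(3) c by metis
    show "runs P W 0 (exec i \<sigma>) (exec i \<sigma>)"
      using represents_bound[OF conjunct1[OF i[OF *(1,2)]] W] by (rule runs_0[OF refl])
  qed (rule represents_bound[OF *(2) W])
  then show "\<exists>k \<sigma>'. runs P W k \<sigma> \<sigma>' \<and> represents B W s' \<sigma>' \<and> pc \<sigma>' = pc \<sigma> + code_length c \<and>
          k + 7 * credit s' \<le> 7 * credit s"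
    using i[OF *(1,2)] assms(2,3) c(3) by (intro exI[of _ "Suc 0"] exI[of _ "exec i \<sigma>"]) auto
qed

lemma simulated_address:
  assumes W: "16 * B + 48 < W" and "0 < credit s" "credit s' = credit s - 1"
    and c: "\<And>l. compile l c = address a y @ [i]" "code_length c = 7"
    and wf: "well_formed c \<Longrightarrow> a < 16 \<and> y < 30"
    and i: "\<And>\<sigma>. well_formed c \<Longrightarrow> represents B W s \<sigma> \<Longrightarrow> reg \<sigma> 31 = 32 + 16 * var s y + a \<Longrightarrow>
      represents B W s' (exec i \<sigma>) \<and> pc (exec i \<sigma>) = Suc (pc \<sigma>)"
  shows "simulated P B W c s s'"
  unfolding simulated_def
proof (intro allI impI, elim conjE)
  fix \<sigma> assume *: "well_formed c" "represents B W s \<sigma>" "code_at P (pc \<sigma>) (compile (pc \<sigma>) c)"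
  have "length (address a y) = 6" by (simp add: address_def)
  then have code: "code_at P (pc \<sigma>) (address a y)" "code_at P (pc \<sigma> + 6) [i]"
    using *(3) c(1) by auto
  obtain \<sigma>' where \<sigma>': "runs P W 6 \<sigma> \<sigma>'" "represents B W s \<sigma>'" "pc \<sigma>' = pc \<sigma> + 6"
    "reg \<sigma>' 31 = 32 + 16 * var s y + a"
    using runs_address[OF *(2) W _ _ code(1)] wf[OF *(1)] by blast
  note e = i[OF *(1) \<sigma>'(2,4)]
  have "runs P W (Suc 0) \<sigma>' (exec i \<sigma>')"
  proof (rule runs_Suc[where i = i])
    show "code_at P (pc \<sigma>') [i]" using code(2) \<sigma>'(3) by simp
    show "runs P W 0 (exec i \<sigma>') (exec i \<sigma>')"
      using represents_bound[OF conjunct1[OF e] W] by (rule runs_0[OF refl])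
  qed (rule represents_bound[OF \<sigma>'(2) W])
  from runs_trans[OF \<sigma>'(1) this] have "runs P W 7 \<sigma> (exec i \<sigma>')" by simp
  then show "\<exists>k \<sigma>'. runs P W k \<sigma> \<sigma>' \<and> represents B W s' \<sigma>' \<and> pc \<sigma>' = pc \<sigma> + code_length c \<and>
          k + 7 * credit s' \<le> 7 * credit s"
    using e \<sigma>'(3) assms(2,3) c(2) by (intro exI[of _ 7] exI[of _ "exec i \<sigma>'"]) auto
qed

lemma big_simulated:
  assumes "big B c s s'" and W: "16 * B + 48 < W"
  shows "simulated P B W c s s'"
  using assms(1)
proof (induction rule: big.induct)
  case (1 s)
  show ?case
    unfolding simulated_def
  proof (intro allI impI)
    fix \<sigma> assume "well_formed Skip \<and> represents B W s \<sigma> \<and> code_at P (pc \<sigma>) (compile (pc \<sigma>) Skip)"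
    then show "\<exists>k \<sigma>'. runs P W k \<sigma> \<sigma>' \<and> represents B W s \<sigma>' \<and>
        pc \<sigma>' = pc \<sigma> + code_length Skip \<and> k + 7 * credit s \<le> 7 * credit s"
      using runs_0[of \<sigma> \<sigma> W P] represents_bound[OF _ W, of s \<sigma>]
      by (intro exI[of _ 0] exI[of _ \<sigma>]) auto
  qed
next
  case (2 s k x)
  then show ?case
    by (intro simulated_exec[OF W, where l = 0]) (auto simp: represents_def)
next
  case (3 s y z x)
  then show ?case
    by (intro simulated_exec[OF W, where l = 0]) (auto simp: represents_def)
next
  case (4 s x y z)
  then show ?case
    by (intro simulated_exec[OF W, where l = 0])
      (auto simp: represents_def intro: order.trans[OF diff_le_self])
next
  case (5 s v vs x)
  then show ?case
    by (intro simulated_exec[OF W, where l = 0]) (auto simp: represents_def)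
next
  case (6 s x a y)
  show ?case
    by (rule simulated_address[OF W, where a = a and y = y and i = "Load x 31"])
      (use 6 in \<open>auto simp: represents_def\<close>)
next
  case (7 s a y x)
  show ?case
  proof (rule simulated_address[OF W, where a = a and y = y and i = "Store 31 x"])
    fix \<sigma> assume "well_formed (APut a y x)" "represents B W s \<sigma>" "reg \<sigma> 31 = 32 + 16 * var s y + a"
    then show "represents B W (s\<lparr>arr := (arr s)(a := (arr s a)(var s y := var s x)),
        credit := credit s - 1\<rparr>) (exec (Store 31 x) \<sigma>) \<and> pc (exec (Store 31 x) \<sigma>) = Suc (pc \<sigma>)"
      using address_inject[of _ a _ "var s y"] by (auto simp: represents_def)
  qed (use 7 in auto)
next
  case (8 c1 s s' c2 s'')
  show ?case
    unfolding simulated_def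
  proof (intro allI impI, elim conjE)
    fix \<sigma> assume *: "well_formed (c1 ;; c2)" "represents B W s \<sigma>"
      "code_at P (pc \<sigma>) (compile (pc \<sigma>) (c1 ;; c2))"
    obtain k \<sigma>' where 1: "runs P W k \<sigma> \<sigma>'" "represents B W s' \<sigma>'" "pc \<sigma>' = pc \<sigma> + code_length c1"
      "k + 7 * credit s' \<le> 7 * credit s"
      using 8(3) * unfolding simulated_def by fastforce
    obtain k' \<sigma>'' where 2: "runs P W k' \<sigma>' \<sigma>''" "represents B W s'' \<sigma>''"
      "pc \<sigma>'' = pc \<sigma>' + code_length c2" "k' + 7 * credit s'' \<le> 7 * credit s'"
      using 8(4) * 1 unfolding simulated_def by fastforce
    show "\<exists>k \<sigma>'. runs P W k \<sigma> \<sigma>' \<and> represents B W s'' \<sigma>' \<and>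
        pc \<sigma>' = pc \<sigma> + code_length (c1 ;; c2) \<and> k + 7 * credit s'' \<le> 7 * credit s"
      using runs_trans[OF 1(1) 2(1)] 1 2 by (intro exI[of _ "k + k'"] exI[of _ \<sigma>'']) auto
  qed
next
  case (9 s x c1 s' c2)
  show ?case
    unfolding simulated_def
  proof (intro allI impI, elim conjE)
    fix \<sigma> assume *: "well_formed (Cond x c1 c2)" "represents B W s \<sigma>"
      "code_at P (pc \<sigma>) (compile (pc \<sigma>) (Cond x c1 c2))"
    let ?l = "pc \<sigma> + code_length c2 + 3"
    obtain \<sigma>1 where 1: "runs P W 1 \<sigma> \<sigma>1" "represents B W s \<sigma>1" "pc \<sigma>1 = ?l"
      using runs_test[OF *(2) W, of x P ?l] * 9(2) by auto
    have "code_at P ?l (compile ?l c1)" using *(3) by (simp add: eval_nat_numeral)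
    then obtain k \<sigma>' where 2: "runs P W k \<sigma>1 \<sigma>'" "represents B W s' \<sigma>'"
      "pc \<sigma>' = ?l + code_length c1" "k + 7 * credit s' \<le> 7 * (credit s - 1)"
      using 9(4) * 1 unfolding simulated_def by fastforce
    show "\<exists>k \<sigma>'. runs P W k \<sigma> \<sigma>' \<and> represents B W s' \<sigma>' \<and>
        pc \<sigma>' = pc \<sigma> + code_length (Cond x c1 c2) \<and> k + 7 * credit s' \<le> 7 * credit s"
      using runs_trans[OF 1(1) 2(1)] 2 9(1) by (intro exI[of _ "1 + k"] exI[of _ \<sigma>']) auto
  qed
next
  case (10 s x c2 s' c1)
  show ?case
    unfolding simulated_def
  proof (intro allI impI, elim conjE)
    fix \<sigma> assume *: "well_formed (Cond x c1 c2)" "represents B W s \<sigma>"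
      "code_at P (pc \<sigma>) (compile (pc \<sigma>) (Cond x c1 c2))"
    let ?l = "pc \<sigma> + code_length (Cond x c1 c2)"
    obtain \<sigma>1 where 1: "runs P W 1 \<sigma> \<sigma>1" "represents B W s \<sigma>1" "pc \<sigma>1 = pc \<sigma> + 1"
      using runs_test[OF *(2) W, of x P "pc \<sigma> + code_length c2 + 3"] * 10(2) by auto
    have "code_at P (pc \<sigma> + 1) (compile (pc \<sigma> + 1) c2)" using *(3) by simp
    then obtain k \<sigma>2 where 2: "runs P W k \<sigma>1 \<sigma>2" "represents B W s' \<sigma>2"
      "pc \<sigma>2 = pc \<sigma> + 1 + code_length c2" "k + 7 * credit s' \<le> 7 * (credit s - 1)"
      using 10(4) * 1 unfolding simulated_def by fastforce
    have "code_at P (pc \<sigma>2) [Const 30 1, JumpPos 30 ?l]"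
      using *(3) 2(3) by (simp add: ac_simps)
    then obtain \<sigma>3 where 3: "runs P W 2 \<sigma>2 \<sigma>3" "represents B W s' \<sigma>3" "pc \<sigma>3 = ?l"
      using runs_goto[OF 2(2) W] by blast
    show "\<exists>k \<sigma>'. runs P W k \<sigma> \<sigma>' \<and> represents B W s' \<sigma>' \<and>
        pc \<sigma>' = pc \<sigma> + code_length (Cond x c1 c2) \<and> k + 7 * credit s' \<le> 7 * credit s"
      using runs_trans[OF runs_trans[OF 1(1) 2(1)] 3(1)] 2 3 10(1)
      by (intro exI[of _ "1 + k + 2"] exI[of _ \<sigma>3]) auto
  qed
next
  case (11 c1 s s' x c2)
  show ?case
    unfolding simulated_def
  proof (intro allI impI, elim conjE)
    fix \<sigma> assume *: "well_formed (While c1 x c2)" "represents B W s \<sigma>"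
      "code_at P (pc \<sigma>) (compile (pc \<sigma>) (While c1 x c2))"
    let ?l = "pc \<sigma> + code_length (While c1 x c2)"
    obtain k \<sigma>1 where 1: "runs P W k \<sigma> \<sigma>1" "represents B W s' \<sigma>1" "pc \<sigma>1 = pc \<sigma> + code_length c1"
      "k + 7 * credit s' \<le> 7 * credit s"
      using 11(4) * unfolding simulated_def by fastforce
    obtain \<sigma>2 where 2: "runs P W 1 \<sigma>1 \<sigma>2" "represents B W s' \<sigma>2" "pc \<sigma>2 = Suc (pc \<sigma>1)"
      using runs_test[OF 1(2) W, of x P "pc \<sigma> + code_length c1 + 3"] * 1(3) 11(3) by auto
    have "code_at P (pc \<sigma>2) [Const 30 1, JumpPos 30 ?l]"
      using *(3) 1(3) 2(3) by (simp add: ac_simps)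
    then obtain \<sigma>3 where 3: "runs P W 2 \<sigma>2 \<sigma>3" "represents B W s' \<sigma>3" "pc \<sigma>3 = ?l"
      using runs_goto[OF 2(2) W] by blast
    show "\<exists>k \<sigma>'. runs P W k \<sigma> \<sigma>' \<and> represents B W (s'\<lparr>credit := credit s' - 1\<rparr>) \<sigma>' \<and>
        pc \<sigma>' = pc \<sigma> + code_length (While c1 x c2) \<and>
        k + 7 * credit (s'\<lparr>credit := credit s' - 1\<rparr>) \<le> 7 * credit s"
      using runs_trans[OF runs_trans[OF 1(1) 2(1)] 3(1)] 1 3 11(2)
      by (intro exI[of _ "k + 1 + 2"] exI[of _ \<sigma>3]) auto
  qed
next
  case (12 c1 s s' x c2 s'' s''')
  show ?case
    unfolding simulated_def
  proof (intro allI impI, elim conjE)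
    fix \<sigma> assume *: "well_formed (While c1 x c2)" "represents B W s \<sigma>"
      "code_at P (pc \<sigma>) (compile (pc \<sigma>) (While c1 x c2))"
    let ?l = "pc \<sigma> + code_length c1 + 3"
    obtain k \<sigma>1 where 1: "runs P W k \<sigma> \<sigma>1" "represents B W s' \<sigma>1" "pc \<sigma>1 = pc \<sigma> + code_length c1"
      "k + 7 * credit s' \<le> 7 * credit s"
      using 12(6) * unfolding simulated_def by fastforce
    obtain \<sigma>2 where 2: "runs P W 1 \<sigma>1 \<sigma>2" "represents B W s' \<sigma>2" "pc \<sigma>2 = ?l"
      using runs_test[OF 1(2) W, of x P ?l] * 1(3) 12(3) by auto
    have "code_at P ?l (compile ?l c2)" using *(3) by (simp add: eval_nat_numeral)
    then obtain k' \<sigma>3 where 3: "runs P W k' \<sigma>2 \<sigma>3" "represents B W s'' \<sigma>3"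
      "pc \<sigma>3 = ?l + code_length c2" "k' + 7 * credit s'' \<le> 7 * (credit s' - 1)"
      using 12(7) * 2 unfolding simulated_def by fastforce
    have "code_at P (pc \<sigma>3) [Const 30 1, JumpPos 30 (pc \<sigma>)]"
      using *(3) 3(3) by (simp add: eval_nat_numeral)
    then obtain \<sigma>4 where 4: "runs P W 2 \<sigma>3 \<sigma>4" "represents B W s'' \<sigma>4" "pc \<sigma>4 = pc \<sigma>"
      using runs_goto[OF 3(2) W] by blast
    obtain k'' \<sigma>5 where 5: "runs P W k'' \<sigma>4 \<sigma>5" "represents B W s''' \<sigma>5"
      "pc \<sigma>5 = pc \<sigma> + code_length (While c1 x c2)" "k'' + 7 * credit s''' \<le> 7 * credit s''"
      using 12(8) *(1,3) 4(2,3) unfolding simulated_def by metis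
    show "\<exists>k \<sigma>'. runs P W k \<sigma> \<sigma>' \<and> represents B W s''' \<sigma>' \<and>
        pc \<sigma>' = pc \<sigma> + code_length (While c1 x c2) \<and> k + 7 * credit s''' \<le> 7 * credit s"
      using runs_trans[OF runs_trans[OF runs_trans[OF runs_trans[OF 1(1) 2(1)] 3(1)] 4(1)] 5(1)]
        1 3 5 12(2)
      by (intro exI[of _ "k + 1 + k' + 2 + k''"] exI[of _ \<sigma>5]) auto
  qed
qed

definition initial :: "nat list \<Rightarrow> nat \<Rightarrow> state" where
  "initial xs n = \<lparr>var = \<lambda>_. 0, arr = \<lambda>_ _. 0, input = xs, credit = n\<rparr>"

lemma decides_within_if_wp:
  assumes "well_formed c" "wp B c (\<lambda>s. var s 0 = (if b then 1 else 0)) (initial xs n)"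
    and "16 * B + 48 < 2 ^ w"
  shows "decides_within (compile 0 c) w (7 * n) xs b"
proof -
  let ?P = "compile 0 c" and ?\<sigma> = "\<lparr>pc = 0, reg = (\<lambda>_. 0), tape = xs\<rparr> :: config"
  obtain s where s: "big B c (initial xs n) s" "var s 0 = (if b then 1 else 0)"
    using assms(2) unfolding wp_def by blast
  have "represents B (2 ^ w) (initial xs n) ?\<sigma>"
    using assms(3) by (simp add: represents_def initial_def)
  moreover have "code_at ?P 0 ?P" using code_at_self[of "[]" ?P] by simp
  ultimately obtain k \<sigma> where k: "runs ?P (2 ^ w) k ?\<sigma> \<sigma>" "represents B (2 ^ w) s \<sigma>"
    "pc \<sigma> = code_length c" "k + 7 * credit s \<le> 7 * n"
    using big_simulated[OF s(1) assms(3), of ?P] assms(1) unfolding simulated_def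
    by (auto simp: initial_def)
  have "run ?P xs j = (step ?P ^^ j) ?\<sigma>" for j by (simp add: run_def)
  then show ?thesis
    using k s(2) unfolding decides_within_def runs_def
    by (intro exI[of _ k]) (auto simp: halted_def represents_def)
qed


section \<open>Correctness triples with cost bounds\<close>

text \<open>Quantifying over the surplus \<open>m\<close> makes \<open>k\<close> a cost that is
  independent of the context. Resetting the credit to 0 keeps it out of postconditions, so that a
  final state can even be specified by an equation.\<close>

definition triple :: "nat \<Rightarrow> nat \<Rightarrow> com \<Rightarrow> (state \<Rightarrow> bool) \<Rightarrow> state \<Rightarrow> bool" where
  "triple B k c Q s \<longleftrightarrow>
     (\<forall>m. wp B c (\<lambda>t. Q (t\<lparr>credit := 0\<rparr>) \<and> m \<le> credit t) (s\<lparr>credit := k + m\<rparr>))"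

lemma frame_credit [simp]:
  "frame c (s\<lparr>credit := m\<rparr>) t = frame c s t" "frame c s (t\<lparr>credit := m\<rparr>) = frame c s t"
  by (simp_all add: frame_def)

lemma frame_refl [simp]: "frame c s s"
  by (simp add: frame_def)

lemma triple_credit [simp]: "triple B k c Q (s\<lparr>credit := m\<rparr>) = triple B k c Q s"
  by (simp add: triple_def)

lemma triple_conseq:
  assumes "triple B k c Q s" "k \<le> k'"
    and "\<And>t. Q t \<Longrightarrow> frame c s t \<Longrightarrow> Q' t"
  shows "triple B k' c Q' s"
  unfolding triple_def
proof
  fix m
  have "k + (k' - k + m) = k' + m" using assms(2) by simp
  then have "wp B c (\<lambda>t. Q (t\<lparr>credit := 0\<rparr>) \<and> k' - k + m \<le> credit t) (s\<lparr>credit := k' + m\<rparr>)"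
    using assms(1) unfolding triple_def by metis
  then show "wp B c (\<lambda>t. Q' (t\<lparr>credit := 0\<rparr>) \<and> m \<le> credit t) (s\<lparr>credit := k' + m\<rparr>)"
    by (rule wp_frame) (use assms(3) in auto)
qed

lemma triple_Seq:
  assumes "triple B k1 c1 Q s" and "\<And>t. Q t \<Longrightarrow> frame c1 s t \<Longrightarrow> triple B k2 c2 Q' t"
  shows "triple B (k1 + k2) (c1 ;; c2) Q' s"
  unfolding triple_def
proof
  fix m
  have "wp B c1 (\<lambda>t. Q (t\<lparr>credit := 0\<rparr>) \<and> k2 + m \<le> credit t) (s\<lparr>credit := k1 + (k2 + m)\<rparr>)"
    using assms(1) unfolding triple_def by blast
  then have "wp B c1 (wp B c2 (\<lambda>t. Q' (t\<lparr>credit := 0\<rparr>) \<and> m \<le> credit t)) (s\<lparr>credit := k1 + (k2 + m)\<rparr>)"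
  proof (rule wp_frame)
    fix t assume t: "Q (t\<lparr>credit := 0\<rparr>) \<and> k2 + m \<le> credit t" "frame c1 (s\<lparr>credit := k1 + (k2 + m)\<rparr>) t"
    then have "triple B k2 c2 Q' t" using assms(2)[of "t\<lparr>credit := 0\<rparr>"] by simp
    then have "wp B c2 (\<lambda>t. Q' (t\<lparr>credit := 0\<rparr>) \<and> credit t' - k2 \<le> credit t)
      (t\<lparr>credit := k2 + (credit t' - k2)\<rparr>)" for t' :: state
      unfolding triple_def by blast
    from this[of t] t(1)
    show "wp B c2 (\<lambda>t. Q' (t\<lparr>credit := 0\<rparr>) \<and> m \<le> credit t) t"
      by (auto elim!: wp_mono)
  qed
  then show "wp B (c1 ;; c2) (\<lambda>t. Q' (t\<lparr>credit := 0\<rparr>) \<and> m \<le> credit t) (s\<lparr>credit := k1 + k2 + m\<rparr>)"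
    by (simp add: add.assoc)
qed

lemma triple_Seq_exact:
  assumes "triple B k1 c1 (\<lambda>t. t = u) s" "triple B k2 c2 Q u"
  shows "triple B (k1 + k2) (c1 ;; c2) Q s"
  using assms(1) by (rule triple_Seq) (use assms(2) in simp)

lemma triple_ex: "triple B k c Q s \<Longrightarrow> \<exists>t. Q t"
  unfolding triple_def wp_def by blast

text \<open>\<open>\<mu>\<close> bounds the number of rounds. Each round pays for \<open>c1\<close>,
  one test and \<open>c2\<close>; the final \<open>k1 + 1\<close> pays for the last evaluation and
  the failing test.\<close>

lemma triple_While:
  assumes inv: "I (s\<lparr>credit := 0\<rparr>)"
    and step: "\<And>t. I t \<Longrightarrow> frame (While c1 x c2) s t \<Longrightarrow>
      triple B k1 c1 (\<lambda>u. (var u x = 0 \<longrightarrow> Q u) \<and>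
        (0 < var u x \<longrightarrow> triple B k2 c2 (\<lambda>v. I v \<and> \<mu> v < \<mu> t) u)) t"
  shows "triple B ((k1 + k2 + 1) * \<mu> (s\<lparr>credit := 0\<rparr>) + k1 + 1) (While c1 x c2) Q s"
  unfolding triple_def
proof
  fix m
  let ?I = "\<lambda>t. I (t\<lparr>credit := 0\<rparr>) \<and>
    (k1 + k2 + 1) * \<mu> (t\<lparr>credit := 0\<rparr>) + k1 + 1 + m \<le> credit t"
  show "wp B (While c1 x c2) (\<lambda>t. Q (t\<lparr>credit := 0\<rparr>) \<and> m \<le> credit t)
    (s\<lparr>credit := (k1 + k2 + 1) * \<mu> (s\<lparr>credit := 0\<rparr>) + k1 + 1 + m\<rparr>)"
  proof (rule wp_While[where I = ?I])
    fix t assume t: "?I t"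
      "frame (While c1 x c2) (s\<lparr>credit := (k1 + k2 + 1) * \<mu> (s\<lparr>credit := 0\<rparr>) + k1 + 1 + m\<rparr>) t"
    let ?t = "t\<lparr>credit := 0\<rparr>"
    have "triple B k1 c1 (\<lambda>u. (var u x = 0 \<longrightarrow> Q u) \<and>
        (0 < var u x \<longrightarrow> triple B k2 c2 (\<lambda>v. I v \<and> \<mu> v < \<mu> ?t) u)) ?t"
      using step[of ?t] t by simp
    then have "wp B c1 (\<lambda>u. ((var u x = 0 \<longrightarrow> Q (u\<lparr>credit := 0\<rparr>)) \<and>
        (0 < var u x \<longrightarrow> triple B k2 c2 (\<lambda>v. I v \<and> \<mu> v < \<mu> ?t) u)) \<and> credit t - k1 \<le> credit u) t"
      unfolding triple_def[of B k1] using t(1)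
      by (auto dest!: spec[of _ "credit t - k1"])
    then show "wp B c1 (\<lambda>u. 0 < credit u \<and>
        (0 < var u x \<longrightarrow> wp B c2 ?I (u\<lparr>credit := credit u - 1\<rparr>)) \<and>
        (var u x = 0 \<longrightarrow> Q (u\<lparr>credit := credit u - 1, credit := 0\<rparr>) \<and>
          m \<le> credit (u\<lparr>credit := credit u - 1\<rparr>))) t"
    proof (rule wp_mono, intro conjI impI)
      fix u assume u: "((var u x = 0 \<longrightarrow> Q (u\<lparr>credit := 0\<rparr>)) \<and>
        (0 < var u x \<longrightarrow> triple B k2 c2 (\<lambda>v. I v \<and> \<mu> v < \<mu> ?t) u)) \<and> credit t - k1 \<le> credit u"
      have "k1 + 1 + m \<le> (k1 + k2 + 1) * \<mu> ?t + k1 + 1 + m" by simp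
      also have "\<dots> \<le> credit t" using t(1) by blast
      finally have "k1 + 1 + m \<le> credit t" .
      then show "0 < credit u" "m \<le> credit (u\<lparr>credit := credit u - 1\<rparr>)" using u by auto
      show "Q (u\<lparr>credit := credit u - 1, credit := 0\<rparr>)" if "var u x = 0" using u that by simp
      assume "0 < var u x"
      then have tr: "triple B k2 c2 (\<lambda>v. I v \<and> \<mu> v < \<mu> ?t) u" using u by blast
      \<comment> \<open>The body has a run, and its end state has a smaller measure; so the measure
        was positive before.\<close>
      then have "0 < \<mu> ?t" using triple_ex by fastforce
      then obtain j where j: "\<mu> ?t = Suc j" by (cases "\<mu> ?t") auto
      let ?r = "(k1 + k2 + 1) * j + k1 + 1 + m"
      have "?r \<le> credit u - 1 - k2" "k2 \<le> credit u - 1" using t(1) u j by auto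
      moreover have "wp B c2 (\<lambda>v. (I (v\<lparr>credit := 0\<rparr>) \<and> \<mu> (v\<lparr>credit := 0\<rparr>) < \<mu> ?t) \<and>
          credit u - 1 - k2 \<le> credit v) (u\<lparr>credit := k2 + (credit u - 1 - k2)\<rparr>)"
        using tr unfolding triple_def by blast
      ultimately have "wp B c2 (\<lambda>v. (I (v\<lparr>credit := 0\<rparr>) \<and> \<mu> (v\<lparr>credit := 0\<rparr>) < \<mu> ?t) \<and>
          ?r \<le> credit v) (u\<lparr>credit := credit u - 1\<rparr>)"
        by (auto elim!: wp_mono)
      then show "wp B c2 ?I (u\<lparr>credit := credit u - 1\<rparr>)"
      proof (rule wp_mono)
        fix v assume v: "(I (v\<lparr>credit := 0\<rparr>) \<and> \<mu> (v\<lparr>credit := 0\<rparr>) < \<mu> ?t) \<and> ?r \<le> credit v"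
        then have "(k1 + k2 + 1) * \<mu> (v\<lparr>credit := 0\<rparr>) \<le> (k1 + k2 + 1) * j"
          using j by (intro mult_le_mono2) simp
        then show "?I v" using v by linarith
      qed
    qed
  qed (use inv in simp)
qed

text \<open>The counter of a loop is variable 4; variable 1 holds the constant 1.\<close>

definition for_loop :: "nat \<Rightarrow> com \<Rightarrow> com" where
  "for_loop n c = VConst 4 0 ;; While (VSub 5 n 4) 5 (c ;; VAdd 4 4 1)"

text \<open>The 3 per round pays for the increment, the subtraction and the test; the other 3 pays
  for the initialisation and the last, failing test. \<open>insens\<close> says that the invariant
  ignores the counter, the test variable 5 and the credit, which the loop itself changes.\<close>

lemma triple_for_loop:
  assumes n: "var s n = N" "n \<notin> {4, 5}" "N \<le> B" and one: "var s 1 = 1"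
    and vars: "{1, 4, n} \<inter> vars_written c = {}"
    and insens: "\<And>i s t. I i s \<Longrightarrow> arr t = arr s \<Longrightarrow> input t = input s \<Longrightarrow>
      (\<And>x. x \<noteq> 4 \<Longrightarrow> x \<noteq> 5 \<Longrightarrow> var t x = var s x) \<Longrightarrow> I i t"
    and init: "I 0 s"
    and body: "\<And>i t. I i t \<Longrightarrow> i < N \<Longrightarrow> var t 4 = i \<Longrightarrow> var t 1 = 1 \<Longrightarrow>
      frame (for_loop n c) s t \<Longrightarrow> triple B k c (I (Suc i)) t"
  shows "triple B ((k + 3) * N + 3) (for_loop n c) (I N) s"
proof -
  let ?s = "s\<lparr>var := (var s)(4 := 0), credit := 0\<rparr>"
  define w where "w = While (VSub 5 n 4) 5 (c ;; VAdd 4 4 1)"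
  have fl: "for_loop n c = VConst 4 0 ;; w" by (simp add: for_loop_def w_def)
  have "triple B 1 (VConst 4 0) (\<lambda>t. t = ?s) s"
    by (simp add: triple_def)
  moreover have "triple B ((k + 3) * N + 2) w (I N) ?s"
  proof -
    let ?\<mu> = "\<lambda>t. N - var t 4"
    have "triple B ((1 + (k + 1) + 1) * ?\<mu> (?s\<lparr>credit := 0\<rparr>) + 1 + 1) w (I N) ?s"
      unfolding w_def
    proof (rule triple_While[where I = "\<lambda>t. var t 4 \<le> N \<and> I (var t 4) t"])
      show "var (?s\<lparr>credit := 0\<rparr>) 4 \<le> N \<and> I (var (?s\<lparr>credit := 0\<rparr>) 4) (?s\<lparr>credit := 0\<rparr>)"
        using insens[OF init] by simp
      fix t assume t: "var t 4 \<le> N \<and> I (var t 4) t" "frame (While (VSub 5 n 4) 5 (c ;; VAdd 4 4 1)) ?s t"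
      have vt: "var t 1 = 1" "var t n = N"
        using t(2) n one vars unfolding frame_def by auto
      let ?u = "t\<lparr>var := (var t)(5 := N - var t 4), credit := 0\<rparr>"
      have "triple B 1 (VSub 5 n 4) (\<lambda>u. u = ?u) t"
        using vt by (simp add: triple_def)
      moreover have "triple B (k + 1) (c ;; VAdd 4 4 1) (\<lambda>v. (var v 4 \<le> N \<and> I (var v 4) v) \<and> ?\<mu> v < ?\<mu> t) ?u"
        if lt: "0 < var ?u 5"
      proof (rule triple_Seq)
        have "frame (for_loop n c) s ?u"
          using t(2) unfolding frame_def for_loop_def by auto
        then show "triple B k c (I (Suc (var t 4))) ?u"
          using body[of "var t 4" ?u] insens[of "var t 4" t ?u] t(1) lt vt by simp
        fix v assume v: "I (Suc (var t 4)) v" "frame c ?u v"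
        then have "var v 4 = var t 4" "var v 1 = 1" using vars vt unfolding frame_def by auto
        then show "triple B 1 (VAdd 4 4 1) (\<lambda>v. (var v 4 \<le> N \<and> I (var v 4) v) \<and> ?\<mu> v < ?\<mu> t) v"
          using lt n(3) insens[OF v(1)] by (simp add: triple_def)
      qed
      moreover have "I N ?u" if "var ?u 5 = 0"
      proof -
        have "var t 4 = N" using that t(1) by simp
        then show ?thesis using insens[of N t ?u] t(1) by simp
      qed
      ultimately show "triple B 1 (VSub 5 n 4) (\<lambda>u. (var u 5 = 0 \<longrightarrow> I N u) \<and>
        (0 < var u 5 \<longrightarrow> triple B (k + 1) (c ;; VAdd 4 4 1)
           (\<lambda>v. (var v 4 \<le> N \<and> I (var v 4) v) \<and> ?\<mu> v < ?\<mu> t) u)) t"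
        by (elim triple_conseq) auto
    qed
    then show ?thesis by (simp add: algebra_simps eval_nat_numeral)
  qed
  ultimately have "triple B (1 + ((k + 3) * N + 2)) (for_loop n c) (I N) s"
    unfolding fl by (elim triple_Seq) simp
  then show ?thesis by (rule triple_conseq) auto
qed


section \<open>Elimination orders of forests\<close>

text \<open>Deleting a leaf loses at most one edge. This makes the length of the edge list linear in
  the number of vertices.\<close>

lemma bridged_edges_card:
  assumes "bridged E U" "finite U"
  shows "card {e \<in> E. \<exists>x\<in>U. \<exists>y\<in>U. e = {x, y}} \<le> card U"
  using assms
proof (induction "card U" arbitrary: U rule: less_induct)
  case less
  let ?edges = "\<lambda>U. {e \<in> E. \<exists>x\<in>U. \<exists>y\<in>U. e = {x, y}}"
  show ?case
  proof (cases "\<exists>a\<in>U. \<exists>b\<in>U. {a, b} \<in> E")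
    case False
    then have "?edges U = {}" by blast
    then show ?thesis by (metis card.empty le0)
  next
    case True
    then obtain a b where ab: "a \<in> U" "b \<in> U" "{a, b} \<in> E" by blast
    obtain u p v where v: "v \<in> U" "{x \<in> U. {v, x} \<in> E} = {u}"
      by (rule bridged_safe_vertex[OF less.prems ab]) (rule that)
    have "?edges U \<subseteq> insert {v, u} (?edges (U - {v}))"
    proof
      fix e assume "e \<in> ?edges U"
      then obtain x y where e: "e \<in> E" "x \<in> U" "y \<in> U" "e = {x, y}" by blast
      have "z = u" if "z \<in> U" "{v, z} \<in> E" for z using that v(2) by blast
      moreover have "{v, x} \<in> E" if "y = v" using e that by (simp add: insert_commute)
      ultimately show "e \<in> insert {v, u} (?edges (U - {v}))"
        using e by (cases "x = v"; cases "y = v") auto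
    qed
    moreover have "finite (?edges (U - {v}))"
      by (rule finite_subset[of _ "Pow U"]) (use less.prems(2) in auto)
    ultimately have "card (?edges U) \<le> card (insert {v, u} (?edges (U - {v})))"
      by (intro card_mono) auto
    also have "\<dots> \<le> Suc (card (?edges (U - {v})))" by (rule card_insert_le_m1) auto
    also have "card (?edges (U - {v})) \<le> card (U - {v})"
      using less.prems v(1) bridged_subset[of E U "U - {v}"] card_Diff1_less[of U v]
      by (intro less.hyps) auto
    also have "Suc (card (U - {v})) = card U"
      using v(1) less.prems(2) by (metis card_Suc_Diff1)
    finally show ?thesis by simp
  qed
qed

section \<open>Counting tokens by cutting off leaves\<close>

text \<open>Weights instead of token sets, because a vertex accumulates the tokens of the leaves
  that were cut off from it.\<close>

definition balanced ::
    "'v set set \<Rightarrow> 'v set \<Rightarrow> ('v \<Rightarrow> nat) \<Rightarrow> ('v \<Rightarrow> nat) \<Rightarrow> bool" where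
  "balanced F U f g \<longleftrightarrow> (\<forall>C. closed_in F U C \<longrightarrow> sum f C = sum g C)"

lemma closed_in_finite: "closed_in F U C \<Longrightarrow> finite U \<Longrightarrow> finite C"
  unfolding closed_in_def using finite_subset by blast

lemma balanced_isolated:
  assumes "finite U" "x \<in> U" "\<And>y. y \<in> U - {x} \<Longrightarrow> {x, y} \<notin> F"
  shows "balanced F U f g \<longleftrightarrow> f x = g x \<and> balanced F (U - {x}) f g"
proof
  have sym: "y \<in> U - {x} \<Longrightarrow> {y, x} \<notin> F" for y
    using assms(3)[of y] by (metis insert_commute)
  assume bal: "balanced F U f g"
  have "closed_in F U {x}" using assms unfolding closed_in_def by blast
  then have "sum f {x} = sum g {x}" using bal unfolding balanced_def by blast
  moreover have "closed_in F U C" if "closed_in F (U - {x}) C" for C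
    using that sym unfolding closed_in_def by blast
  ultimately show "f x = g x \<and> balanced F (U - {x}) f g"
    using bal unfolding balanced_def by simp
next
  assume bal: "f x = g x \<and> balanced F (U - {x}) f g"
  show "balanced F U f g"
    unfolding balanced_def
  proof (intro allI impI)
    fix C assume C: "closed_in F U C"
    then have "closed_in F (U - {x}) (C - {x})" unfolding closed_in_def by blast
    then have "sum f (C - {x}) = sum g (C - {x})" using bal unfolding balanced_def by blast
    moreover have "sum h C = (if x \<in> C then h x else 0) + sum h (C - {x})" for h :: "'a \<Rightarrow> nat"
    proof (cases "x \<in> C")
      case True
      then show ?thesis using sum.remove[OF closed_in_finite[OF C assms(1)] True, of h] by presburger
    qed simp
    ultimately show "sum f C = sum g C" using bal by presburger
  qed
qed

text \<open>A closed set contains \<open>x\<close> iff it contains \<open>p\<close>, so shifting the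
  weight of \<open>x\<close> to \<open>p\<close> changes no relevant sum.\<close>

lemma balanced_leaf:
  assumes "finite U" "x \<in> U" "p \<in> U" "x \<noteq> p" "{x, p} \<in> F"
    and only: "\<And>y. y \<in> U - {x} \<Longrightarrow> {x, y} \<in> F \<Longrightarrow> y = p"
  shows "balanced F U f g \<longleftrightarrow>
    balanced F (U - {x}) (f(p := f p + f x)) (g(p := g p + g x))"
proof -
  have only': "y = p" if "y \<in> U - {x}" "{y, x} \<in> F" for y
    by (rule only) (use that in \<open>simp_all add: insert_commute\<close>)
  have sum_in: "sum (h(p := h p + h x)) C = sum h (insert x C)"
    if "finite C" "p \<in> C" "x \<notin> C" for h :: "'a \<Rightarrow> nat" and C
  proof -
    have "sum (h(p := h p + h x)) (C - {p}) = sum h (C - {p})" by (rule sum.cong) auto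
    then show ?thesis
      using that sum.remove[of C p h] sum.remove[of C p "h(p := h p + h x)"]
      by (simp del: fun_upd_apply add: fun_upd_same)
  qed
  have sum_out: "sum (h(p := h p + h x)) C = sum h C" if "p \<notin> C" for h :: "'a \<Rightarrow> nat" and C
    using that by (intro sum.cong) auto
  show ?thesis
  proof
    assume bal: "balanced F U f g"
    show "balanced F (U - {x}) (f(p := f p + f x)) (g(p := g p + g x))"
      unfolding balanced_def
    proof (intro allI impI)
      fix C assume C: "closed_in F (U - {x}) C"
      then have fin: "finite C" "x \<notin> C"
        using assms(1) closed_in_finite by (auto simp: closed_in_def)
      show "sum (f(p := f p + f x)) C = sum (g(p := g p + g x)) C"
      proof (cases "p \<in> C")
        case True
        have "closed_in F U (insert x C)"
          unfolding closed_in_def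
        proof (intro conjI ballI impI)
          show "insert x C \<subseteq> U" using C assms(2) unfolding closed_in_def by blast
          fix a b assume ab: "a \<in> insert x C" "b \<in> U" "{a, b} \<in> F"
          show "b \<in> insert x C"
          proof (cases "b = x")
            case False
            then show ?thesis using ab only[of b] True C unfolding closed_in_def by blast
          qed simp
        qed
        then show ?thesis using bal sum_in[OF fin(1) True fin(2)] unfolding balanced_def by simp
      next
        case False
        have "closed_in F U C"
          unfolding closed_in_def
        proof (intro conjI ballI impI)
          show "C \<subseteq> U" using C unfolding closed_in_def by blast
          fix a b assume ab: "a \<in> C" "b \<in> U" "{a, b} \<in> F"
          have "a \<in> U - {x}" using ab(1) C unfolding closed_in_def by blast
          then have "b \<noteq> x" using only' ab False by blast
          then show "b \<in> C" using ab C unfolding closed_in_def by blast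
        qed
        then show ?thesis using bal sum_out[OF False] unfolding balanced_def by simp
      qed
    qed
  next
    assume bal: "balanced F (U - {x}) (f(p := f p + f x)) (g(p := g p + g x))"
    show "balanced F U f g"
      unfolding balanced_def
    proof (intro allI impI)
      fix C assume C: "closed_in F U C"
      have fin: "finite (C - {x})" using closed_in_finite[OF C assms(1)] by simp
      have xp: "x \<in> C \<longleftrightarrow> p \<in> C"
        using C assms(2,3,5) unfolding closed_in_def by (metis insert_commute)
      have "closed_in F (U - {x}) (C - {x})" using C unfolding closed_in_def by blast
      then have eq: "sum (f(p := f p + f x)) (C - {x}) = sum (g(p := g p + g x)) (C - {x})"
        using bal unfolding balanced_def by blast
      show "sum f C = sum g C"
      proof (cases "p \<in> C")
        case True
        then have "p \<in> C - {x}" "insert x (C - {x}) = C" using assms(4) xp by auto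
        then show ?thesis using eq sum_in[OF fin] by simp
      next
        case False
        then have "p \<notin> C - {x}" "C - {x} = C" using xp by auto
        then show ?thesis using eq sum_out[of "C - {x}"] by simp
      qed
    qed
  qed
qed

text \<open>The vertices are listed so that each has at most one neighbour later in the list, its parent;
  the number \<open>n\<close> stands for a missing parent.\<close>

locale elimination =
  fixes n :: nat and E :: "nat set set" and par ord :: "nat \<Rightarrow> nat"
  assumes bij: "bij_betw ord {..<n} {..<n}"
    and par_le: "\<And>i. i < n \<Longrightarrow> par (ord i) \<le> n"
    and par_eq: "\<And>i. i < n \<Longrightarrow> {y. {ord i, y} \<in> E} - ord ` {..<i} = {par (ord i)} - {n}"
    and edge: "\<And>x y. {x, y} \<in> E \<Longrightarrow> x < n \<and> y < n \<and> x \<noteq> y"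
begin

lemma ord_less: "i < n \<Longrightarrow> ord i < n"
  using bij by (auto simp: bij_betw_def)

lemma ord_eq_iff: "i < n \<Longrightarrow> j < n \<Longrightarrow> ord i = ord j \<longleftrightarrow> i = j"
  using bij by (auto simp: bij_betw_def inj_on_def)

lemma ex_ord: "y < n \<Longrightarrow> \<exists>i<n. y = ord i"
  using bij by (auto simp: bij_betw_def image_def)

lemma par_le': "y < n \<Longrightarrow> par y \<le> n"
  using ex_ord par_le by blast

lemma par_edge: "y < n \<Longrightarrow> par y \<noteq> n \<Longrightarrow> {y, par y} \<in> E"
  using ex_ord[of y] par_eq by blast

lemma par_notin: "i < n \<Longrightarrow> par (ord i) \<notin> ord ` {..<Suc i}"
proof
  assume i: "i < n" and mem: "par (ord i) \<in> ord ` {..<Suc i}"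
  then have "par (ord i) < n" using ord_less by auto
  then have e: "{ord i, par (ord i)} \<in> E" "par (ord i) \<notin> ord ` {..<i}"
    using par_eq[OF i] by blast+
  then have "par (ord i) = ord i" using mem by (auto simp: less_Suc_eq)
  then show False using e(1) edge by metis
qed

lemma par_later: "i < n \<Longrightarrow> j < n \<Longrightarrow> par (ord i) = ord j \<Longrightarrow> i < j"
  using par_notin[of i] by (metis imageI lessThan_iff not_less_eq)

lemma par_neq: "y < n \<Longrightarrow> par y \<noteq> y"
  using par_edge edge by (metis less_irrefl)

lemma par_par_neq: "y < n \<Longrightarrow> par (par y) \<noteq> y \<or> par y = n"
proof -
  assume y: "y < n"
  then obtain i where i: "i < n" "y = ord i" using ex_ord by blast
  show ?thesis
  proof (cases "par y = n")
    case False
    then obtain j where j: "j < n" "par y = ord j" using ex_ord par_le'[OF y] by (metis le_neq_implies_less)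
    then show ?thesis using par_later[OF i(1) j(1)] par_later[OF j(1) i(1)] i(2) by fastforce
  qed simp
qed

text \<open>Of the two ends of an edge, the one earlier in the order has the other as its
  parent.\<close>

lemma edge_iff: "{x, y} \<in> E \<longleftrightarrow> x < n \<and> y < n \<and> (par x = y \<or> par y = x)"
proof
  assume e: "{x, y} \<in> E"
  then have lt: "x < n" "y < n" "x \<noteq> y" using edge by auto
  then obtain i j where ij: "i < n" "x = ord i" "j < n" "y = ord j" using ex_ord by metis
  have *: "par (ord i) = ord j" if "i < j" "{ord i, ord j} \<in> E" "j < n" for i j
  proof -
    have "ord j \<notin> ord ` {..<i}" using that ord_eq_iff by auto
    then have "ord j \<in> {par (ord i)} - {n}" using that par_eq[of i] by auto
    then show ?thesis by simp
  qed
  have "i < j \<or> j < i" using lt(3) ij by (metis linorder_neqE_nat)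
  then have "par x = y \<or> par y = x" using * ij e by (metis insert_commute)
  then show "x < n \<and> y < n \<and> (par x = y \<or> par y = x)" using lt by blast
next
  assume "x < n \<and> y < n \<and> (par x = y \<or> par y = x)"
  then show "{x, y} \<in> E" using par_edge by (metis insert_commute less_irrefl)
qed

text \<open>\<open>D\<close> is the stuckness within the subtree, determined from the leaves
  upwards; \<open>R\<close> is determined from the roots downwards. Below a token, the second guard
  of a child must be a grandchild; above it, the second guard of the parent is a sibling or the
  grandparent.\<close>

lemma rigid_eq:
  assumes I: "I \<subseteq> {..<n}"
    and D: "\<And>y. y < n \<Longrightarrow> D y \<longleftrightarrow> y \<in> I \<and> (\<forall>z<n. par z = y \<longrightarrow> (\<exists>y'<n. par y' = z \<and> D y'))"
    and R: "\<And>y. y < n \<Longrightarrow> R y \<longleftrightarrow> D y \<and> (par y = n \<or>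
      (\<exists>y'<n. y' \<noteq> y \<and> par y' = par y \<and> D y') \<or> (par (par y) < n \<and> R (par (par y))))"
  shows "rigid E {..<n} I = {y. y < n \<and> R y}"
proof
  let ?S = "rigid E {..<n} I"
  have S: "y < n" "y \<in> I" if "y \<in> ?S" for y using rigid_subset[of E "{..<n}" I] that by auto
  have other: "\<exists>y'\<in>?S. y' \<noteq> y \<and> {y', z} \<in> E" if "y \<in> ?S" "{y, z} \<in> E" for y z
    using frozen_rigid[of E "{..<n}" I] that edge unfolding frozen_def by blast
  \<comment> \<open>Induction along the order: the other guard of a child \<open>z\<close> cannot be
    the parent of \<open>z\<close>, so it is a child of \<open>z\<close> and comes earlier.\<close>
  have SD: "i < n \<Longrightarrow> ord i \<in> ?S \<Longrightarrow> D (ord i)" for i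
  proof (induction i rule: less_induct)
    case (less i)
    have "\<exists>y'<n. par y' = z \<and> D y'" if z: "z < n" "par z = ord i" for z
    proof -
      have "{ord i, z} \<in> E" using z S(1)[OF less.prems(2)] edge_iff by blast
      then obtain y' where y': "y' \<in> ?S" "y' \<noteq> ord i" "{y', z} \<in> E"
        using other less.prems(2) by blast
      then have pz: "par y' = z" using edge_iff z by blast
      obtain j k where jk: "j < n" "y' = ord j" "k < n" "z = ord k"
        using ex_ord S(1)[OF y'(1)] z by metis
      have "j < i" using par_later[of j k] par_later[of k i] jk pz z less.prems(1) by auto
      then have "D y'" using less.IH jk y'(1) by blast
      then show ?thesis using pz S(1)[OF y'(1)] by blast
    qed
    then show ?case using D S[OF less.prems(2)] by blast
  qed
  then have SD: "D y" if "y \<in> ?S" for y using that ex_ord[OF S(1)[OF that]] by blast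
  \<comment> \<open>Induction from the end of the order: a guard that is not a sibling is the
    grandparent, which comes later.\<close>
  have SR: "i < n \<Longrightarrow> ord i \<in> ?S \<Longrightarrow> R (ord i)" for i
  proof (induction "n - i" arbitrary: i rule: less_induct)
    case less
    let ?y = "ord i"
    have y: "?y < n" using less.prems ord_less by blast
    have Dy: "D ?y" using SD less.prems(2) by blast
    have "R ?y" if pn: "par ?y \<noteq> n"
    proof -
      have "{?y, par ?y} \<in> E" using pn par_edge y by blast
      then obtain y' where y': "y' \<in> ?S" "y' \<noteq> ?y" "{y', par ?y} \<in> E"
        using other less.prems(2) by blast
      show ?thesis
      proof (cases "par y' = par ?y")
        case True
        then have "\<exists>y'<n. y' \<noteq> ?y \<and> par y' = par ?y \<and> D y'"
          using SD[OF y'(1)] S(1)[OF y'(1)] y'(2) by blast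
        then show ?thesis using Dy by (subst R[OF y]) blast
      next
        case False
        then have pp: "par (par ?y) = y'" using y'(3) edge_iff by blast
        obtain j k where jk: "j < n" "y' = ord j" "k < n" "par ?y = ord k"
          using ex_ord S(1)[OF y'(1)] pn par_le'[OF y] by (metis le_neq_implies_less)
        have "i < j" using par_later[of i k] par_later[of k j] jk pp less.prems(1) by auto
        then have "R y'" using less.hyps[of j] jk y'(1) by auto
        then show ?thesis using Dy pp S(1)[OF y'(1)] by (subst R[OF y]) blast
      qed
    qed
    then show ?case using Dy by (cases "par ?y = n") (subst R[OF y], blast+)
  qed
  then show "?S \<subseteq> {y. y < n \<and> R y}" using ex_ord S(1) by blast
  let ?T = "{y. y < n \<and> R y}"
  have "frozen E {..<n} I ?T"
    unfolding frozen_def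
  proof (intro conjI ballI impI)
    show "?T \<subseteq> I \<inter> {..<n}" using R D by blast
    fix u z assume u: "u \<in> ?T" and z: "z \<in> {..<n}" "{u, z} \<in> E"
    have un: "u < n" "R u" "D u" using u R by blast+
    show "\<exists>u'\<in>?T. u' \<noteq> u \<and> {u', z} \<in> E"
    proof (cases "par z = u")
      case True
      then obtain y where y: "y < n" "par y = z" "D y" using D[OF un(1)] un(3) z(1) by blast
      \<comment> \<open>Stuck grandchildren of a vertex with \<open>R\<close> inherit
        \<open>R\<close> through the grandparent clause.\<close>
      have "R y" using y True un by (subst R[OF y(1)]) blast
      moreover have "y \<noteq> u" using par_par_neq[OF y(1)] y(2) z(1) True by auto
      ultimately show ?thesis using y z(1) edge_iff by blast
    next
      case False
      then have pz: "par u = z" using z edge_iff by blast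
      then have "par u \<noteq> n" using z(1) by auto
      then consider y' where "y' < n" "y' \<noteq> u" "par y' = z" "D y'" | "par z < n" "R (par z)"
        using R[OF un(1)] un(2) pz by blast
      then show ?thesis
      proof cases
        case 1
        \<comment> \<open>The sibling clause is symmetric: \<open>u\<close> is itself the stuck
          sibling that \<open>y'\<close> requires.\<close>
        then have "R y'" using R[of y'] un pz by metis
        then show ?thesis using 1 z(1) edge_iff by blast
      next
        case 2
        then show ?thesis using False z(1) edge_iff by blast
      qed
    qed
  qed
  then show "?T \<subseteq> ?S" by (rule frozen_le_rigid)
qed

end


section \<open>The linear-time program\<close>

abbreviation (input) "vAns \<equiv> 0 :: nat"
abbreviation (input) "vOne \<equiv> 1 :: nat"
abbreviation (input) "vN \<equiv> 2 :: nat"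
abbreviation (input) "vLen \<equiv> 3 :: nat"
abbreviation (input) "vI \<equiv> 4 :: nat"
abbreviation (input) "vX \<equiv> 6 :: nat"
abbreviation (input) "vP \<equiv> 7 :: nat"
abbreviation (input) "vK \<equiv> 8 :: nat"
abbreviation (input) "vA \<equiv> 9 :: nat"
abbreviation (input) "vB \<equiv> 10 :: nat"
abbreviation (input) "vC \<equiv> 11 :: nat"
abbreviation (input) "vD \<equiv> 12 :: nat"
abbreviation (input) "vTwo \<equiv> 13 :: nat"
abbreviation (input) "vZero \<equiv> 14 :: nat"

abbreviation (input) "aDeg \<equiv> 0 :: nat"
abbreviation (input) "aSum \<equiv> 1 :: nat"
abbreviation (input) "aPar \<equiv> 2 :: nat"
abbreviation (input) "aOrd \<equiv> 3 :: nat"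
abbreviation (input) "aTokB \<equiv> 4 :: nat"
abbreviation (input) "aTokR \<equiv> 5 :: nat"
text \<open>The unnamed arrays 6, 7, 8 and 10, 11, 12 hold the intermediate results of the two calls
  of \<open>find_rigid\<close>, so that the second call also starts from zeroed arrays.\<close>

abbreviation (input) "aRigB \<equiv> 9 :: nat"
abbreviation (input) "aRigR \<equiv> 13 :: nat"
abbreviation (input) "aBlk \<equiv> 14 :: nat"

section \<open>Reading the input\<close>

definition nbrs :: "'v set set \<Rightarrow> 'v \<Rightarrow> 'v set" where
  "nbrs E x = {y. {x, y} \<in> E}"

definition count_end :: "nat \<Rightarrow> nat \<Rightarrow> com" where
  "count_end x y = AGet vA aDeg x ;; VAdd vA vA vOne ;; APut aDeg x vA ;;
     AGet vA aSum x ;; VAdd vA vA y ;; APut aSum x vA"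

definition read_edges :: com where
  "read_edges = for_loop vLen (VRead vX ;; VRead vP ;; count_end vX vP ;; count_end vP vX)"

lemma tripleI:
  "(\<And>m. wp B c (\<lambda>t. Q (t\<lparr>credit := 0\<rparr>) \<and> m \<le> credit t) (s\<lparr>credit := k + m\<rparr>)) \<Longrightarrow> triple B k c Q s"
  by (simp add: triple_def)

text \<open>Since every edge is listed once, each neighbour is counted and summed once. The bound
  \<open>n * n\<close> on numbers is needed for the sums of neighbours.\<close>

lemma triple_read_edges:
  assumes es: "\<And>u v. (u, v) \<in> set es \<Longrightarrow> u < n \<and> v < n \<and> u \<noteq> v"
    and dist: "distinct (map (\<lambda>(u, v). {u, v}) es)"
    and B: "n * n \<le> B" "n \<le> B" "length es \<le> B"
    and s: "var s vLen = length es" "var s vOne = 1" "arr s aDeg = (\<lambda>_. 0)" "arr s aSum = (\<lambda>_. 0)"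
      "input s = concat (map (\<lambda>(u, v). [u, v]) es) @ rest"
  shows "triple B (17 * length es + 3) read_edges
    (\<lambda>t. input t = rest \<and> (\<forall>x. arr t aDeg x = card (nbrs (set (map (\<lambda>(u, v). {u, v}) es)) x) \<and>
       arr t aSum x = \<Sum>(nbrs (set (map (\<lambda>(u, v). {u, v}) es)) x))) s"
proof -
  define N where "N i = nbrs (set (map (\<lambda>(u, v). {u, v}) (take i es)))" for i
  define Inv where "Inv i t \<longleftrightarrow> input t = concat (map (\<lambda>(u, v). [u, v]) (drop i es)) @ rest \<and>
    (\<forall>x. arr t aDeg x = card (N i x) \<and> arr t aSum x = \<Sum>(N i x))" for i and t :: state
  have N_less: "N i x \<subseteq> {..<n}" for i x
    using es by (auto simp: N_def nbrs_def doubleton_eq_iff dest!: in_set_takeD)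
  then have fin: "finite (N i x)" for i x using finite_subset by blast
  have cardN: "card (N i x) \<le> n" for i x
    using card_mono[OF _ N_less] by simp
  have sumN: "\<Sum>(N i x) \<le> B" for i x
  proof -
    have "\<Sum>(N i x) \<le> card (N i x) * n"
      using N_less[of i x] sum_bounded_above[of "N i x" "\<lambda>y. y" n] by fastforce
    also have "\<dots> \<le> n * n" using cardN by simp
    finally show ?thesis using B(1) by simp
  qed
  have "triple B ((14 + 3) * length es + 3) read_edges (Inv (length es)) s"
    unfolding read_edges_def
  proof (rule triple_for_loop)
    show "Inv 0 s" using s by (simp add: Inv_def N_def nbrs_def)
    fix i t assume t: "Inv i t" "i < length es" "var t vOne = 1"
    obtain u v where uv: "es ! i = (u, v)" by fastforce
    then have uv': "u < n" "v < n" "u \<noteq> v" using es t(2) by (metis nth_mem)+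
    have "{u, v} \<notin> set (map (\<lambda>(u, v). {u, v}) (take i es))"
    proof -
      have "distinct (map (\<lambda>(u, v). {u, v}) (take (Suc i) es))"
        using dist by (metis distinct_take take_map)
      then show ?thesis using t(2) uv by (simp add: take_Suc_conv_app_nth)
    qed
    then have new: "v \<notin> N i u" "u \<notin> N i v" by (simp_all add: N_def nbrs_def insert_commute)
    have NS: "N (Suc i) x = (if x = u then insert v (N i u) else if x = v then insert u (N i v) else N i x)" for x
      using t(2) uv by (auto simp: N_def nbrs_def take_Suc_conv_app_nth doubleton_eq_iff)
    have inp: "input t = u # v # concat (map (\<lambda>(u, v). [u, v]) (drop (Suc i) es)) @ rest"
      using t(1,2) uv by (simp add: Inv_def flip: Cons_nth_drop_Suc)
    have bounds: "Suc (card (N i u)) \<le> B" "Suc (card (N i v)) \<le> B"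
      "\<Sum>(N i u) + v \<le> B" "\<Sum>(N i v) + u \<le> B"
      using cardN[of "Suc i" u] cardN[of "Suc i" v] sumN[of "Suc i" u] sumN[of "Suc i" v] B(2) fin new uv'
      by (simp_all add: NS add.commute)
    show "triple B 14 (VRead vX ;; VRead vP ;; count_end vX vP ;; count_end vP vX) (Inv (Suc i)) t"
      apply (rule tripleI)
      using t(1,3) uv' inp B bounds fin new
      apply (simp add: count_end_def Inv_def NS)
      done
  qed (use s B in \<open>auto simp: Inv_def count_end_def\<close>)
  then show ?thesis
    by (rule triple_conseq) (auto simp: Inv_def N_def)
qed

definition read_tokens :: "nat \<Rightarrow> com" where
  "read_tokens a = VRead vLen ;; for_loop vLen (VRead vX ;; APut a vX vOne)"

lemma triple_read_tokens:
  assumes bs: "set bs \<subseteq> {..<n}" "n \<le> B" "length bs \<le> B"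
    and s: "var s vOne = 1" "arr s a = (\<lambda>_. 0)" "input s = length bs # bs @ rest"
  shows "triple B (5 * length bs + 4) (read_tokens a)
    (\<lambda>t. input t = rest \<and> arr t a = (\<lambda>x. if x \<in> set bs then 1 else 0)) s"
proof -
  define Inv where "Inv i t \<longleftrightarrow> input t = drop i bs @ rest \<and>
    arr t a = (\<lambda>x. if x \<in> set (take i bs) then 1 else 0)" for i and t :: state
  let ?s = "s\<lparr>var := (var s)(vLen := length bs), input := bs @ rest, credit := 0\<rparr>"
  have "triple B (1 + ((2 + 3) * length bs + 3)) (read_tokens a) (Inv (length bs)) s"
    unfolding read_tokens_def
  proof (rule triple_Seq)
    show "triple B 1 (VRead vLen) (\<lambda>t. t = ?s) s"
      using s bs by (simp add: triple_def)
    show "triple B ((2 + 3) * length bs + 3) (for_loop vLen (VRead vX ;; APut a vX vOne)) (Inv (length bs)) t"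
      if "t = ?s" for t
      unfolding that
    proof (rule triple_for_loop)
      fix i t assume t: "Inv i t" "i < length bs" "var t vOne = 1"
      then have "input t = bs ! i # drop (Suc i) bs @ rest"
        by (simp add: Inv_def Cons_nth_drop_Suc flip: append_Cons)
      moreover have "bs ! i \<le> B" using bs t(2) nth_mem by fastforce
      ultimately show "triple B 2 (VRead vX ;; APut a vX vOne) (Inv (Suc i)) t"
        using t by (intro tripleI) (auto simp: Inv_def take_Suc_conv_app_nth)
    qed (use s bs in \<open>auto simp: Inv_def\<close>)
  qed
  then show ?thesis by (rule triple_conseq) (auto simp: Inv_def)
qed

section \<open>Computing the elimination order\<close>

definition init_parents :: com where
  "init_parents = for_loop vN (APut aPar vI vN)"

lemma triple_init_parents:
  assumes "var s vN = n" "var s vOne = 1" "n \<le> B"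
  shows "triple B (4 * n + 3) init_parents (\<lambda>t. \<forall>x<n. arr t aPar x = n) s"
proof -
  define Inv where "Inv i t \<longleftrightarrow> (\<forall>x<i. arr t aPar x = n)" for i and t :: state
  have "triple B ((1 + 3) * n + 3) init_parents (Inv n) s"
    unfolding init_parents_def
  proof (rule triple_for_loop)
    fix i t assume "Inv i t" "var t vI = i" "frame (for_loop vN (APut aPar vI vN)) s t"
    then show "triple B 1 (APut aPar vI vN) (Inv (Suc i)) t"
      using assms by (intro tripleI) (auto simp: Inv_def frame_def for_loop_def)
  qed (use assms in \<open>auto simp: Inv_def\<close>)
  then show ?thesis by (rule triple_conseq) (auto simp: Inv_def)
qed

text \<open>The neighbour of a vertex of degree one is the sum of its neighbours, so leaves can be cut off
  without adjacency lists.\<close>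

definition eliminate_step :: com where
  "eliminate_step =
     AGet vA aDeg vX ;; VSub vB vA vOne ;; VSub vC vOne vB ;; VSub vD vOne vA ;; VSub vC vC vD ;;
     Cond vC
       (AGet vP aSum vX ;; APut aPar vX vP ;; APut aOrd vK vX ;; VAdd vK vK vOne ;;
        APut aDeg vX vZero ;; AGet vA aDeg vP ;; VSub vA vA vOne ;; APut aDeg vP vA ;;
        AGet vA aSum vP ;; VSub vA vA vX ;; APut aSum vP vA ;; VAdd vX vP vZero)
       (VAdd vI vI vOne ;; VAdd vX vI vZero)"

text \<open>\<open>vI\<close> scans the vertices once. When a leaf is cut off, its neighbour becomes
  the current vertex \<open>vX\<close>, so a chain of new leaves is followed at once; only when the
  current vertex is no leaf does the scan advance. Each round increases \<open>vI\<close> or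
  \<open>vK\<close>, which gives at most \<open>2 * n\<close> rounds.\<close>

definition eliminate :: com where
  "eliminate = VConst vK 0 ;; VConst vI 0 ;; VConst vX 0 ;; While (VSub 5 vN vI) 5 eliminate_step"

text \<open>Degrees and sums of the remaining vertices refer to remaining neighbours only. The
  degree 0 of a removed vertex prevents it from being chosen again.\<close>

definition eliminating ::
    "nat \<Rightarrow> nat set set \<Rightarrow> nat \<Rightarrow> (nat \<Rightarrow> nat) \<Rightarrow> (nat \<Rightarrow> nat) \<Rightarrow> (nat \<Rightarrow> nat) \<Rightarrow> (nat \<Rightarrow> nat) \<Rightarrow> bool" where
  "eliminating n E k ord par deg sm \<longleftrightarrow> k \<le> n \<and> inj_on ord {..<k} \<and> ord ` {..<k} \<subseteq> {..<n} \<and>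
     (\<forall>i<k. par (ord i) < n \<and> nbrs E (ord i) - ord ` {..<i} = {par (ord i)} \<and> deg (ord i) = 0) \<and>
     (\<forall>y<n. y \<notin> ord ` {..<k} \<longrightarrow> par y = n \<and> deg y = card (nbrs E y - ord ` {..<k}) \<and>
        sm y = \<Sum>(nbrs E y - ord ` {..<k}))"

lemma eliminating_step:
  assumes el: "eliminating n E k ord par deg sm"
    and E: "\<And>x y. {x, y} \<in> E \<Longrightarrow> x < n \<and> y < n \<and> x \<noteq> y"
    and x: "x < n" "deg x = 1"
  shows "k < n" "sm x < n" "sm x \<noteq> x"
    "eliminating n E (Suc k) (ord(k := x)) (par(x := sm x))
      (deg(x := 0, sm x := deg (sm x) - 1)) (sm(sm x := sm (sm x) - x))"
proof -
  let ?X = "ord ` {..<k}" and ?p = "sm x"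
  have inj: "inj_on ord {..<k}" and X: "?X \<subseteq> {..<n}"
    and old: "\<And>i. i < k \<Longrightarrow> par (ord i) < n \<and> nbrs E (ord i) - ord ` {..<i} = {par (ord i)} \<and> deg (ord i) = 0"
    and new: "\<And>y. y < n \<Longrightarrow> y \<notin> ?X \<Longrightarrow> par y = n \<and> deg y = card (nbrs E y - ?X) \<and> sm y = \<Sum>(nbrs E y - ?X)"
    using el unfolding eliminating_def by blast+
  \<comment> \<open>Removed vertices have degree 0, while \<open>x\<close> has degree 1.\<close>
  have xX: "x \<notin> ?X" using old x(2) by (metis imageE lessThan_iff zero_neq_one)
  then have "card (nbrs E x - ?X) = 1" using new x by simp
  then obtain p where p: "nbrs E x - ?X = {p}" by (rule card_1_singletonE)
  then have smx: "?p = p" using new[OF x(1) xX] by simp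
  have pE: "{x, p} \<in> E" "p \<notin> ?X" using p unfolding nbrs_def by auto
  then show "?p < n" "?p \<noteq> x" using smx E[OF pE(1)] by auto
  have "card ?X = k" using inj by (simp add: card_image)
  moreover have "card ?X < card {..<n}" using X xX x(1) by (intro psubset_card_mono) auto
  ultimately show k: "k < n" by simp
  have img: "(ord(k := x)) ` {..<i} = ord ` {..<i}" if "i \<le> k" for i
    using that by (intro image_cong) auto
  have imgS: "(ord(k := x)) ` {..<Suc k} = insert x ?X"
    unfolding lessThan_Suc image_insert img[OF order_refl] by simp
  have "inj_on (ord(k := x)) {..<Suc k}"
    using inj xX unfolding lessThan_Suc by (auto simp: inj_on_def)
  moreover have "par' ((ord(k := x)) i) < n \<and>
      nbrs E ((ord(k := x)) i) - (ord(k := x)) ` {..<i} = {par' ((ord(k := x)) i)} \<and>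
      (deg(x := 0, ?p := deg ?p - 1)) ((ord(k := x)) i) = 0"
    if "i < Suc k" "par' = par(x := ?p)" for i par'
  proof (cases "i = k")
    case True
    then show ?thesis using that p smx E pE img[of k] by auto
  next
    case False
    then have "i < k" "ord i \<noteq> x" "ord i \<noteq> p" using that xX pE(2) by auto
    then show ?thesis using that old[of i] img[of i] smx by auto
  qed
  moreover have "(par(x := ?p)) y = n \<and> (deg(x := 0, ?p := deg ?p - 1)) y = card (nbrs E y - insert x ?X) \<and>
      (sm(?p := sm ?p - x)) y = \<Sum>(nbrs E y - insert x ?X)"
    if y: "y < n" "y \<notin> insert x ?X" for y
  proof (cases "y = p")
    case True
    have fin: "finite (nbrs E p - ?X)"
      by (rule finite_subset[of _ "{..<n}"]) (use E in \<open>auto simp: nbrs_def\<close>)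
    have "x \<in> nbrs E p - ?X" using pE xX by (simp add: nbrs_def insert_commute)
    moreover have "nbrs E p - insert x ?X = (nbrs E p - ?X) - {x}" by blast
    ultimately show ?thesis
      using new[of p] y True smx fin by (simp add: sum_diff1_nat)
  next
    case False
    have "x \<notin> nbrs E y"
    proof
      assume "x \<in> nbrs E y"
      then have "y \<in> nbrs E x - ?X" using y by (simp add: nbrs_def insert_commute)
      then show False using p False by blast
    qed
    then have "nbrs E y - insert x ?X = nbrs E y - ?X" by blast
    then show ?thesis using new[of y] y False smx by auto
  qed
  ultimately show "eliminating n E (Suc k) (ord(k := x)) (par(x := ?p))
      (deg(x := 0, ?p := deg ?p - 1)) (sm(?p := sm ?p - x))"
    unfolding eliminating_def imgS
  proof (intro conjI, goal_cases)
    case 4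
    then show ?case by blast
  next
    case 5
    then show ?case by blast
  qed (use k X x(1) in auto)
qed

text \<open>The invariant says that no scanned vertex except the current one has degree 1. At the
  end \<open>vX = n\<close>, so the exception disappears and no leaf remains; a forest without
  leaves has no edges.\<close>

lemma triple_eliminate:
  assumes E: "\<And>x y. {x, y} \<in> E \<Longrightarrow> x < n \<and> y < n \<and> x \<noteq> y" and br: "bridged E {..<n}"
    and s: "var s vN = n" "var s vOne = 1" "var s vZero = 0" "\<forall>x<n. arr s aPar x = n"
      "\<forall>x<n. arr s aDeg x = card (nbrs E x) \<and> arr s aSum x = \<Sum>(nbrs E x)"
    and B: "n \<le> B" "0 < n"
  shows "triple B (40 * n + 5) eliminate
    (\<lambda>t. \<exists>deg sm. eliminating n E (var t vK) (arr t aOrd) (arr t aPar) deg sm \<and>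
      (\<forall>y<n. y \<notin> arr t aOrd ` {..<var t vK} \<longrightarrow> nbrs E y \<subseteq> arr t aOrd ` {..<var t vK})) s"
    (is "triple B _ _ ?post s")
proof -
  define Inv where "Inv t \<longleftrightarrow>
    eliminating n E (var t vK) (arr t aOrd) (arr t aPar) (arr t aDeg) (arr t aSum) \<and>
    var t vI \<le> n \<and> (var t vI < n \<longrightarrow> var t vX < n) \<and> (var t vI = n \<longrightarrow> var t vX = n) \<and>
    (\<forall>y<n. y \<le> var t vI \<longrightarrow> y \<noteq> var t vX \<longrightarrow> arr t aDeg y \<noteq> 1)" for t :: state
  define loop where "loop = While (VSub 5 vN vI) 5 eliminate_step"
  let ?\<mu> = "\<lambda>t. (n - var t vI) + (n - var t vK)"
  let ?s = "s\<lparr>var := (var s)(vK := 0, vI := 0, vX := 0), credit := 0\<rparr>"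
  have fin: "Inv t \<Longrightarrow> var t vI = n \<Longrightarrow> ?post t" for t
  proof -
    assume inv: "Inv t" and "var t vI = n"
    then have deg: "\<And>y. y < n \<Longrightarrow> arr t aDeg y \<noteq> 1" and
      el: "eliminating n E (var t vK) (arr t aOrd) (arr t aPar) (arr t aDeg) (arr t aSum)"
      unfolding Inv_def by auto
    let ?X = "arr t aOrd ` {..<var t vK}"
    have "nbrs E a \<subseteq> ?X" if a: "a < n" "a \<notin> ?X" for a
    proof (rule ccontr)
      assume "\<not> ?thesis"
      then obtain b where b: "{a, b} \<in> E" "b \<notin> ?X" unfolding nbrs_def by blast
      then have ab: "a \<in> {..<n} - ?X" "b \<in> {..<n} - ?X" using a E by auto
      \<comment> \<open>An edge between remaining vertices would yield a leaf of the remaining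
        forest, and its stored degree would be 1.\<close>
      obtain u p v where v: "v \<in> {..<n} - ?X" "{x \<in> {..<n} - ?X. {v, x} \<in> E} = {u}"
        by (rule bridged_safe_vertex[OF bridged_subset[OF br Diff_subset] _ ab b(1)]) (simp, rule that)
      have "{x \<in> {..<n} - ?X. {v, x} \<in> E} = nbrs E v - ?X" using E unfolding nbrs_def by auto
      then have "arr t aDeg v = 1" using el v unfolding eliminating_def by auto
      then show False using deg v(1) by auto
    qed
    then show "?post t" using el by blast
  qed
  have "triple B ((1 + 18 + 1) * ?\<mu> (?s\<lparr>credit := 0\<rparr>) + 1 + 1) loop ?post ?s"
    unfolding loop_def
  proof (rule triple_While[where I = Inv])
    show "Inv (?s\<lparr>credit := 0\<rparr>)"
      using s B by (simp add: Inv_def eliminating_def)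
    fix t assume t: "Inv t" "frame (While (VSub 5 vN vI) 5 eliminate_step) ?s t"
    then have vt: "var t vN = n" "var t vOne = 1" "var t vZero = 0"
      using s by (auto simp: frame_def eliminate_step_def)
    let ?u = "t\<lparr>var := (var t)(5 := n - var t vI), credit := 0\<rparr>"
    have "triple B 1 (VSub 5 vN vI) (\<lambda>u. u = ?u) t" using vt by (simp add: triple_def)
    moreover have "triple B 18 eliminate_step (\<lambda>v. Inv v \<and> ?\<mu> v < ?\<mu> t) ?u" if "var t vI < n"
    proof -
      have x: "var t vX < n" using t(1) that by (simp add: Inv_def)
      have el: "eliminating n E (var t vK) (arr t aOrd) (arr t aPar) (arr t aDeg) (arr t aSum)"
        using t(1) by (simp add: Inv_def)
      show ?thesis
      proof (cases "arr t aDeg (var t vX) = 1")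
        case True
        note step = eliminating_step[OF el E x True]
        show ?thesis
          using vt t(1) x that True step B
          by (intro tripleI) (auto simp: eliminate_step_def Inv_def)
      next
        case False
        \<comment> \<open>This truncated difference is the program's test for degree one: it is 1
          for degree 1 and 0 for every other degree.\<close>
        then have "Suc 0 - (arr t aDeg (var t vX) - Suc 0) - (Suc 0 - arr t aDeg (var t vX)) = 0"
          by simp
        then show ?thesis
          using vt t(1) x that False B
          by (intro tripleI) (auto simp: eliminate_step_def Inv_def le_Suc_eq)
      qed
    qed
    moreover have "?post ?u" if "\<not> var t vI < n"
    proof -
      have "var t vI = n" using t(1) that by (simp add: Inv_def)
      then have "?post t" using fin t(1) by blast
      then show ?thesis by simp
    qed
    ultimately show "triple B 1 (VSub 5 vN vI)
      (\<lambda>u. (var u 5 = 0 \<longrightarrow> ?post u) \<and> (0 < var u 5 \<longrightarrow> triple B 18 eliminate_step (\<lambda>v. Inv v \<and> ?\<mu> v < ?\<mu> t) u)) t"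
      by (elim triple_conseq) auto
  qed
  then have loop: "triple B (40 * n + 2) loop ?post ?s" by simp
  have "triple B (1 + (1 + (1 + (40 * n + 2)))) eliminate ?post s"
    unfolding eliminate_def loop_def[symmetric]
    by (rule triple_Seq_exact[where u = "s\<lparr>var := (var s)(vK := 0), credit := 0\<rparr>"],
        simp add: triple_def,
        rule triple_Seq_exact[where u = "s\<lparr>var := (var s)(vK := 0, vI := 0), credit := 0\<rparr>"],
        simp add: triple_def, rule triple_Seq_exact[where u = ?s], simp add: triple_def, rule loop)
  then show ?thesis by (rule triple_conseq) auto
qed

text \<open>The vertices left over are recognised by \<open>par = n\<close>. They have no neighbours
  among themselves, so their mutual order is irrelevant.\<close>

definition append_roots :: com where
  "append_roots = for_loop vN (AGet vP aPar vI ;; VSub vA vN vP ;;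
     Cond vA Skip (APut aOrd vK vI ;; VAdd vK vK vOne))"

lemma triple_append_roots:
  assumes E: "\<And>x y. {x, y} \<in> E \<Longrightarrow> x < n \<and> y < n \<and> x \<noteq> y"
    and el: "eliminating n E (var s vK) (arr s aOrd) (arr s aPar) deg sm"
    and roots: "\<And>y. y < n \<Longrightarrow> y \<notin> arr s aOrd ` {..<var s vK} \<Longrightarrow> nbrs E y \<subseteq> arr s aOrd ` {..<var s vK}"
    and s: "var s vN = n" "var s vOne = 1" and B: "n \<le> B"
  shows "triple B (8 * n + 3) append_roots (\<lambda>t. elimination n E (arr s aPar) (arr t aOrd)) s"
proof -
  let ?X = "arr s aOrd ` {..<var s vK}" and ?par = "arr s aPar"
  have X: "?X \<subseteq> {..<n}" using el unfolding eliminating_def by blast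
  have parX: "?par y < n" if "y \<in> ?X" for y using el that unfolding eliminating_def by blast
  have parn: "?par y = n" if "y < n" "y \<notin> ?X" for y using el that unfolding eliminating_def by blast
  define good where "good i k ord \<longleftrightarrow> k \<le> n \<and> inj_on ord {..<k} \<and>
    ord ` {..<k} = ?X \<union> {y. y < i \<and> ?par y = n} \<and>
    (\<forall>j<k. ?par (ord j) \<le> n \<and> nbrs E (ord j) - ord ` {..<j} = {?par (ord j)} - {n})" for i k ord
  define Inv where "Inv i t \<longleftrightarrow> good i (var t vK) (arr t aOrd)" for i and t :: state
  have step: "k < n \<and> good (Suc i) (Suc k) (ord(k := i))"
    if g: "good i k ord" and i: "i < n" "?par i = n" for i k ord
  proof -
    let ?Y = "ord ` {..<k}"
    have inj: "inj_on ord {..<k}" and Y: "?Y = ?X \<union> {y. y < i \<and> ?par y = n}"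
      and old: "\<And>j. j < k \<Longrightarrow> ?par (ord j) \<le> n \<and> nbrs E (ord j) - ord ` {..<j} = {?par (ord j)} - {n}"
      using g unfolding good_def by auto
    have iX: "i \<notin> ?X" using parX[of i] i by auto
    then have iY: "i \<notin> ?Y" using Y by auto
    have "card ?Y = k" using inj by (simp add: card_image)
    moreover have "?Y \<subset> {..<n}" using X Y i iY by auto
    then have "card ?Y < card {..<n}" by (intro psubset_card_mono) auto
    ultimately have k: "k < n" by simp
    have img: "(ord(k := i)) ` {..<j} = ord ` {..<j}" if "j \<le> k" for j
      using that by (intro image_cong) auto
    have imgS: "(ord(k := i)) ` {..<Suc k} = insert i ?Y"
      unfolding lessThan_Suc image_insert img[OF order_refl] by simp
    have "inj_on (ord(k := i)) {..<Suc k}"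
      using inj iY unfolding lessThan_Suc by (auto simp: inj_on_def)
    moreover have "insert i ?Y = ?X \<union> {y. y < Suc i \<and> ?par y = n}"
      using Y i by (auto simp: less_Suc_eq)
    moreover have "?par ((ord(k := i)) j) \<le> n \<and>
        nbrs E ((ord(k := i)) j) - (ord(k := i)) ` {..<j} = {?par ((ord(k := i)) j)} - {n}"
      if "j < Suc k" for j
    proof (cases "j = k")
      case True
      then show ?thesis using roots[OF i(1) iX] i(2) Y img[of k] by auto
    next
      case False
      then show ?thesis using that old[of j] img[of j] by auto
    qed
    ultimately show ?thesis unfolding good_def imgS using k by simp
  qed
  have "triple B ((5 + 3) * n + 3) append_roots (Inv n) s"
    unfolding append_roots_def
  proof (rule triple_for_loop)
    show "Inv 0 s" using el unfolding Inv_def good_def eliminating_def by auto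
    fix i t assume t: "Inv i t" "i < n" "var t vI = i" "var t vOne = 1"
      and fr: "frame (for_loop vN (AGet vP aPar vI ;; VSub vA vN vP ;;
        Cond vA Skip (APut aOrd vK vI ;; VAdd vK vK vOne))) s t"
    have vt: "var t vN = n" "arr t aPar = ?par" using fr s by (auto simp: frame_def for_loop_def)
    have "?par i \<le> n" using parX[of i] parn[of i] t(2) by force
    then consider "?par i < n" | "?par i = n" by linarith
    then show "triple B 5 (AGet vP aPar vI ;; VSub vA vN vP ;;
        Cond vA Skip (APut aOrd vK vI ;; VAdd vK vK vOne)) (Inv (Suc i)) t"
    proof cases
      case 1
      then have "{y. y < Suc i \<and> ?par y = n} = {y. y < i \<and> ?par y = n}" by (auto simp: less_Suc_eq)
      then have "good (Suc i) = good i" by (simp add: good_def fun_eq_iff)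
      then show ?thesis using 1 t vt by (intro tripleI) (auto simp: Inv_def)
    next
      case 2
      then show ?thesis using step[of i "var t vK" "arr t aOrd"] t vt B
        by (intro tripleI) (auto simp: Inv_def)
    qed
  qed (use s B in \<open>auto simp: Inv_def\<close>)
  then show ?thesis
  proof (rule triple_conseq)
    fix t assume "Inv n t"
    then have g: "good n (var t vK) (arr t aOrd)" by (simp add: Inv_def)
    then have "arr t aOrd ` {..<var t vK} = {..<n}"
      using X parn unfolding good_def by auto
    moreover from this have "var t vK = n"
      using g unfolding good_def by (metis card_image card_lessThan)
    ultimately show "elimination n E ?par (arr t aOrd)"
      using g E unfolding good_def by unfold_locales (auto simp: bij_betw_def nbrs_def)
  qed simp
qed

section \<open>Finding the rigid tokens\<close>

text \<open>Relative to the subtree below it, the token on \<open>y\<close> is stuck iff every child of \<open>y\<close> has a child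
  with a stuck token. \<open>cnt z\<close> counts the stuck tokens on the children of \<open>z\<close>, and \<open>bad y\<close> flags a child
  of \<open>y\<close> without any.\<close>

definition mark_stuck_step :: "nat \<Rightarrow> nat \<Rightarrow> nat \<Rightarrow> nat \<Rightarrow> com" where
  "mark_stuck_step tok cnt bad stuck =
     AGet vX aOrd vI ;; AGet vP aPar vX ;; AGet vA tok vX ;; AGet vB bad vX ;; VSub vA vA vB ;;
      APut stuck vX vA ;; AGet vB cnt vP ;; VAdd vB vB vA ;; APut cnt vP vB ;; AGet vB cnt vX ;;
      Cond vB Skip (APut bad vP vOne)"

definition mark_stuck :: "nat \<Rightarrow> nat \<Rightarrow> nat \<Rightarrow> nat \<Rightarrow> com" where
  "mark_stuck tok cnt bad stuck = for_loop vN (mark_stuck_step tok cnt bad stuck)"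

definition mark_rigid_step :: "nat \<Rightarrow> nat \<Rightarrow> nat \<Rightarrow> com" where
  "mark_rigid_step cnt stuck rig =
     VSub vC vN vI ;; VSub vC vC vOne ;; AGet vX aOrd vC ;; AGet vP aPar vX ;; AGet vA cnt vP ;;
      VSub vA vA vOne ;; AGet vB aPar vP ;; AGet vB rig vB ;; VAdd vA vA vB ;;
      Cond vA (AGet vA stuck vX ;; APut rig vX vA) Skip"

definition mark_rigid :: "nat \<Rightarrow> nat \<Rightarrow> nat \<Rightarrow> com" where
  "mark_rigid cnt stuck rig = for_loop vN (mark_rigid_step cnt stuck rig)"

text \<open>Setting \<open>cnt n\<close> to 2 makes the stuck tokens on roots rigid.\<close>

definition find_rigid :: "nat \<Rightarrow> nat \<Rightarrow> nat \<Rightarrow> nat \<Rightarrow> nat \<Rightarrow> com" where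
  "find_rigid tok cnt bad stuck rig = mark_stuck tok cnt bad stuck ;;
     VConst vTwo 2 ;; APut cnt vN vTwo ;; mark_rigid cnt stuck rig"

context elimination
begin

definition stuck_upto ::
    "nat set \<Rightarrow> nat \<Rightarrow> (nat \<Rightarrow> nat) \<Rightarrow> (nat \<Rightarrow> nat) \<Rightarrow> (nat \<Rightarrow> nat) \<Rightarrow> bool" where
  "stuck_upto I i cnt bad d \<longleftrightarrow>
     (\<forall>z. cnt z = card {y \<in> ord ` {..<i}. par y = z \<and> d y = 1}) \<and>
     (\<forall>z. bad z = of_bool (\<exists>y\<in>ord ` {..<i}. par y = z \<and> cnt y = 0)) \<and>
     (\<forall>y\<in>ord ` {..<i}. d y = of_bool (y \<in> I \<and> (\<forall>z\<in>ord ` {..<i}. par z = y \<longrightarrow> cnt z \<noteq> 0)))"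

text \<open>The parent \<open>p\<close> comes after all processed vertices. The updates of
  \<open>cnt\<close> and \<open>bad\<close> at \<open>p\<close> therefore affect no entry on which
  the processed values depend, and \<open>bad x\<close> is already final when \<open>x\<close> is
  processed.\<close>

lemma stuck_upto_Suc:
  assumes st: "stuck_upto I i cnt bad d" and i: "i < n"
    and x: "x = ord i" and p: "p = par x" and e: "e = of_bool (x \<in> I) - bad x"
  shows "stuck_upto I (Suc i) (cnt(p := cnt p + e)) (if 0 < cnt x then bad else bad(p := 1)) (d(x := e))"
proof -
  let ?P = "ord ` {..<i}"
  have cnt: "cnt z = card {y \<in> ?P. par y = z \<and> d y = 1}"
    and bad: "bad z = of_bool (\<exists>y\<in>?P. par y = z \<and> cnt y = 0)"
    and d: "y \<in> ?P \<Longrightarrow> d y = of_bool (y \<in> I \<and> (\<forall>z\<in>?P. par z = y \<longrightarrow> cnt z \<noteq> 0))" for z y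
    using st[unfolded stuck_upto_def] by blast+
  have PS: "ord ` {..<Suc i} = insert x ?P" by (simp add: lessThan_Suc x)
  have xP: "x \<notin> ?P" using x i ord_eq_iff by auto
  have pP: "p \<notin> ?P" "p \<noteq> x" using par_notin[OF i] unfolding PS p x by auto
  have e': "e = of_bool (x \<in> I \<and> (\<forall>z\<in>?P. par z = x \<longrightarrow> cnt z \<noteq> 0))"
    using bad[of x] by (auto simp: e)
  have same: "(cnt(p := cnt p + e)) y = cnt y" if "y \<in> insert x ?P" for y using that pP by auto
  have "(cnt(p := cnt p + e)) z = card {y \<in> insert x ?P. par y = z \<and> (d(x := e)) y = 1}" for z
  proof -
    have "{y \<in> insert x ?P. par y = z \<and> (d(x := e)) y = 1} =
      {y \<in> ?P. par y = z \<and> d y = 1} \<union> (if p = z \<and> e = 1 then {x} else {})"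
      using xP p by auto
    moreover have "e = 0 \<or> e = 1" by (simp add: e')
    ultimately show ?thesis using xP cnt[of z] cnt[of p] by auto
  qed
  moreover have "(if 0 < cnt x then bad else bad(p := 1)) z =
      of_bool (\<exists>y\<in>insert x ?P. par y = z \<and> (cnt(p := cnt p + e)) y = 0)" for z
  proof -
    have "(\<exists>y\<in>insert x ?P. par y = z \<and> (cnt(p := cnt p + e)) y = 0) \<longleftrightarrow>
      (p = z \<and> cnt x = 0) \<or> (\<exists>y\<in>?P. par y = z \<and> cnt y = 0)"
      using same p by auto
    then show ?thesis unfolding bad[of z] by (auto simp: bad)
  qed
  moreover have "(d(x := e)) y = of_bool (y \<in> I \<and>
      (\<forall>z\<in>insert x ?P. par z = y \<longrightarrow> (cnt(p := cnt p + e)) z \<noteq> 0))"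
    if y: "y \<in> insert x ?P" for y
  proof -
    have "p \<noteq> y" using y pP by auto
    then have *: "(\<forall>z\<in>insert x ?P. par z = y \<longrightarrow> (cnt(p := cnt p + e)) z \<noteq> 0) \<longleftrightarrow>
      (\<forall>z\<in>?P. par z = y \<longrightarrow> cnt z \<noteq> 0)"
      using same p by auto
    show ?thesis
    proof (cases "y = x")
      case True
      then show ?thesis unfolding * using e' by simp
    next
      case False
      then show ?thesis unfolding * using d[of y] y by simp
    qed
  qed
  ultimately show ?thesis unfolding stuck_upto_def PS by blast
qed

lemma triple_mark_stuck:
  assumes I: "I \<subseteq> {..<n}" "arr s tok = (\<lambda>x. of_bool (x \<in> I))"
    and a: "distinct [tok, cnt, bad, stuck, aPar, aOrd]"
    and s: "var s vN = n" "var s vOne = 1" "arr s aPar = par" "arr s aOrd = ord"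
      "arr s cnt = (\<lambda>_. 0)" "arr s bad = (\<lambda>_. 0)"
    and B: "n \<le> B"
  shows "triple B (15 * n + 3) (mark_stuck tok cnt bad stuck)
    (\<lambda>t. stuck_upto I n (arr t cnt) (arr t bad) (arr t stuck)) s"
proof -
  define Inv where "Inv i t \<longleftrightarrow> stuck_upto I i (arr t cnt) (arr t bad) (arr t stuck)" for i and t :: state
  have bound: "cn z + e \<le> B"
    if "stuck_upto I i cn b d" "i < n" "e \<le> 1" for i cn b d z e
  proof -
    have "cn z \<le> card (ord ` {..<i})"
      using that(1) unfolding stuck_upto_def by (auto intro!: card_mono)
    also have "\<dots> \<le> i" using card_image_le[of "{..<i}" ord] by simp
    finally show ?thesis using that B by simp
  qed
  have "triple B ((12 + 3) * n + 3) (mark_stuck tok cnt bad stuck) (Inv n) s"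
    unfolding mark_stuck_def
  proof (rule triple_for_loop)
    show "Inv 0 s" using s by (simp add: Inv_def stuck_upto_def)
    fix i t
    assume t: "Inv i t" "i < n" "var t vI = i" "var t vOne = 1"
      and fr: "frame (for_loop vN (mark_stuck_step tok cnt bad stuck)) s t"
    have vt: "arr t aPar = par" "arr t aOrd = ord" "arr t tok = (\<lambda>x. of_bool (x \<in> I))"
      using fr s a I by (auto simp: frame_def for_loop_def mark_stuck_step_def)
    define x where "x = ord i"
    define p where "p = par x"
    define e where "e = of_bool (x \<in> I) - arr t bad x"
    have px: "p \<noteq> x" using par_neq[OF ord_less[OF t(2)]] by (simp add: p_def x_def)
    note nxt = stuck_upto_Suc[OF t(1)[unfolded Inv_def] t(2) x_def p_def e_def]
    have "arr t cnt p + e \<le> B"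
      by (rule bound[OF t(1)[unfolded Inv_def] t(2)]) (simp add: e_def)
    then show "triple B 12 (mark_stuck_step tok cnt bad stuck) (Inv (Suc i)) t"
      using t vt px nxt a
      by (intro tripleI) (auto simp: Inv_def mark_stuck_step_def simp flip: x_def p_def e_def split: if_splits)
  qed (use s B in \<open>auto simp: Inv_def mark_stuck_step_def\<close>)
  then show ?thesis by (rule triple_conseq) (auto simp: Inv_def)
qed

text \<open>\<open>r\<close> occurs on both sides: this is a fixed-point equation that the pass from
  the roots solves, because grandparents are settled first. The threshold is 2 because a stuck
  \<open>y\<close> is itself counted in \<open>cnt (par y)\<close>.\<close>

definition rigid_upto :: "nat \<Rightarrow> (nat \<Rightarrow> nat) \<Rightarrow> (nat \<Rightarrow> nat) \<Rightarrow> (nat \<Rightarrow> nat) \<Rightarrow> bool" where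
  "rigid_upto i cnt d r \<longleftrightarrow> (\<forall>y. r y = of_bool (y \<in> ord ` {n - i..<n} \<and> d y = 1 \<and>
     (2 \<le> cnt (par y) \<or> r (par (par y)) = 1)))"

lemma rigid_upto_Suc:
  assumes r: "rigid_upto i cnt d r" and i: "i < n" and x: "x = ord (n - i - 1)"
    and cn: "cnt n = 2" and dx: "d x = 0 \<or> d x = 1"
  shows "rigid_upto (Suc i) cnt d
    (if 0 < cnt (par x) - 1 + r (par (par x)) then r(x := d x) else r)" (is "rigid_upto _ _ _ ?r")
proof -
  let ?P = "ord ` {n - i..<n}"
  have r: "r y = of_bool (y \<in> ?P \<and> d y = 1 \<and> (2 \<le> cnt (par y) \<or> r (par (par y)) = 1))" for y
    using r unfolding rigid_upto_def by blast
  have "{n - Suc i..<n} = insert (n - i - 1) {n - i..<n}" using i by auto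
  then have PS: "ord ` {n - Suc i..<n} = insert x ?P" using x by simp
  have xP: "x \<notin> ?P" using x i ord_eq_iff by auto
  have xn: "x < n" using x i ord_less by simp
  have rx: "r x = 0" using r[of x] xP by simp
  \<comment> \<open>Setting \<open>r x\<close> must not disturb the equations of settled vertices.
    Grandparents come later in the order, hence differ from \<open>x\<close>; below a missing parent
    the value \<open>par n\<close> is arbitrary, but there \<open>cnt n = 2\<close> already
    decides.\<close>
  have far: "2 \<le> cnt (par y) \<or> par (par y) \<noteq> x" if y: "y \<in> insert x ?P" for y
  proof (cases "par y = n")
    case False
    have "y \<in> ord ` {n - Suc i..<n}" using y PS by blast
    then obtain j where j: "y = ord j" "n - Suc i \<le> j" "j < n" by auto
    then obtain k where k: "k < n" "par y = ord k"
      using ex_ord False par_le[of j] by (metis le_neq_implies_less)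
    have "par (par y) \<noteq> ord (n - i - 1)"
      using par_later[OF j(3) k(1)] par_later[OF k(1), of "n - i - 1"] j k i by auto
    then show ?thesis using x by simp
  qed (simp add: cn)
  define c where "c y \<longleftrightarrow> 2 \<le> cnt (par y) \<or> r (par (par y)) = 1" for y
  have ry: "r y = of_bool (y \<in> ?P \<and> d y = 1 \<and> c y)" for y using r[of y] unfolding c_def .
  have "r (par (par x)) = 0 \<or> r (par (par x)) = 1" by (subst (1 2) ry) simp
  then have "0 < cnt (par x) - 1 + r (par (par x)) \<longleftrightarrow> c x" unfolding c_def by auto
  then have r': "?r y = (if c x \<and> y = x then d x else r y)" for y by simp
  have c': "2 \<le> cnt (par y) \<or> ?r (par (par y)) = 1 \<longleftrightarrow> c y" if "y \<in> insert x ?P" for y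
    using far[OF that] unfolding c_def by auto
  have "?r y = of_bool (y \<in> insert x ?P \<and> d y = 1 \<and> (2 \<le> cnt (par y) \<or> ?r (par (par y)) = 1))" for y
  proof (cases "y \<in> insert x ?P")
    case True
    show ?thesis unfolding c'[OF True] r'[of y] using True ry[of y] xP dx by auto
  next
    case False
    then show ?thesis unfolding r'[of y] using ry[of y] by auto
  qed
  then show ?thesis unfolding rigid_upto_def PS by blast
qed

text \<open>Translates the counters into the clauses of \<open>rigid_eq\<close>:
  \<open>cnt z\<close> is nonzero iff \<open>z\<close> has a stuck child, and for a stuck
  \<open>y\<close> a count of at least 2 at its parent means a stuck sibling.\<close>

lemma rigid_upto_rigid:
  assumes I: "I \<subseteq> {..<n}" and st: "stuck_upto I n cnt bad d" and r: "rigid_upto n (cnt(n := 2)) d r"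
  shows "r = (\<lambda>y. of_bool (y \<in> rigid E {..<n} I))"
proof -
  have P: "ord ` {..<n} = {..<n}" using bij by (simp add: bij_betw_def)
  have cnt: "cnt z = card {y \<in> {..<n}. par y = z \<and> d y = 1}"
    and d: "y \<in> {..<n} \<Longrightarrow> d y = of_bool (y \<in> I \<and> (\<forall>z\<in>{..<n}. par z = y \<longrightarrow> cnt z \<noteq> 0))" for z y
    using st[unfolded stuck_upto_def P] by blast+
  have ry: "r y = of_bool (y < n \<and> d y = 1 \<and> (2 \<le> (cnt(n := 2)) (par y) \<or> r (par (par y)) = 1))" for y
  proof -
    have "{n - n..<n} = {..<n}" by auto
    from r[unfolded rigid_upto_def this P, rule_format, of y] show ?thesis by simp
  qed
  have less: "y < n" if "r y = 1" for y using ry[of y] that by (cases "y < n") simp_all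
  have "rigid E {..<n} I = {y. y < n \<and> r y = 1}"
  proof (rule rigid_eq[OF I])
    fix y assume "y < n"
    then show "d y = 1 \<longleftrightarrow> y \<in> I \<and> (\<forall>z<n. par z = y \<longrightarrow> (\<exists>y'<n. par y' = z \<and> d y' = 1))"
      using d[of y] cnt by (auto simp: card_eq_0_iff)
  next
    fix y assume y: "y < n"
    have two: "2 \<le> cnt (par y) \<longleftrightarrow> (\<exists>y'<n. y' \<noteq> y \<and> par y' = par y \<and> d y' = 1)" if "d y = 1"
    proof -
      let ?C = "{y' \<in> {..<n}. par y' = par y \<and> d y' = 1}"
      have "finite ?C" "y \<in> ?C" using y that by auto
      then have "card ?C = Suc (card (?C - {y}))" by (rule card.remove)
      with cnt have c: "cnt (par y) = Suc (card (?C - {y}))" by (rule trans)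
      have "2 \<le> Suc m \<longleftrightarrow> m \<noteq> 0" for m by auto
      then have "2 \<le> cnt (par y) \<longleftrightarrow> card (?C - {y}) \<noteq> 0" unfolding c .
      also have "\<dots> \<longleftrightarrow> ?C - {y} \<noteq> {}" 
        using card_eq_0_iff[of "?C - {y}"] finite_Diff[OF \<open>finite ?C\<close>, of "{y}"] by argo
      finally show ?thesis by blast
    qed
    show "r y = 1 \<longleftrightarrow> d y = 1 \<and> (par y = n \<or> (\<exists>y'<n. y' \<noteq> y \<and> par y' = par y \<and> d y' = 1) \<or>
        par (par y) < n \<and> r (par (par y)) = 1)"
      using ry[of y] y two less by auto
  qed
  moreover have "r y = 0 \<or> r y = 1" for y using ry[of y] by simp
  ultimately show ?thesis using less by (auto simp: fun_eq_iff)
qed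

lemma triple_mark_rigid:
  assumes d: "\<And>y. y < n \<Longrightarrow> arr s stuck y = 0 \<or> arr s stuck y = 1"
    and c: "arr s cnt n = 2" "\<And>y. arr s cnt y \<le> n + 1"
    and a: "distinct [cnt, stuck, rig, aPar, aOrd]"
    and s: "var s vN = n" "var s vOne = 1" "arr s aPar = par" "arr s aOrd = ord" "arr s rig = (\<lambda>_. 0)"
    and B: "n + 1 \<le> B"
  shows "triple B (15 * n + 3) (mark_rigid cnt stuck rig)
    (\<lambda>t. rigid_upto n (arr s cnt) (arr s stuck) (arr t rig)) s"
proof -
  define Inv where "Inv i t \<longleftrightarrow> rigid_upto i (arr s cnt) (arr s stuck) (arr t rig)" for i and t :: state
  have "triple B ((12 + 3) * n + 3) (mark_rigid cnt stuck rig) (Inv n) s"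
    unfolding mark_rigid_def
  proof (rule triple_for_loop)
    show "Inv 0 s" using s by (simp add: Inv_def rigid_upto_def)
    fix i t
    assume t: "Inv i t" "i < n" "var t vI = i" "var t vOne = 1"
      and fr: "frame (for_loop vN (mark_rigid_step cnt stuck rig)) s t"
    have vt: "var t vN = n" "arr t aPar = par" "arr t aOrd = ord" "arr t cnt = arr s cnt"
      "arr t stuck = arr s stuck"
      using fr s a by (auto simp: frame_def for_loop_def mark_rigid_step_def)
    define x where "x = ord (n - i - 1)"
    have xn: "x < n" using ord_less t(2) by (simp add: x_def)
    note nxt = rigid_upto_Suc[OF t(1)[unfolded Inv_def] t(2) x_def c(1) d[OF xn]]
    have "\<exists>P. arr t rig (par (par x)) = of_bool P"
      using t(1) unfolding Inv_def rigid_upto_def by blast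
    then have "arr t rig (par (par x)) \<le> 1" by auto
    then have "arr s cnt (par x) - Suc 0 + arr t rig (par (par x)) \<le> B"
      using c(2)[of "par x"] B by linarith
    moreover have "ord (n - Suc i) = x" by (simp add: x_def)
    moreover have "arr t rig x \<le> B" for x
    proof -
      have "\<exists>P. arr t rig x = of_bool P" using t(1) unfolding Inv_def rigid_upto_def by blast
      then show ?thesis using B by auto
    qed
    ultimately show "triple B 12 (mark_rigid_step cnt stuck rig) (Inv (Suc i)) t"
      using t(2,3,4) vt a nxt by (intro tripleI) (auto simp: Inv_def mark_rigid_step_def split: if_splits)
  qed (use s B in \<open>auto simp: Inv_def mark_rigid_step_def\<close>)
  then show ?thesis by (rule triple_conseq) (auto simp: Inv_def)
qed

end

lemma (in elimination) triple_find_rigid: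
  assumes I: "I \<subseteq> {..<n}" "arr s tok = (\<lambda>x. of_bool (x \<in> I))"
    and a: "distinct [tok, cnt, bad, stuck, rig, aPar, aOrd]"
    and s: "var s vN = n" "var s vOne = 1" "arr s aPar = par" "arr s aOrd = ord"
      "arr s cnt = (\<lambda>_. 0)" "arr s bad = (\<lambda>_. 0)" "arr s rig = (\<lambda>_. 0)"
    and B: "n + 2 \<le> B" "0 < n"
  shows "triple B (30 * n + 8) (find_rigid tok cnt bad stuck rig)
    (\<lambda>t. arr t rig = (\<lambda>x. of_bool (x \<in> rigid E {..<n} I))) s"
proof -
  let ?Q = "\<lambda>t. arr t rig = (\<lambda>x. of_bool (x \<in> rigid E {..<n} I))"
  have "triple B (15 * n + 3 + (1 + (1 + (15 * n + 3)))) (find_rigid tok cnt bad stuck rig) ?Q s"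
    unfolding find_rigid_def
  proof (rule triple_Seq)
    show "triple B (15 * n + 3) (mark_stuck tok cnt bad stuck)
      (\<lambda>t. stuck_upto I n (arr t cnt) (arr t bad) (arr t stuck)) s"
      using assms by (intro triple_mark_stuck) auto
    fix t assume t: "stuck_upto I n (arr t cnt) (arr t bad) (arr t stuck)"
      "frame (mark_stuck tok cnt bad stuck) s t"
    have vt: "var t vN = n" "var t vOne = 1" "arr t aPar = par" "arr t aOrd = ord" "arr t rig = (\<lambda>_. 0)"
      using t(2) s a by (auto simp: frame_def mark_stuck_def for_loop_def mark_stuck_step_def)
    let ?u = "t\<lparr>var := (var t)(vTwo := 2), credit := 0\<rparr>"
    let ?v = "?u\<lparr>arr := (arr t)(cnt := (arr t cnt)(n := 2))\<rparr>"
    show "triple B (1 + (1 + (15 * n + 3))) (VConst vTwo 2 ;; APut cnt vN vTwo ;; mark_rigid cnt stuck rig) ?Q t"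
    proof (rule triple_Seq)
      show "triple B 1 (VConst vTwo 2) (\<lambda>u. u = ?u) t" using B by (simp add: triple_def)
      show "triple B (1 + (15 * n + 3)) (APut cnt vN vTwo ;; mark_rigid cnt stuck rig) ?Q u" if "u = ?u" for u
        unfolding that
      proof (rule triple_Seq)
        show "triple B 1 (APut cnt vN vTwo) (\<lambda>u. u = ?v) ?u" using vt by (simp add: triple_def)
        have "arr t cnt z \<le> n" for z
        proof -
          have "arr t cnt z \<le> card (ord ` {..<n})"
            using t(1) unfolding stuck_upto_def by (auto intro!: card_mono)
          also have "\<dots> \<le> n" using card_image_le[of "{..<n}" ord] by simp
          finally show ?thesis .
        qed
        then have c: "arr ?v cnt z \<le> n + 1" for z using B(2) by (auto simp: le_SucI)
        have P: "ord ` {..<n} = {..<n}" using bij by (simp add: bij_betw_def)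
        have d: "arr t stuck y = 0 \<or> arr t stuck y = 1" if "y < n" for y
          using t(1)[unfolded stuck_upto_def P] that by auto
        have "triple B (15 * n + 3) (mark_rigid cnt stuck rig)
            (\<lambda>w. rigid_upto n (arr ?v cnt) (arr ?v stuck) (arr w rig)) ?v"
          using vt a d c B by (intro triple_mark_rigid) auto
        then have "triple B (15 * n + 3) (mark_rigid cnt stuck rig) ?Q ?v"
          by (rule triple_conseq) (use rigid_upto_rigid[OF I(1) t(1)] a in auto)
        then show "triple B (15 * n + 3) (mark_rigid cnt stuck rig) ?Q v" if "v = ?v" for v
          using that by simp
      qed
    qed
  qed
  then show ?thesis by (rule triple_conseq) auto
qed


section \<open>Comparing rigid sets and component counts\<close>

definition compare_step :: com where
  "compare_step =
     AGet vA aRigB vI ;; AGet vB aRigR vI ;; VSub vC vA vB ;; VSub vD vB vA ;; VAdd vC vC vD ;;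
        Cond vC (VConst vAns 0) Skip ;; AGet vP aPar vI ;;
        Cond vA (APut aBlk vI vOne ;; APut aBlk vP vOne) Skip ;; AGet vB aRigB vP ;;
        Cond vB (APut aBlk vI vOne) Skip"

text \<open>Marking cell \<open>n\<close> as blocked makes a missing parent look like a blocked one,
  so that \<open>weigh\<close> needs no special case for roots.\<close>

definition compare :: com where
  "compare = VConst vAns 1 ;;
     for_loop vN compare_step ;;
     APut aBlk vN vOne"

text \<open>The token arrays are overwritten as weights. A vertex passes its two weights to its
  parent if the edge is unblocked; otherwise its component is complete and the two weights are
  compared.\<close>

definition weigh_step :: com where
  "weigh_step =
     AGet vX aOrd vI ;; AGet vP aPar vX ;; AGet vA aBlk vX ;; AGet vB aBlk vP ;; VAdd vC vA vB ;;
      AGet vA aTokB vX ;; AGet vB aTokR vX ;;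
      Cond vC
        (VSub vC vA vB ;; VSub vD vB vA ;; VAdd vC vC vD ;; Cond vC (VConst vAns 0) Skip)
        (AGet vC aTokB vP ;; VAdd vC vC vA ;; APut aTokB vP vC ;;
         AGet vC aTokR vP ;; VAdd vC vC vB ;; APut aTokR vP vC)"

definition weigh :: com where
  "weigh = for_loop vN weigh_step"

context elimination
begin

text \<open>Every edge joins a vertex to its parent, so looking only at parents, in both directions,
  marks the full closed neighbourhood.\<close>

lemma triple_compare:
  assumes R: "Rb \<subseteq> {..<n}" "Rr \<subseteq> {..<n}"
    and s: "var s vN = n" "var s vOne = 1" "arr s aPar = par"
      "arr s aRigB = (\<lambda>x. of_bool (x \<in> Rb))" "arr s aRigR = (\<lambda>x. of_bool (x \<in> Rr))"
      "arr s aBlk = (\<lambda>_. 0)"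
    and B: "n + 2 \<le> B"
  shows "triple B (17 * n + 5) compare (\<lambda>t. var t vAns = of_bool (Rb = Rr) \<and>
    (\<forall>x<n. arr t aBlk x = of_bool (x \<in> blocked E Rb)) \<and> arr t aBlk n = 1) s"
proof -
  define bl where "bl i z \<longleftrightarrow> (\<exists>y<i. (y \<in> Rb \<and> (z = y \<or> z = par y)) \<or> (z = y \<and> par y \<in> Rb))" for i z
  have bl_Suc: "bl (Suc i) z \<longleftrightarrow> bl i z \<or> (i \<in> Rb \<and> (z = i \<or> z = par i)) \<or> (z = i \<and> par i \<in> Rb)" for i z
    unfolding bl_def less_Suc_eq by blast
  define Inv where "Inv i t \<longleftrightarrow> var t vAns = of_bool (\<forall>y<i. y \<in> Rb \<longleftrightarrow> y \<in> Rr) \<and>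
    arr t aBlk = (\<lambda>z. of_bool (bl i z))" for i and t :: state
  have loop: "triple B ((14 + 3) * n + 3) (for_loop vN compare_step) (Inv n) (s\<lparr>var := (var s)(vAns := 1), credit := 0\<rparr>)"
  proof (rule triple_for_loop)
    fix i t assume t: "Inv i t" "i < n" "var t vI = i" "var t vOne = 1"
      and fr: "frame (for_loop vN compare_step) (s\<lparr>var := (var s)(vAns := 1), credit := 0\<rparr>) t"
    have vt: "arr t aPar = par" "arr t aRigB = (\<lambda>x. of_bool (x \<in> Rb))"
      "arr t aRigR = (\<lambda>x. of_bool (x \<in> Rr))"
      using fr s by (auto simp: frame_def for_loop_def compare_step_def)
    have blk: "arr t aBlk = (\<lambda>z. of_bool (bl i z))" "var t vAns = of_bool (\<forall>y<i. y \<in> Rb \<longleftrightarrow> y \<in> Rr)"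
      using t(1) by (auto simp: Inv_def)
    show "triple B 14 compare_step (Inv (Suc i)) t"
      using t(2-4) vt blk B
      by (intro tripleI; cases "i \<in> Rb"; cases "i \<in> Rr"; cases "par i \<in> Rb")
        (auto simp: compare_step_def Inv_def bl_Suc fun_eq_iff less_Suc_eq)
  qed (use s B in \<open>auto simp: Inv_def bl_def compare_step_def\<close>)
  have "triple B (1 + (17 * n + 3 + 1)) compare (\<lambda>t. var t vAns = of_bool (Rb = Rr) \<and>
    (\<forall>x<n. arr t aBlk x = of_bool (x \<in> blocked E Rb)) \<and> arr t aBlk n = 1) s"
    unfolding compare_def
  proof (rule triple_Seq)
    show "triple B 1 (VConst vAns 1) (\<lambda>t. t = s\<lparr>var := (var s)(vAns := 1), credit := 0\<rparr>) s"
      using B by (simp add: triple_def)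
    show "triple B (17 * n + 3 + 1) (for_loop vN compare_step ;; APut aBlk vN vOne)
      (\<lambda>t. var t vAns = of_bool (Rb = Rr) \<and>
        (\<forall>x<n. arr t aBlk x = of_bool (x \<in> blocked E Rb)) \<and> arr t aBlk n = 1) t"
      if "t = s\<lparr>var := (var s)(vAns := 1), credit := 0\<rparr>" for t
      unfolding that
    proof (rule triple_Seq)
      show "triple B (17 * n + 3) (for_loop vN compare_step) (Inv n) (s\<lparr>var := (var s)(vAns := 1), credit := 0\<rparr>)"
        using loop by simp
      fix u assume u: "Inv n u" "frame (for_loop vN compare_step) (s\<lparr>var := (var s)(vAns := 1), credit := 0\<rparr>) u"
      have vu: "var u vN = n" "var u vOne = 1"
        using u(2) s by (auto simp: frame_def for_loop_def compare_step_def)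
      have "(\<forall>y<n. y \<in> Rb \<longleftrightarrow> y \<in> Rr) \<longleftrightarrow> Rb = Rr" using R by blast
      moreover have "bl n x \<longleftrightarrow> x \<in> blocked E Rb" if "x < n" for x
        using that R unfolding bl_def blocked_def edge_iff by blast
      ultimately show "triple B 1 (APut aBlk vN vOne) (\<lambda>t. var t vAns = of_bool (Rb = Rr) \<and>
          (\<forall>x<n. arr t aBlk x = of_bool (x \<in> blocked E Rb)) \<and> arr t aBlk n = 1) u"
        using u(1) vu by (simp add: triple_def Inv_def)
    qed
  qed
  then show ?thesis by (rule triple_conseq) auto
qed

text \<open>The goal stays equivalent to the current answer together with balance on the vertices
  not yet cut off. Each step is \<open>balanced_isolated\<close> or \<open>balanced_leaf\<close>,
  and on the empty rest balance is trivial.\<close>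

lemma triple_weigh:
  assumes F: "F = unblocked_edges E R"
    and s: "var s vN = n" "var s vOne = 1" "arr s aPar = par" "arr s aOrd = ord"
      "\<forall>x<n. arr s aBlk x = of_bool (x \<in> blocked E R)" "arr s aBlk n = 1" "var s vAns = of_bool a"
      "sum (arr s aTokB) {..<n} \<le> n" "sum (arr s aTokR) {..<n} \<le> n"
    and B: "n + 2 \<le> B"
  shows "triple B (17 * n + 3) weigh
    (\<lambda>t. var t vAns = of_bool (a \<and> balanced F {..<n} (arr s aTokB) (arr s aTokR))) s"
proof -
  define goal where "goal \<longleftrightarrow> a \<and> balanced F {..<n} (arr s aTokB) (arr s aTokR)"
  define U where "U i = {..<n} - ord ` {..<i}" for i
  have finU: "finite (U i)" for i by (simp add: U_def)
  \<comment> \<open>The total remaining weight never grows, which bounds every single weight by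
    \<open>n\<close> and keeps the additions below \<open>B\<close>.\<close>
  define Inv where "Inv i t \<longleftrightarrow>
    (\<exists>a'. var t vAns = of_bool a' \<and> (a' \<and> balanced F (U i) (arr t aTokB) (arr t aTokR) \<longleftrightarrow> goal)) \<and>
    sum (arr t aTokB) (U i) \<le> n \<and> sum (arr t aTokR) (U i) \<le> n" for i and t :: state
  have "triple B ((14 + 3) * n + 3) weigh (Inv n) s"
    unfolding weigh_def
  proof (rule triple_for_loop)
    show "Inv 0 s" using s by (auto simp: Inv_def U_def goal_def)
    fix i t assume t: "Inv i t" "i < n" "var t vI = i" "var t vOne = 1"
      and fr: "frame (for_loop vN weigh_step) s t"
    have vt: "arr t aPar = par" "arr t aOrd = ord" "arr t aBlk = arr s aBlk"
      using fr s by (auto simp: frame_def for_loop_def weigh_step_def)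
    define x where "x = ord i"
    define p where "p = par x"
    let ?f = "arr t aTokB" and ?g = "arr t aTokR"
    obtain a' where a': "var t vAns = of_bool a'" "a' \<and> balanced F (U i) ?f ?g \<longleftrightarrow> goal"
      and sums: "sum ?f (U i) \<le> n" "sum ?g (U i) \<le> n"
      using t(1) unfolding Inv_def by blast
    have xU: "x \<in> U i" using t(2) ord_less ord_eq_iff by (auto simp: U_def x_def)
    have US: "U (Suc i) = U i - {x}" by (auto simp: U_def x_def less_Suc_eq)
    have xn: "x < n" and pn: "p \<le> n" using t(2) ord_less par_le by (auto simp: x_def p_def)
    have px: "p \<noteq> x" using par_neq[OF xn] by (simp add: p_def)
    have fx: "h y \<le> n" if "y \<in> U i" "sum h (U i) \<le> n" for h :: "nat \<Rightarrow> nat" and y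
      using member_le_sum[of y "U i" h] that finU by simp
    have only: "y = p \<and> p < n" if "y \<in> U i" "{x, y} \<in> F" for y
    proof -
      have "y \<in> {y. {ord i, y} \<in> E} - ord ` {..<i}"
        using that F by (auto simp: U_def x_def unblocked_edges_def)
      then have "y \<in> {p} - {n}" using par_eq[OF t(2)] by (simp add: x_def p_def)
      then show ?thesis using pn by auto
    qed
    show "triple B 14 weigh_step (Inv (Suc i)) t"
    proof (cases "p = n \<or> x \<in> blocked E R \<or> p \<in> blocked E R")
      case True
      have "arr s aBlk y \<le> 1" if "y \<le> n" for y
        using s(5,6) that by (cases "y = n") auto
      from this[of x] this[of p] have blk: "arr s aBlk x + arr s aBlk p \<le> B" using xn pn B by simp
      have blk': "0 < arr s aBlk x \<or> 0 < arr s aBlk p"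
        using True s(5,6) xn pn by (cases "p = n") auto
      \<comment> \<open>The only candidate for a remaining neighbour is the parent, and here the
        parent is missing or the edge to it is blocked.\<close>
      have "{x, y} \<notin> F" if "y \<in> U i - {x}" for y
        using only[of y] that True F by (auto simp: unblocked_edges_def)
      then have bal: "balanced F (U i) ?f ?g \<longleftrightarrow> ?f x = ?g x \<and> balanced F (U (Suc i)) ?f ?g"
        using balanced_isolated[OF finU xU] unfolding US by blast
      have less: "sum h (U (Suc i)) \<le> n" if "sum h (U i) \<le> n" for h :: "nat \<Rightarrow> nat"
        using that sum_mono2[of "U i" "U (Suc i)" h] finU unfolding US by simp
      have le: "?f x \<le> n" "?g x \<le> n" using fx[OF xU] sums by auto
      have d: "?f x - ?g x + (?g x - ?f x) \<le> B" using le B by auto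
      have cond: "0 < arr s aBlk x + arr s aBlk p" using blk' by auto
      show ?thesis
      proof (cases "?f x = ?g x")
        case True
        then have "a' \<and> balanced F (U (Suc i)) ?f ?g \<longleftrightarrow> goal" using a'(2) bal by blast
        then have "Inv (Suc i) u" if "var u vAns = var t vAns" "arr u = arr t" for u
          using that a'(1) less[OF sums(1)] less[OF sums(2)] unfolding Inv_def by auto
        then show ?thesis
          using t(2-4) vt blk cond True
          by (intro tripleI) (auto simp: weigh_step_def simp flip: x_def p_def simp del: add_gr_0)
      next
        case False
        then have "\<not> goal" using a'(2) bal by auto
        then have "Inv (Suc i) u" if "var u vAns = 0" "arr u = arr t" for u
          using that less[OF sums(1)] less[OF sums(2)] unfolding Inv_def by (auto intro: exI[of _ False])
        moreover have "0 < ?f x - ?g x + (?g x - ?f x)" using False by auto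
        ultimately show ?thesis
          using t(2-4) vt blk cond d False
          by (intro tripleI) (auto simp: weigh_step_def simp flip: x_def p_def simp del: add_gr_0)
      qed
    next
      case False
      then have blk: "arr s aBlk x = 0" "arr s aBlk p = 0" and pn: "p < n"
        using s(5) xn pn by auto
      have "p \<notin> ord ` {..<i}" using par_notin[OF t(2)] by (auto simp: x_def p_def lessThan_Suc)
      then have pU: "p \<in> U i" using pn by (simp add: U_def)
      have "{x, p} \<in> F"
        using False par_edge[OF xn] pn F by (auto simp: unblocked_edges_def p_def)
      then have bal: "balanced F (U i) ?f ?g \<longleftrightarrow>
          balanced F (U (Suc i)) (?f(p := ?f p + ?f x)) (?g(p := ?g p + ?g x))"
        unfolding US using only by (intro balanced_leaf[OF finU xU pU px[symmetric]]) auto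
      have sm: "sum (h(p := h p + h x)) (U (Suc i)) = sum h (U i)" for h :: "nat \<Rightarrow> nat"
      proof -
        have pU': "p \<in> U i - {x}" using pU px by blast
        have "sum (h(p := h p + h x)) (U i - {x} - {p}) = sum h (U i - {x} - {p})"
          by (rule sum.cong) auto
        then show ?thesis
          using sum.remove[OF finU xU, of h] sum.remove[OF _ pU', of h]
            sum.remove[OF _ pU', of "h(p := h p + h x)"] finU unfolding US
          by (simp del: fun_upd_apply add: fun_upd_same)
      qed
      have le: "h p + h x \<le> n" if "sum h (U i) \<le> n" for h :: "nat \<Rightarrow> nat"
      proof -
        have pU': "p \<in> U (Suc i)" using pU px unfolding US by blast
        have "(h(p := h p + h x)) p \<le> sum (h(p := h p + h x)) (U (Suc i))"
          by (rule member_le_sum[OF pU']) (use finU in auto)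
        then show ?thesis using that sm by simp
      qed
      have bounds: "?f p + ?f x \<le> B" "?g p + ?g x \<le> B" using le[OF sums(1)] le[OF sums(2)] B by auto
      have "Inv (Suc i) u"
        if u: "var u vAns = var t vAns" "arr u aTokB = ?f(p := ?f p + ?f x)"
          "arr u aTokR = ?g(p := ?g p + ?g x)" for u
        unfolding Inv_def u sm using a' bal sums by blast
      then show ?thesis
        using t(2-4) vt blk bounds px by (intro tripleI) (simp add: weigh_step_def flip: x_def p_def)
    qed
  qed (use s B in \<open>auto simp: Inv_def weigh_step_def\<close>)
  then show ?thesis
  proof (rule triple_conseq)
    fix t assume "Inv n t"
    moreover have "U n = {}" using bij by (simp add: U_def bij_betw_def)
    moreover have "balanced F {} f g" for f g by (simp add: balanced_def closed_in_def)
    ultimately show "var t vAns = of_bool (a \<and> balanced F {..<n} (arr s aTokB) (arr s aTokR))"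
      by (auto simp: Inv_def goal_def)
  qed simp
qed

end

section \<open>The complete program\<close>

definition sliding_program :: com where
  "sliding_program = VConst vOne 1 ;; VRead vN ;; VRead vLen ;; read_edges ;;
     read_tokens aTokB ;; read_tokens aTokR ;; init_parents ;; eliminate ;; append_roots ;;
     find_rigid aTokB 6 7 8 aRigB ;; find_rigid aTokR 10 11 12 aRigR ;; compare ;; weigh"

lemmas program_defs =
  read_edges_def count_end_def read_tokens_def init_parents_def eliminate_def append_roots_def
  find_rigid_def mark_stuck_def mark_rigid_def compare_def weigh_def for_loop_def eliminate_step_def
  mark_stuck_step_def mark_rigid_step_def compare_step_def weigh_step_def

lemma well_formed_sliding_program: "well_formed sliding_program"
  by (simp add: sliding_program_def program_defs)

text \<open>Adds up the costs of the passes; \<open>frame\<close> carries untouched variables and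
  arrays from one pass to the next. In the bound on numbers, \<open>n * n\<close> accommodates sums
  of neighbours, and \<open>n + 2\<close> the remaining counters and constants.\<close>

lemma triple_sliding_program:
  assumes tree: "tree {..<n} E" and inst: "sliding_token_instance {..<n} E I J"
    and enc: "encodes xs n E I J"
  shows "triple (n * n + n + 2) (173 * n + 54) sliding_program
    (\<lambda>t. var t vAns = of_bool (sliding_token {..<n} E I J)) (initial xs 0)"
proof -
  let ?B = "n * n + n + 2"
  have graph: "simple_graph {..<n} E" using tree unfolding tree_def by blast
  have edge: "x < n \<and> y < n \<and> x \<noteq> y" if "{x, y} \<in> E" for x y
  proof -
    obtain u v where "u < n" "v < n" "u \<noteq> v" "{x, y} = {u, v}"
      using graph \<open>{x, y} \<in> E\<close> unfolding simple_graph_def by blast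
    then show ?thesis by (auto simp: doubleton_eq_iff)
  qed
  have n: "0 < n" using tree unfolding tree_def connected_graph_def by auto
  have br: "bridged E {..<n}"
    using bridged_if_acyclic tree unfolding tree_def by blast
  have ind: "independent_set {..<n} E I" "independent_set {..<n} E J"
    using inst unfolding sliding_token_instance_def by auto
  have sub: "I \<subseteq> {..<n}" "J \<subseteq> {..<n}" using ind unfolding independent_set_def by auto
  obtain es bs rs where es: "distinct (map (\<lambda>(u, v). {u, v}) es)" "set (map (\<lambda>(u, v). {u, v}) es) = E"
    and bs: "distinct bs" "set bs = I" and rs: "distinct rs" "set rs = J"
    and xs: "xs = [n, length es] @ concat (map (\<lambda>(u, v). [u, v]) es)
              @ [length bs] @ bs @ [length rs] @ rs"
    using enc unfolding encodes_def enumerates_def by blast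
  have es_less: "u < n \<and> v < n \<and> u \<noteq> v" if "(u, v) \<in> set es" for u v
    using that es(2) edge by force
  \<comment> \<open>The only place where the input length has to be related to \<open>n\<close>; it
    makes reading the edges linear.\<close>
  have "card E \<le> n"
  proof -
    have "E \<subseteq> {e \<in> E. \<exists>x\<in>{..<n}. \<exists>y\<in>{..<n}. e = {x, y}}"
      using graph unfolding simple_graph_def by blast
    then have "E = {e \<in> E. \<exists>x\<in>{..<n}. \<exists>y\<in>{..<n}. e = {x, y}}" by blast
    then show ?thesis using bridged_edges_card[OF br] by simp
  qed
  then have len: "length es \<le> n" "length bs \<le> n" "length rs \<le> n"
    using es bs rs sub card_mono[of "{..<n}"] distinct_card length_map
    by (metis, metis card_lessThan finite_lessThan, metis card_lessThan finite_lessThan)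
  let ?Q = "\<lambda>t. var t vAns = of_bool (sliding_token {..<n} E I J)"
  let ?s1 = "(initial xs 0)\<lparr>var := (\<lambda>_. 0)(vOne := 1)\<rparr>"
  let ?s2 = "?s1\<lparr>var := (\<lambda>_. 0)(vOne := 1, vN := n), input := tl xs\<rparr>"
  let ?s3 = "?s2\<lparr>var := (\<lambda>_. 0)(vOne := 1, vN := n, vLen := length es), input := tl (tl xs)\<rparr>"
  have "triple ?B (1 + (1 + (1 + (17 * n + 3 + (5 * n + 4 + (5 * n + 4 + (4 * n + 3 + (40 * n + 5 +
      (8 * n + 3 + (30 * n + 8 + (30 * n + 8 + (17 * n + 5 + (17 * n + 3))))))))))))) sliding_program ?Q
      (initial xs 0)"
    unfolding sliding_program_def
  proof (rule triple_Seq_exact[of _ _ _ ?s1], simp add: triple_def initial_def,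
      rule triple_Seq_exact[of _ _ _ ?s2], simp add: triple_def initial_def xs,
      rule triple_Seq_exact[of _ _ _ ?s3], use len in \<open>simp add: triple_def initial_def xs\<close>,
      rule triple_Seq)
    show "triple ?B (17 * n + 3) read_edges
      (\<lambda>t. input t = length bs # bs @ length rs # rs \<and>
         (\<forall>x. arr t aDeg x = card (nbrs E x) \<and> arr t aSum x = \<Sum>(nbrs E x))) ?s3"
      by (rule triple_conseq[OF triple_read_edges[where es = es and n = n and
            rest = "length bs # bs @ length rs # rs"]])
        (use es es_less len in \<open>auto simp: initial_def xs\<close>)
    fix t4 assume t4: "input t4 = length bs # bs @ length rs # rs \<and>
         (\<forall>x. arr t4 aDeg x = card (nbrs E x) \<and> arr t4 aSum x = \<Sum>(nbrs E x))"
      "frame read_edges ?s3 t4"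
    have v4: "var t4 vOne = 1" "var t4 vN = n" "var t4 vZero = 0"
      "\<And>a. a \<notin> {aDeg, aSum} \<Longrightarrow> arr t4 a = (\<lambda>_. 0)"
      using t4(2) by (auto simp: frame_def program_defs initial_def)
    show "triple ?B (5 * n + 4 + (5 * n + 4 + (4 * n + 3 + (40 * n + 5 +
      (8 * n + 3 + (30 * n + 8 + (30 * n + 8 + (17 * n + 5 + (17 * n + 3)))))))))
      (read_tokens aTokB ;; read_tokens aTokR ;; init_parents ;; eliminate ;; append_roots ;;
       find_rigid aTokB 6 7 8 aRigB ;; find_rigid aTokR 10 11 12 aRigR ;; compare ;; weigh) ?Q t4"
    proof (rule triple_Seq)
      show "triple ?B (5 * n + 4) (read_tokens aTokB)
        (\<lambda>t. input t = length rs # rs \<and> arr t aTokB = (\<lambda>x. of_bool (x \<in> I))) t4"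
        by (rule triple_conseq[OF triple_read_tokens[where bs = bs and n = n and rest = "length rs # rs"]])
          (use bs sub len t4(1) v4 in \<open>auto simp: fun_eq_iff\<close>)
      fix t5 assume t5: "input t5 = length rs # rs \<and> arr t5 aTokB = (\<lambda>x. of_bool (x \<in> I))"
        "frame (read_tokens aTokB) t4 t5"
      have v5: "var t5 vOne = 1" "var t5 vN = n" "var t5 vZero = 0"
        "arr t5 aDeg = arr t4 aDeg" "arr t5 aSum = arr t4 aSum"
        "\<And>a. a \<notin> {aDeg, aSum, aTokB} \<Longrightarrow> arr t5 a = (\<lambda>_. 0)"
        using t5(2) v4 by (auto simp: frame_def program_defs)
      show "triple ?B (5 * n + 4 + (4 * n + 3 + (40 * n + 5 +
        (8 * n + 3 + (30 * n + 8 + (30 * n + 8 + (17 * n + 5 + (17 * n + 3))))))))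
        (read_tokens aTokR ;; init_parents ;; eliminate ;; append_roots ;;
         find_rigid aTokB 6 7 8 aRigB ;; find_rigid aTokR 10 11 12 aRigR ;; compare ;; weigh) ?Q t5"
      proof (rule triple_Seq)
        show "triple ?B (5 * n + 4) (read_tokens aTokR) (\<lambda>t. arr t aTokR = (\<lambda>x. of_bool (x \<in> J))) t5"
          by (rule triple_conseq[OF triple_read_tokens[where bs = rs and n = n and rest = "[]"]])
            (use rs sub len t5(1) v5 in \<open>auto simp: fun_eq_iff\<close>)
        fix t6 assume t6: "arr t6 aTokR = (\<lambda>x. of_bool (x \<in> J))" "frame (read_tokens aTokR) t5 t6"
        have v6: "var t6 vOne = 1" "var t6 vN = n" "var t6 vZero = 0"
          "arr t6 aDeg = arr t4 aDeg" "arr t6 aSum = arr t4 aSum" "arr t6 aTokB = arr t5 aTokB"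
          "\<And>a. a \<notin> {aDeg, aSum, aTokB, aTokR} \<Longrightarrow> arr t6 a = (\<lambda>_. 0)"
          using t6(2) v5 by (auto simp: frame_def program_defs)
        show "triple ?B (4 * n + 3 + (40 * n + 5 +
          (8 * n + 3 + (30 * n + 8 + (30 * n + 8 + (17 * n + 5 + (17 * n + 3)))))))
          (init_parents ;; eliminate ;; append_roots ;;
           find_rigid aTokB 6 7 8 aRigB ;; find_rigid aTokR 10 11 12 aRigR ;; compare ;; weigh) ?Q t6"
        proof (rule triple_Seq)
          show "triple ?B (4 * n + 3) init_parents (\<lambda>t. \<forall>x<n. arr t aPar x = n) t6"
            using v6 by (intro triple_init_parents) auto
          fix t7 assume t7: "\<forall>x<n. arr t7 aPar x = n" "frame init_parents t6 t7"
          have v7: "var t7 vOne = 1" "var t7 vN = n" "var t7 vZero = 0"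
            "arr t7 aDeg = arr t4 aDeg" "arr t7 aSum = arr t4 aSum" "arr t7 aTokB = arr t5 aTokB"
            "arr t7 aTokR = arr t6 aTokR"
            "\<And>a. a \<notin> {aDeg, aSum, aTokB, aTokR, aPar} \<Longrightarrow> arr t7 a = (\<lambda>_. 0)"
            using t7(2) v6 by (auto simp: frame_def program_defs)
          show "triple ?B (40 * n + 5 + (8 * n + 3 + (30 * n + 8 + (30 * n + 8 + (17 * n + 5 + (17 * n + 3))))))
            (eliminate ;; append_roots ;;
             find_rigid aTokB 6 7 8 aRigB ;; find_rigid aTokR 10 11 12 aRigR ;; compare ;; weigh) ?Q t7"
          proof (rule triple_Seq)
            show "triple ?B (40 * n + 5) eliminate
              (\<lambda>t. \<exists>deg sm. eliminating n E (var t vK) (arr t aOrd) (arr t aPar) deg sm \<and>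
                (\<forall>y<n. y \<notin> arr t aOrd ` {..<var t vK} \<longrightarrow> nbrs E y \<subseteq> arr t aOrd ` {..<var t vK})) t7"
              using v7 t4 t7 n by (intro triple_eliminate[OF edge br]) auto
            fix t8 assume t8: "\<exists>deg sm. eliminating n E (var t8 vK) (arr t8 aOrd) (arr t8 aPar) deg sm \<and>
                (\<forall>y<n. y \<notin> arr t8 aOrd ` {..<var t8 vK} \<longrightarrow> nbrs E y \<subseteq> arr t8 aOrd ` {..<var t8 vK})"
              "frame eliminate t7 t8"
            have v8: "var t8 vOne = 1" "var t8 vN = n"
              "arr t8 aTokB = arr t5 aTokB" "arr t8 aTokR = arr t6 aTokR"
              "\<And>a. a \<notin> {aDeg, aSum, aTokB, aTokR, aPar, aOrd} \<Longrightarrow> arr t8 a = (\<lambda>_. 0)"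
              using t8(2) v7 by (auto simp: frame_def program_defs)
            show "triple ?B (8 * n + 3 + (30 * n + 8 + (30 * n + 8 + (17 * n + 5 + (17 * n + 3)))))
              (append_roots ;;
               find_rigid aTokB 6 7 8 aRigB ;; find_rigid aTokR 10 11 12 aRigR ;; compare ;; weigh) ?Q t8"
            proof (rule triple_Seq)
              show "triple ?B (8 * n + 3) append_roots (\<lambda>t. elimination n E (arr t8 aPar) (arr t aOrd)) t8"
              proof -
                obtain deg sm where el: "eliminating n E (var t8 vK) (arr t8 aOrd) (arr t8 aPar) deg sm"
                  using t8(1) by blast
                show ?thesis
                  by (rule triple_append_roots[where s = t8 and B = ?B, OF edge el]) (use t8(1) v8 in auto)
              qed
              fix t9 assume t9: "elimination n E (arr t8 aPar) (arr t9 aOrd)" "frame append_roots t8 t9"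
              have v9: "var t9 vOne = 1" "var t9 vN = n" "arr t9 aPar = arr t8 aPar"
                "arr t9 aTokB = arr t5 aTokB" "arr t9 aTokR = arr t6 aTokR"
                "\<And>a. a \<notin> {aDeg, aSum, aTokB, aTokR, aPar, aOrd} \<Longrightarrow> arr t9 a = (\<lambda>_. 0)"
                using t9(2) v8 by (auto simp: frame_def program_defs)
              interpret elimination n E "arr t8 aPar" "arr t9 aOrd" by (rule t9(1))
              show "triple ?B (30 * n + 8 + (30 * n + 8 + (17 * n + 5 + (17 * n + 3))))
                (find_rigid aTokB 6 7 8 aRigB ;; find_rigid aTokR 10 11 12 aRigR ;; compare ;; weigh) ?Q t9"
              proof (rule triple_Seq)
                show "triple ?B (30 * n + 8) (find_rigid aTokB 6 7 8 aRigB)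
                  (\<lambda>t. arr t aRigB = (\<lambda>x. of_bool (x \<in> rigid E {..<n} I))) t9"
                  using sub t5(1) v9 n by (intro triple_find_rigid) auto
                fix t10 assume t10: "arr t10 aRigB = (\<lambda>x. of_bool (x \<in> rigid E {..<n} I))"
                  "frame (find_rigid aTokB 6 7 8 aRigB) t9 t10"
                have v10: "var t10 vOne = 1" "var t10 vN = n" "arr t10 aPar = arr t8 aPar"
                  "arr t10 aOrd = arr t9 aOrd"
                  "arr t10 aTokB = arr t5 aTokB" "arr t10 aTokR = arr t6 aTokR"
                  "\<And>a. a \<in> {10, 11, 12, aRigR, aBlk} \<Longrightarrow> arr t10 a = (\<lambda>_. 0)"
                  using t10(2) v9 by (auto simp: frame_def program_defs)
                show "triple ?B (30 * n + 8 + (17 * n + 5 + (17 * n + 3)))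
                  (find_rigid aTokR 10 11 12 aRigR ;; compare ;; weigh) ?Q t10"
                proof (rule triple_Seq)
                  show "triple ?B (30 * n + 8) (find_rigid aTokR 10 11 12 aRigR)
                    (\<lambda>t. arr t aRigR = (\<lambda>x. of_bool (x \<in> rigid E {..<n} J))) t10"
                    using sub t6(1) v10 n by (intro triple_find_rigid) auto
                  fix t11 assume t11: "arr t11 aRigR = (\<lambda>x. of_bool (x \<in> rigid E {..<n} J))"
                    "frame (find_rigid aTokR 10 11 12 aRigR) t10 t11"
                  have v11: "var t11 vOne = 1" "var t11 vN = n" "arr t11 aPar = arr t8 aPar"
                    "arr t11 aOrd = arr t9 aOrd" "arr t11 aRigB = arr t10 aRigB"
                    "arr t11 aTokB = arr t5 aTokB" "arr t11 aTokR = arr t6 aTokR"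
                    "arr t11 aBlk = (\<lambda>_. 0)"
                    using t11(2) v10 by (auto simp: frame_def program_defs)
                  let ?R = "rigid E {..<n} I"
                  show "triple ?B (17 * n + 5 + (17 * n + 3)) (compare ;; weigh) ?Q t11"
                  proof (rule triple_Seq)
                    show "triple ?B (17 * n + 5) compare (\<lambda>t. var t vAns = of_bool (?R = rigid E {..<n} J) \<and>
                      (\<forall>x<n. arr t aBlk x = of_bool (x \<in> blocked E ?R)) \<and> arr t aBlk n = 1) t11"
                      using v11 t10(1) t11(1) rigid_subset[of E "{..<n}"] by (intro triple_compare) auto
                    fix t12 assume t12: "var t12 vAns = of_bool (?R = rigid E {..<n} J) \<and>
                      (\<forall>x<n. arr t12 aBlk x = of_bool (x \<in> blocked E ?R)) \<and> arr t12 aBlk n = 1"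
                      "frame compare t11 t12"
                    have v12: "var t12 vOne = 1" "var t12 vN = n" "arr t12 aPar = arr t8 aPar"
                      "arr t12 aOrd = arr t9 aOrd"
                      "arr t12 aTokB = (\<lambda>x. of_bool (x \<in> I))" "arr t12 aTokR = (\<lambda>x. of_bool (x \<in> J))"
                      using t12(2) v11 t5(1) t6(1) by (auto simp: frame_def program_defs)
                    have sum: "sum (\<lambda>x. of_bool (x \<in> K)) C = card (K \<inter> C)" if "finite C" for K C :: "nat set"
                      using that by (simp add: Int_commute)
                    \<comment> \<open>Summing the indicator functions over a closed set gives its
                      token counts, so balance of the arrays is the counting condition of
                      \<open>reach_iff\<close>.\<close>
                    have "sliding_token {..<n} E I J \<longleftrightarrow> ?R = rigid E {..<n} J \<and>
                      balanced (unblocked_edges E ?R) {..<n} (arr t12 aTokB) (arr t12 aTokR)"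
                      unfolding sliding_token_iff_reach[OF inst] reach_iff[OF br finite_lessThan ind]
                        balanced_def v12
                      using sum closed_in_finite[of _ "{..<n}"] by (metis (no_types, lifting) finite_lessThan)
                    moreover have "triple ?B (17 * n + 3) weigh (\<lambda>t. var t vAns = of_bool (?R = rigid E {..<n} J \<and>
                        balanced (unblocked_edges E ?R) {..<n} (arr t12 aTokB) (arr t12 aTokR))) t12"
                    proof (rule triple_weigh[OF refl])
                      show "sum (arr t12 aTokB) {..<n} \<le> n" "sum (arr t12 aTokR) {..<n} \<le> n"
                        unfolding v12 sum[OF finite_lessThan]
                        by (metis card_lessThan card_mono finite_lessThan inf_le2)+
                    qed (use v12 t12(1) in auto)
                    ultimately show "triple ?B (17 * n + 3) weigh ?Q t12" by simp
                  qed
                qed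
              qed
            qed
          qed
        qed
      qed
    qed
  qed
  then show ?thesis by (rule triple_conseq) auto
qed

theorem theorem1:
  shows "\<exists>(P :: program) (T :: nat \<Rightarrow> nat) (w :: nat \<Rightarrow> nat).
    (\<lambda>n. real (T n)) \<in> O(\<lambda>n. real n) \<and>
    (\<lambda>n. real (w n)) \<in> O(\<lambda>n. ln (real n)) \<and>
    (\<forall>n E I\<^sub>b I\<^sub>r inp.
       tree {0..<n} E \<and> sliding_token_instance {0..<n} E I\<^sub>b I\<^sub>r \<and> encodes inp n E I\<^sub>b I\<^sub>r \<longrightarrow>
       decides_within P (w n) (T n) inp (sliding_token {0..<n} E I\<^sub>b I\<^sub>r))"
proof (intro exI conjI allI impI)
  let ?T = "\<lambda>n :: nat. 7 * (173 * n + 54)"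
  let ?L = "\<lambda>n :: nat. nat \<lceil>log 2 (real n + 1)\<rceil>"
  \<comment> \<open>Two logarithms cover \<open>(n + 1) * (n + 1)\<close>, and 7 further bits the
    factor 128 that dominates \<open>16 * ?B + 48\<close>.\<close>
  let ?w = "\<lambda>n. 7 + 2 * ?L n"
  show "(\<lambda>n. real (?T n)) \<in> O(\<lambda>n. real n)"
    \<comment> \<open>The constant is \<open>7 * (173 + 54)\<close>, valid from \<open>n = 1\<close>
      on.\<close>
    by (intro bigoI[of _ 1589] eventually_sequentiallyI[of 1]) auto
  show "(\<lambda>n. real (?w n)) \<in> O(\<lambda>n. ln (real n))"
  proof (rule landau_o.big_trans)
    \<comment> \<open>Rounding up costs at most 1 in each of the two logarithms, hence 9 instead of
      7.\<close>
    show "(\<lambda>n. real (?w n)) \<in> O(\<lambda>n. 9 + 2 * log 2 (real n + 1))"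
    proof (intro bigoI[of _ 1] always_eventually allI)
      fix n :: nat
      have "0 \<le> log 2 (real n + 1)" by simp
      moreover from this have "real (?L n) \<le> log 2 (real n + 1) + 1" by linarith
      moreover have "norm (real (7 + 2 * m)) \<le> 1 * norm (9 + 2 * l)"
        if "0 \<le> l" "real m \<le> l + 1" for m :: nat and l :: real
        using that by simp
      ultimately show "norm (real (?w n)) \<le> 1 * norm (9 + 2 * log 2 (real n + 1))" by blast
    qed
    show "(\<lambda>n. 9 + 2 * log 2 (real n + 1)) \<in> O(\<lambda>n. ln (real n))"
      unfolding log_def by real_asymp
  qed
  fix n E I\<^sub>b I\<^sub>r inp
  assume *: "tree {0..<n} E \<and> sliding_token_instance {0..<n} E I\<^sub>b I\<^sub>r \<and> encodes inp n E I\<^sub>b I\<^sub>r"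
  let ?B = "n * n + n + 2" and ?b = "sliding_token {0..<n} E I\<^sub>b I\<^sub>r"
  have "triple ?B (173 * n + 54) sliding_program (\<lambda>t. var t vAns = of_bool ?b) (initial inp 0)"
    using * triple_sliding_program by (simp add: atLeast0LessThan)
  then have "wp ?B sliding_program (\<lambda>t. var (t\<lparr>credit := 0\<rparr>) vAns = of_bool ?b \<and> 0 \<le> credit t)
      ((initial inp 0)\<lparr>credit := 173 * n + 54 + 0\<rparr>)"
    unfolding triple_def by blast
  then have wp: "wp ?B sliding_program (\<lambda>t. var t 0 = (if ?b then 1 else 0)) (initial inp (173 * n + 54))"
    by (simp add: initial_def of_bool_def)
  have "real n + 1 = 2 powr log 2 (real n + 1)" by simp
  also have "\<dots> \<le> 2 powr real (?L n)" by (intro powr_mono) linarith+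
  also have "\<dots> = real (2 ^ ?L n)" by (subst powr_realpow) simp_all
  finally have "real (n + 1) \<le> real (2 ^ ?L n)" by (simp only: of_nat_add of_nat_1)
  then have "n + 1 \<le> 2 ^ ?L n" by (simp only: of_nat_le_iff)
  then have "(n + 1) * (n + 1) \<le> 2 ^ ?L n * 2 ^ ?L n" by (intro mult_mono) auto
  also have "\<dots> = 2 ^ (2 * ?L n)" by (simp add: mult_2 power_add)
  finally have "128 * ((n + 1) * (n + 1)) \<le> 2 ^ ?w n" by (simp add: power_add)
  moreover have "16 * ?B + 48 < 128 * ((n + 1) * (n + 1))" by (simp add: algebra_simps)
  ultimately have "16 * ?B + 48 < 2 ^ ?w n" by linarith
  then show "decides_within (compile 0 sliding_program) (?w n) (?T n) inp ?b"
    by (rule decides_within_if_wp[OF well_formed_sliding_program wp])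
qed

end
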